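(* Let $G$ be a group, let $n$ be a positive integer, and let ${\rm Rep}_n(G)$ be the representation variety of degree $n$ for $G$ over $\mathbb{Z}$. For every integer $m$ with $0<m<n$, the absolutely $m$-thick representations in ${\rm Rep}_n(G)$ form an open subscheme of ${\rm Rep}_n(G)$; that is, the set of points $x\in {\rm Rep}_n(G)$ whose associated representation $\rho_x : G\to {\rm GL}_n(k(x))$ is absolutely $m$-thick is open. In particular, the absolutely thick representations in ${\rm Rep}_n(G)$ form an open subscheme of ${\rm Rep}_n(G)$.
   Context: ${\rm Rep}_n(G)$ is the affine scheme over $\mathbb{Z}$ representing the contravariant functor from schemes to sets sending $X$ to the set of group homomorphisms $\rho: G\to {\rm GL}_n(\Gamma(X,\mathcal{O}_X))$. A point $x\in{\rm Rep}_n(G)$ with residue field $k(x)$ determines a representation $\rho_x: G\to{\rm GL}_n(k(x))$ (the specialization of the universal representation). Let $V$ be an $n$-dimensional vector space over a field $k$ and $\rho: G\to {\rm GL}(V)$ a representation. $\rho$ is $m$-thick if for all subspaces $V_1,V_2\subseteq V$ with $\dim V_1=m$ and $\dim V_2=n-m$ there exists $g\in G$ with $(\rho(g)V_1)\oplus V_2=V$. $\rho$ is thick if it is $m$-thick for each $0<m<n$. $\rho$ is absolutely $m$-thick (resp. absolutely thick) if $\rho\otimes_k\overline{k}: G\to{\rm GL}(V\otimes_k\overline{k})$ is $m$-thick (resp. thick), where $\overline{k}$ is an algebraic closure of $k$. *)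

theory Defs
  imports
    "Jordan_Normal_Form.Missing_VectorSpace"
    "HOL-Algebra.Algebraic_Closure"
    "HOL-Library.Poly_Mapping"
    "HOL-Analysis.Abstract_Topology"
begin

hide_const (open) Multiset.mult

section \<open>Thick representations over a field\<close>

text \<open>\<open>thick_at G K V \<rho> m\<close> is \<open>m\<close>-thickness of \<open>\<rho> : G \<rightarrow> GL(V)\<close>; the library keeps subspaces as carrier
  sets, so \<open>dim V1\<close> is the dimension of \<open>V\<close> with its carrier replaced by \<open>V1\<close>.\<close>

definition internal_direct_sum ::
    "('k, 'e) ring_scheme \<Rightarrow> ('k, 'c, 'f) module_scheme \<Rightarrow> 'c set \<Rightarrow> 'c set \<Rightarrow> bool" where
  "internal_direct_sum K V V1 V2 \<longleftrightarrow>
     VectorSpace.subspace K V1 V \<and> VectorSpace.subspace K V2 V \<and>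
     LinearCombinations.module.submodule_sum V V1 V2 = carrier V \<and> V1 \<inter> V2 = {\<zero>\<^bsub>V\<^esub>}"

definition thick_at ::
    "('g, 'h) monoid_scheme \<Rightarrow> ('k, 'e) ring_scheme \<Rightarrow> ('k, 'c, 'f) module_scheme \<Rightarrow>
     ('g \<Rightarrow> 'c \<Rightarrow> 'c) \<Rightarrow> nat \<Rightarrow> bool" where
  "thick_at G K V \<rho> m \<longleftrightarrow>
     (\<forall>V1 V2. VectorSpace.subspace K V1 V \<longrightarrow> VectorSpace.subspace K V2 V \<longrightarrow>
        vectorspace.dim K (V\<lparr>carrier := V1\<rparr>) = m \<longrightarrow>
        vectorspace.dim K (V\<lparr>carrier := V2\<rparr>) = vectorspace.dim K V - m \<longrightarrow>
        (\<exists>g\<in>carrier G. internal_direct_sum K V (\<rho> g ` V1) V2))"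

definition thick ::
    "('g, 'h) monoid_scheme \<Rightarrow> ('k, 'e) ring_scheme \<Rightarrow> ('k, 'c, 'f) module_scheme \<Rightarrow>
     ('g \<Rightarrow> 'c \<Rightarrow> 'c) \<Rightarrow> bool" where
  "thick G K V \<rho> \<longleftrightarrow> (\<forall>m. 0 < m \<and> m < vectorspace.dim K V \<longrightarrow> thick_at G K V \<rho> m)"

section \<open>Matrices\<close>

text \<open>An \<open>n \<times> n\<close> matrix is an extensional function on \<open>{..<n} \<times> {..<n}\<close>.\<close>

abbreviation mat_index :: "nat \<Rightarrow> (nat \<times> nat) set" where
  "mat_index n \<equiv> {..<n} \<times> {..<n}"

definition mat_monoid :: "nat \<Rightarrow> ('a, 'e) ring_scheme \<Rightarrow> (nat \<times> nat \<Rightarrow> 'a) monoid" where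
  "mat_monoid n R =
     \<lparr> carrier = mat_index n \<rightarrow>\<^sub>E carrier R,
       mult = (\<lambda>A B. \<lambda>(i, j)\<in>mat_index n. \<Oplus>\<^bsub>R\<^esub>k\<in>{..<n}. A (i, k) \<otimes>\<^bsub>R\<^esub> B (k, j)),
       one = (\<lambda>(i, j)\<in>mat_index n. if i = j then \<one>\<^bsub>R\<^esub> else \<zero>\<^bsub>R\<^esub>) \<rparr>"

definition GL :: "nat \<Rightarrow> ('a, 'e) ring_scheme \<Rightarrow> (nat \<times> nat \<Rightarrow> 'a) monoid" where
  "GL n R = units_of (mat_monoid n R)"

definition mat_map :: "nat \<Rightarrow> ('a \<Rightarrow> 'b) \<Rightarrow> (nat \<times> nat \<Rightarrow> 'a) \<Rightarrow> nat \<times> nat \<Rightarrow> 'b" where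
  "mat_map n \<phi> A = (\<lambda>x\<in>mat_index n. \<phi> (A x))"

abbreviation std_space :: "nat \<Rightarrow> ('a, 'e) ring_scheme \<Rightarrow> ('a, nat \<Rightarrow> 'a) module" where
  "std_space n R \<equiv> ring.func_space R {..<n}"

definition mat_apply ::
    "nat \<Rightarrow> ('a, 'e) ring_scheme \<Rightarrow> (nat \<times> nat \<Rightarrow> 'a) \<Rightarrow> (nat \<Rightarrow> 'a) \<Rightarrow> nat \<Rightarrow> 'a" where
  "mat_apply n R A v = (\<lambda>i\<in>{..<n}. \<Oplus>\<^bsub>R\<^esub>j\<in>{..<n}. A (i, j) \<otimes>\<^bsub>R\<^esub> v j)"

text \<open>For \<open>\<rho> : G \<rightarrow> GL_n(K)\<close>, i.e. \<open>V = K^n\<close>, the representation \<open>\<rho> \<otimes> L\<close> on \<open>V \<otimes> L = L^n\<close>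
  is given by the matrices of \<open>\<rho>\<close> read in the algebraic closure \<open>L\<close>.
  The embedding of \<open>K\<close> into \<open>field.alg_closure K\<close> is \<open>ring.indexed_const K\<close>,
  see \<open>field.alg_closureE\<close>.\<close>

definition closure_rep ::
    "('k, 'e) ring_scheme \<Rightarrow> nat \<Rightarrow> ('g \<Rightarrow> nat \<times> nat \<Rightarrow> 'k) \<Rightarrow>
     'g \<Rightarrow> (nat \<Rightarrow> ('k list \<times> nat) multiset \<Rightarrow> 'k) \<Rightarrow> nat \<Rightarrow> ('k list \<times> nat) multiset \<Rightarrow> 'k" where
  "closure_rep K n \<rho> g = mat_apply n (field.alg_closure K) (mat_map n (ring.indexed_const K) (\<rho> g))"

definition absolutely_thick_at ::
    "('g, 'h) monoid_scheme \<Rightarrow> ('k, 'e) ring_scheme \<Rightarrow> nat \<Rightarrow> ('g \<Rightarrow> nat \<times> nat \<Rightarrow> 'k) \<Rightarrow> nat \<Rightarrow> bool" where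
  "absolutely_thick_at G K n \<rho> m \<longleftrightarrow>
     thick_at G (field.alg_closure K) (std_space n (field.alg_closure K)) (closure_rep K n \<rho>) m"

definition absolutely_thick ::
    "('g, 'h) monoid_scheme \<Rightarrow> ('k, 'e) ring_scheme \<Rightarrow> nat \<Rightarrow> ('g \<Rightarrow> nat \<times> nat \<Rightarrow> 'k) \<Rightarrow> bool" where
  "absolutely_thick G K n \<rho> \<longleftrightarrow>
     thick G (field.alg_closure K) (std_space n (field.alg_closure K)) (closure_rep K n \<rho>)"

section \<open>Affine schemes\<close>

definition Spec :: "('a, 'e) ring_scheme \<Rightarrow> 'a set set" where
  "Spec A = {p. primeideal p A}"

definition vanishing_set :: "('a, 'e) ring_scheme \<Rightarrow> 'a set \<Rightarrow> 'a set set" where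
  "vanishing_set A E = {p \<in> Spec A. E \<subseteq> p}"

definition zariski :: "('a, 'e) ring_scheme \<Rightarrow> 'a set topology" where
  "zariski A = topology (\<lambda>U. \<exists>E\<subseteq>carrier A. U = Spec A - vanishing_set A E)"

text \<open>Fraction field of a domain; \<open>fraction D a b\<close> is the class \<open>a/b\<close> of the pair \<open>(a, b)\<close>.\<close>

definition fraction :: "('a, 'e) ring_scheme \<Rightarrow> 'a \<Rightarrow> 'a \<Rightarrow> ('a \<times> 'a) set" where
  "fraction D a b =
     {(c, d). c \<in> carrier D \<and> d \<in> carrier D - {\<zero>\<^bsub>D\<^esub>} \<and> a \<otimes>\<^bsub>D\<^esub> d = c \<otimes>\<^bsub>D\<^esub> b}"

definition fraction_field :: "('a, 'e) ring_scheme \<Rightarrow> ('a \<times> 'a) set ring" where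
  "fraction_field D =
     \<lparr> carrier = {fraction D a b | a b. a \<in> carrier D \<and> b \<in> carrier D - {\<zero>\<^bsub>D\<^esub>}},
       mult = (\<lambda>P Q. {z. \<exists>(a, b)\<in>P. \<exists>(c, d)\<in>Q. z \<in> fraction D (a \<otimes>\<^bsub>D\<^esub> c) (b \<otimes>\<^bsub>D\<^esub> d)}),
       one = fraction D \<one>\<^bsub>D\<^esub> \<one>\<^bsub>D\<^esub>,
       zero = fraction D \<zero>\<^bsub>D\<^esub> \<one>\<^bsub>D\<^esub>,
       add = (\<lambda>P Q. {z. \<exists>(a, b)\<in>P. \<exists>(c, d)\<in>Q.
                z \<in> fraction D (a \<otimes>\<^bsub>D\<^esub> d \<oplus>\<^bsub>D\<^esub> c \<otimes>\<^bsub>D\<^esub> b) (b \<otimes>\<^bsub>D\<^esub> d)}) \<rparr>"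

text \<open>The residue field of \<open>Spec A\<close> at \<open>p\<close>, in the form \<open>Frac (A/p)\<close>, and the specialization
  map \<open>A \<rightarrow> k(p)\<close>.\<close>

definition residue_field :: "('a, 'e) ring_scheme \<Rightarrow> 'a set \<Rightarrow> ('a set \<times> 'a set) set ring" where
  "residue_field A p = fraction_field (A Quot p)"

definition to_residue_field :: "('a, 'e) ring_scheme \<Rightarrow> 'a set \<Rightarrow> 'a \<Rightarrow> ('a set \<times> 'a set) set" where
  "to_residue_field A p a = fraction (A Quot p) (p +>\<^bsub>A\<^esub> a) \<one>\<^bsub>A Quot p\<^esub>"

section \<open>The representation variety\<close>

text \<open>\<open>\<int>[X_v | v \<in> S]\<close>: a monomial is a finitely supported exponent function.\<close>

type_synonym 'v int_poly = "('v \<Rightarrow>\<^sub>0 nat) \<Rightarrow>\<^sub>0 int"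

definition int_poly_ring :: "'v set \<Rightarrow> 'v int_poly ring" where
  "int_poly_ring S =
     \<lparr> carrier = {p. \<forall>m\<in>Poly_Mapping.keys p. Poly_Mapping.keys m \<subseteq> S}, mult = (*), one = 1, zero = 0, add = (+) \<rparr>"

definition poly_var :: "'v \<Rightarrow> 'v int_poly" where
  "poly_var v = Poly_Mapping.single (Poly_Mapping.single v 1) 1"

type_synonym 'g rep_poly = "('g \<times> nat \<times> nat) int_poly"

definition rep_poly_ring :: "nat \<Rightarrow> ('g, 'h) monoid_scheme \<Rightarrow> 'g rep_poly ring" where
  "rep_poly_ring n G = int_poly_ring (carrier G \<times> mat_index n)"

definition generic_mat :: "nat \<Rightarrow> 'g \<Rightarrow> nat \<times> nat \<Rightarrow> 'g rep_poly" where
  "generic_mat n g = (\<lambda>(i, j)\<in>mat_index n. poly_var (g, i, j))"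

definition rep_relations :: "nat \<Rightarrow> ('g, 'h) monoid_scheme \<Rightarrow> 'g rep_poly set" where
  "rep_relations n G =
     (let P = rep_poly_ring n G; M = mat_monoid n P in
      {generic_mat n (g \<otimes>\<^bsub>G\<^esub> h) x \<ominus>\<^bsub>P\<^esub> (generic_mat n g \<otimes>\<^bsub>M\<^esub> generic_mat n h) x | g h x.
         g \<in> carrier G \<and> h \<in> carrier G \<and> x \<in> mat_index n} \<union>
      {generic_mat n \<one>\<^bsub>G\<^esub> x \<ominus>\<^bsub>P\<^esub> \<one>\<^bsub>M\<^esub> x | x. x \<in> mat_index n})"

definition rep_ideal :: "nat \<Rightarrow> ('g, 'h) monoid_scheme \<Rightarrow> 'g rep_poly set" where
  "rep_ideal n G = genideal (rep_poly_ring n G) (rep_relations n G)"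

definition rep_ring :: "nat \<Rightarrow> ('g, 'h) monoid_scheme \<Rightarrow> 'g rep_poly set ring" where
  "rep_ring n G = rep_poly_ring n G Quot rep_ideal n G"

definition universal_rep ::
    "nat \<Rightarrow> ('g, 'h) monoid_scheme \<Rightarrow> 'g \<Rightarrow> nat \<times> nat \<Rightarrow> 'g rep_poly set" where
  "universal_rep n G g =
     mat_map n (\<lambda>a. rep_ideal n G +>\<^bsub>rep_poly_ring n G\<^esub> a) (generic_mat n g)"

text \<open>\<open>Rep_n(G) = Spec (rep_ring n G)\<close> as a topological space, and \<open>\<rho>_x\<close> for a point \<open>x\<close>.\<close>

definition Rep :: "nat \<Rightarrow> ('g, 'h) monoid_scheme \<Rightarrow> 'g rep_poly set set topology" where
  "Rep n G = zariski (rep_ring n G)"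

abbreviation residue_field_at where
  "residue_field_at n G x \<equiv> residue_field (rep_ring n G) x"

definition rep_at ::
    "nat \<Rightarrow> ('g, 'h) monoid_scheme \<Rightarrow> 'g rep_poly set set \<Rightarrow> 'g \<Rightarrow>
     nat \<times> nat \<Rightarrow> ('g rep_poly set set \<times> 'g rep_poly set set) set" where
  "rep_at n G x g = mat_map n (to_residue_field (rep_ring n G) x) (universal_rep n G g)"

section \<open>Consistency of the definitions\<close>

subsection \<open>The Zariski topology\<close>

lemma istopology_zariski:
  assumes "cring A"
  shows "istopology (\<lambda>U. \<exists>E\<subseteq>carrier A. U = Spec A - vanishing_set A E)"
proof -
  interpret cring A by fact
  have inter: "\<exists>E\<subseteq>carrier A. U \<inter> V = Spec A - vanishing_set A E"
    if "E1 \<subseteq> carrier A" "U = Spec A - vanishing_set A E1"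
      "E2 \<subseteq> carrier A" "V = Spec A - vanishing_set A E2" for U V E1 E2
  proof (intro exI conjI)
    let ?E = "{a \<otimes>\<^bsub>A\<^esub> b | a b. a \<in> E1 \<and> b \<in> E2}"
    show "?E \<subseteq> carrier A" using that by auto
    have "?E \<subseteq> p \<longleftrightarrow> E1 \<subseteq> p \<or> E2 \<subseteq> p" if p: "primeideal p A" for p
    proof
      interpret p: primeideal p A by fact
      assume E: "?E \<subseteq> p"
      show "E1 \<subseteq> p \<or> E2 \<subseteq> p"
      proof (rule ccontr)
        assume "\<not> (E1 \<subseteq> p \<or> E2 \<subseteq> p)"
        then obtain a b where ab: "a \<in> E1" "a \<notin> p" "b \<in> E2" "b \<notin> p" by auto
        then have "a \<otimes>\<^bsub>A\<^esub> b \<in> p" using E by auto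
        then show False using p.I_prime[of a b] ab \<open>E1 \<subseteq> carrier A\<close> \<open>E2 \<subseteq> carrier A\<close> by auto
      qed
    next
      interpret p: primeideal p A by fact
      assume "E1 \<subseteq> p \<or> E2 \<subseteq> p"
      then show "?E \<subseteq> p"
        using \<open>E1 \<subseteq> carrier A\<close> \<open>E2 \<subseteq> carrier A\<close> by (auto simp: p.I_l_closed p.I_r_closed subset_eq)
    qed
    then show "U \<inter> V = Spec A - vanishing_set A ?E"
      unfolding that(2,4) vanishing_set_def Spec_def by blast
  qed
  have union: "\<exists>E\<subseteq>carrier A. \<Union>\<U> = Spec A - vanishing_set A E"
    if \<U>: "\<And>U. U \<in> \<U> \<Longrightarrow> \<exists>E\<subseteq>carrier A. U = Spec A - vanishing_set A E" for \<U>
  proof -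
    obtain F where F: "\<And>U. U \<in> \<U> \<Longrightarrow> F U \<subseteq> carrier A \<and> U = Spec A - vanishing_set A (F U)"
      using \<U> by metis
    show ?thesis
    proof (intro exI conjI)
      show "\<Union>(F ` \<U>) \<subseteq> carrier A" using F by blast
      show "\<Union>\<U> = Spec A - vanishing_set A (\<Union>(F ` \<U>))"
      proof (intro subset_antisym subsetI)
        fix p assume "p \<in> \<Union>\<U>"
        then obtain U where "U \<in> \<U>" "p \<in> U" by blast
        then show "p \<in> Spec A - vanishing_set A (\<Union>(F ` \<U>))"
          using F[of U] by (auto simp: vanishing_set_def)
      next
        fix p assume "p \<in> Spec A - vanishing_set A (\<Union>(F ` \<U>))"
        then obtain U where "U \<in> \<U>" "p \<in> Spec A" "\<not> F U \<subseteq> p"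
          by (auto simp: vanishing_set_def)
        then have "p \<in> Spec A - vanishing_set A (F U)" by (auto simp: vanishing_set_def)
        then show "p \<in> \<Union>\<U>" using F[OF \<open>U \<in> \<U>\<close>] \<open>U \<in> \<U>\<close> by blast
      qed
    qed
  qed
  show ?thesis
    unfolding istopology_def
  proof (intro conjI allI impI, elim exE conjE)
    fix U V E1 E2
    assume "E1 \<subseteq> carrier A" "U = Spec A - vanishing_set A E1"
      "E2 \<subseteq> carrier A" "V = Spec A - vanishing_set A E2"
    then show "\<exists>E\<subseteq>carrier A. U \<inter> V = Spec A - vanishing_set A E" by (rule inter)
  next
    fix \<U> assume "\<forall>U\<in>\<U>. \<exists>E\<subseteq>carrier A. U = Spec A - vanishing_set A E"
    then show "\<exists>E\<subseteq>carrier A. \<Union>\<U> = Spec A - vanishing_set A E" by (intro union) blast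
  qed
qed

lemma openin_zariski:
  assumes "cring A"
  shows "openin (zariski A) U \<longleftrightarrow> (\<exists>E\<subseteq>carrier A. U = Spec A - vanishing_set A E)"
  unfolding zariski_def using topology_inverse'[OF istopology_zariski[OF assms]] by simp

lemma topspace_zariski:
  assumes "cring A"
  shows "topspace (zariski A) = Spec A"
proof -
  interpret cring A by fact
  have "vanishing_set A (carrier A) = {}"
  proof (rule ccontr)
    assume "vanishing_set A (carrier A) \<noteq> {}"
    then obtain p where "primeideal p A" "carrier A \<subseteq> p" by (auto simp: vanishing_set_def Spec_def)
    moreover from this interpret p: primeideal p A by simp
    have "carrier A \<noteq> p" by (rule p.I_notcarr)
    ultimately show False using p.a_subset by blast
  qed
  then have "openin (zariski A) (Spec A)"
    unfolding openin_zariski[OF assms] by blast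
  moreover have "U \<subseteq> Spec A" if "openin (zariski A) U" for U
    using that unfolding openin_zariski[OF assms] by blast
  ultimately show ?thesis
    by (meson openin_topspace openin_subset subset_antisym)
qed

subsection \<open>Fraction fields and residue fields\<close>

context domain
begin

lemma fraction_eq_iff:
  assumes "a \<in> carrier R" "b \<in> carrier R - {\<zero>}" "c \<in> carrier R" "d \<in> carrier R - {\<zero>}"
  shows "fraction R a b = fraction R c d \<longleftrightarrow> a \<otimes> d = c \<otimes> b"
proof
  assume "fraction R a b = fraction R c d"
  moreover have "(c, d) \<in> fraction R c d" using assms by (auto simp: fraction_def)
  ultimately have "(c, d) \<in> fraction R a b" by simp
  then show "a \<otimes> d = c \<otimes> b" by (auto simp: fraction_def)
next
  assume *: "a \<otimes> d = c \<otimes> b"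
  have "a \<otimes> y = x \<otimes> b \<longleftrightarrow> c \<otimes> y = x \<otimes> d" if "x \<in> carrier R" "y \<in> carrier R - {\<zero>}" for x y
  proof -
    have "a \<otimes> y = x \<otimes> b \<longleftrightarrow> (a \<otimes> y) \<otimes> d = (x \<otimes> b) \<otimes> d"
      using assms that m_rcancel[of d "a \<otimes> y" "x \<otimes> b"] by auto
    also have "\<dots> \<longleftrightarrow> (a \<otimes> d) \<otimes> y = (x \<otimes> d) \<otimes> b"
      using assms that by (simp add: m_assoc m_comm m_lcomm)
    also have "\<dots> \<longleftrightarrow> (c \<otimes> y) \<otimes> b = (x \<otimes> d) \<otimes> b"
      unfolding * using assms that by (simp add: m_assoc m_comm m_lcomm)
    also have "\<dots> \<longleftrightarrow> c \<otimes> y = x \<otimes> d"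
      using assms that m_rcancel[of b "c \<otimes> y" "x \<otimes> d"] by auto
    finally show ?thesis .
  qed
  then show "fraction R a b = fraction R c d" by (auto simp: fraction_def)
qed

lemma nonzero_mult: "b \<in> carrier R - {\<zero>} \<Longrightarrow> d \<in> carrier R - {\<zero>} \<Longrightarrow> b \<otimes> d \<in> carrier R - {\<zero>}"
  using integral_iff by auto

lemma fraction_mult:
  assumes "a \<in> carrier R" "b \<in> carrier R - {\<zero>}" "c \<in> carrier R" "d \<in> carrier R - {\<zero>}"
  shows "fraction R a b \<otimes>\<^bsub>fraction_field R\<^esub> fraction R c d = fraction R (a \<otimes> c) (b \<otimes> d)"
proof -
  have "fraction R (a' \<otimes> c') (b' \<otimes> d') = fraction R (a \<otimes> c) (b \<otimes> d)"
    if "(a', b') \<in> fraction R a b" "(c', d') \<in> fraction R c d" for a' b' c' d'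
  proof -
    have in_R: "a' \<in> carrier R" "b' \<in> carrier R - {\<zero>}" "c' \<in> carrier R" "d' \<in> carrier R - {\<zero>}"
      and eq: "a \<otimes> b' = a' \<otimes> b" "c \<otimes> d' = c' \<otimes> d"
      using that by (auto simp: fraction_def)
    have "(a' \<otimes> c') \<otimes> (b \<otimes> d) = (a' \<otimes> b) \<otimes> (c' \<otimes> d)"
      using in_R assms by (simp add: m_assoc m_comm m_lcomm)
    also have "\<dots> = (a \<otimes> c) \<otimes> (b' \<otimes> d')"
      unfolding eq[symmetric] using in_R assms by (simp add: m_assoc m_comm m_lcomm)
    finally show ?thesis
      using in_R assms nonzero_mult by (subst fraction_eq_iff) auto
  qed
  note eq = this
  have ab: "(a, b) \<in> fraction R a b" and cd: "(c, d) \<in> fraction R c d"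
    using assms by (auto simp: fraction_def)
  have "{z. \<exists>(a', b')\<in>fraction R a b. \<exists>(c', d')\<in>fraction R c d. z \<in> fraction R (a' \<otimes> c') (b' \<otimes> d')} = fraction R (a \<otimes> c) (b \<otimes> d)"
  proof (intro subset_antisym subsetI)
    fix z assume "z \<in> {z. \<exists>(a', b')\<in>fraction R a b. \<exists>(c', d')\<in>fraction R c d. z \<in> fraction R (a' \<otimes> c') (b' \<otimes> d')}"
    then obtain a' b' c' d' where "(a', b') \<in> fraction R a b" "(c', d') \<in> fraction R c d"
      "z \<in> fraction R (a' \<otimes> c') (b' \<otimes> d')"
      by blast
    then show "z \<in> fraction R (a \<otimes> c) (b \<otimes> d)" using eq by simp
  next
    fix z assume "z \<in> fraction R (a \<otimes> c) (b \<otimes> d)"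
    then show "z \<in> {z. \<exists>(a', b')\<in>fraction R a b. \<exists>(c', d')\<in>fraction R c d. z \<in> fraction R (a' \<otimes> c') (b' \<otimes> d')}"
      using ab cd by blast
  qed
  then show ?thesis by (simp add: fraction_field_def)
qed

lemma fraction_add:
  assumes "a \<in> carrier R" "b \<in> carrier R - {\<zero>}" "c \<in> carrier R" "d \<in> carrier R - {\<zero>}"
  shows "fraction R a b \<oplus>\<^bsub>fraction_field R\<^esub> fraction R c d
    = fraction R (a \<otimes> d \<oplus> c \<otimes> b) (b \<otimes> d)"
proof -
  have "fraction R (a' \<otimes> d' \<oplus> c' \<otimes> b') (b' \<otimes> d') = fraction R (a \<otimes> d \<oplus> c \<otimes> b) (b \<otimes> d)"
    if "(a', b') \<in> fraction R a b" "(c', d') \<in> fraction R c d" for a' b' c' d'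
  proof -
    have in_R: "a' \<in> carrier R" "b' \<in> carrier R - {\<zero>}" "c' \<in> carrier R" "d' \<in> carrier R - {\<zero>}"
      and eq: "a \<otimes> b' = a' \<otimes> b" "c \<otimes> d' = c' \<otimes> d"
      using that by (auto simp: fraction_def)
    have "(a' \<otimes> d' \<oplus> c' \<otimes> b') \<otimes> (b \<otimes> d) = (a' \<otimes> b) \<otimes> (d' \<otimes> d) \<oplus> (c' \<otimes> d) \<otimes> (b' \<otimes> b)"
      using in_R assms by (simp add: m_assoc m_comm m_lcomm l_distr r_distr)
    also have "\<dots> = (a \<otimes> d \<oplus> c \<otimes> b) \<otimes> (b' \<otimes> d')"
      unfolding eq[symmetric] using in_R assms by (simp add: m_assoc m_comm m_lcomm l_distr r_distr)
    finally show ?thesis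
      using in_R assms nonzero_mult by (subst fraction_eq_iff) auto
  qed
  note eq = this
  have ab: "(a, b) \<in> fraction R a b" and cd: "(c, d) \<in> fraction R c d"
    using assms by (auto simp: fraction_def)
  have "{z. \<exists>(a', b')\<in>fraction R a b. \<exists>(c', d')\<in>fraction R c d. z \<in> fraction R (a' \<otimes> d' \<oplus> c' \<otimes> b') (b' \<otimes> d')} = fraction R (a \<otimes> d \<oplus> c \<otimes> b) (b \<otimes> d)"
  proof (intro subset_antisym subsetI)
    fix z assume "z \<in> {z. \<exists>(a', b')\<in>fraction R a b. \<exists>(c', d')\<in>fraction R c d. z \<in> fraction R (a' \<otimes> d' \<oplus> c' \<otimes> b') (b' \<otimes> d')}"
    then obtain a' b' c' d' where "(a', b') \<in> fraction R a b" "(c', d') \<in> fraction R c d"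
      "z \<in> fraction R (a' \<otimes> d' \<oplus> c' \<otimes> b') (b' \<otimes> d')"
      by blast
    then show "z \<in> fraction R (a \<otimes> d \<oplus> c \<otimes> b) (b \<otimes> d)" using eq by simp
  next
    fix z assume "z \<in> fraction R (a \<otimes> d \<oplus> c \<otimes> b) (b \<otimes> d)"
    then show "z \<in> {z. \<exists>(a', b')\<in>fraction R a b. \<exists>(c', d')\<in>fraction R c d. z \<in> fraction R (a' \<otimes> d' \<oplus> c' \<otimes> b') (b' \<otimes> d')}"
      using ab cd by blast
  qed
  then show ?thesis by (simp add: fraction_field_def)
qed

lemma fraction_fieldE:
  assumes "z \<in> carrier (fraction_field R)"
  obtains a b where "a \<in> carrier R" "b \<in> carrier R - {\<zero>}" "z = fraction R a b"
  using assms by (auto simp: fraction_field_def)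

lemma fraction_in_carrier:
  "a \<in> carrier R \<Longrightarrow> b \<in> carrier R - {\<zero>} \<Longrightarrow> fraction R a b \<in> carrier (fraction_field R)"
  by (auto simp: fraction_field_def)

lemma fraction_field_one: "\<one>\<^bsub>fraction_field R\<^esub> = fraction R \<one> \<one>"
  and fraction_field_zero: "\<zero>\<^bsub>fraction_field R\<^esub> = fraction R \<zero> \<one>"
  by (simp_all add: fraction_field_def)

lemma field_fraction_field: "field (fraction_field R)"
proof (rule cring.cring_fieldI2)
  let ?F = "fraction_field R"
  note simps = fraction_mult fraction_add fraction_field_one fraction_field_zero
    fraction_in_carrier fraction_eq_iff integral_iff
  note ac = l_distr r_distr a_assoc a_comm a_lcomm m_assoc m_comm m_lcomm
  show "cring ?F"
  proof (intro cringI abelian_groupI comm_monoidI)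
    fix x assume "x \<in> carrier ?F"
    then obtain a b where ab: "a \<in> carrier R" "b \<in> carrier R - {\<zero>}" "x = fraction R a b"
      by (rule fraction_fieldE)
    show "\<exists>y\<in>carrier ?F. y \<oplus>\<^bsub>?F\<^esub> x = \<zero>\<^bsub>?F\<^esub>"
    proof
      show "fraction R (\<ominus> a) b \<oplus>\<^bsub>?F\<^esub> x = \<zero>\<^bsub>?F\<^esub>"
        using ab by (simp add: simps l_minus l_neg)
      show "fraction R (\<ominus> a) b \<in> carrier ?F" using ab by (intro fraction_in_carrier) auto
    qed
    show "\<zero>\<^bsub>?F\<^esub> \<oplus>\<^bsub>?F\<^esub> x = x" "\<one>\<^bsub>?F\<^esub> \<otimes>\<^bsub>?F\<^esub> x = x" using ab by (simp_all add: simps)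
  next
    fix x y assume "x \<in> carrier ?F" "y \<in> carrier ?F"
    then obtain a b c d where ab: "a \<in> carrier R" "b \<in> carrier R - {\<zero>}" "x = fraction R a b"
      "c \<in> carrier R" "d \<in> carrier R - {\<zero>}" "y = fraction R c d"
      by (elim fraction_fieldE) blast
    show "x \<oplus>\<^bsub>?F\<^esub> y \<in> carrier ?F" "x \<otimes>\<^bsub>?F\<^esub> y \<in> carrier ?F"
      unfolding ab using ab nonzero_mult by (auto simp: fraction_mult fraction_add intro!: fraction_in_carrier)
    show "x \<oplus>\<^bsub>?F\<^esub> y = y \<oplus>\<^bsub>?F\<^esub> x" "x \<otimes>\<^bsub>?F\<^esub> y = y \<otimes>\<^bsub>?F\<^esub> x"
      unfolding ab using ab by (simp_all add: fraction_mult fraction_add m_comm a_comm)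
  next
    fix x y z assume "x \<in> carrier ?F" "y \<in> carrier ?F" "z \<in> carrier ?F"
    then obtain a b c d e f where ab: "a \<in> carrier R" "b \<in> carrier R - {\<zero>}" "x = fraction R a b"
      "c \<in> carrier R" "d \<in> carrier R - {\<zero>}" "y = fraction R c d"
      "e \<in> carrier R" "f \<in> carrier R - {\<zero>}" "z = fraction R e f"
      by (elim fraction_fieldE) blast
    have nz: "b \<otimes> d \<in> carrier R - {\<zero>}" "d \<otimes> f \<in> carrier R - {\<zero>}" "b \<otimes> f \<in> carrier R - {\<zero>}"
      "b \<otimes> f \<otimes> (d \<otimes> f) \<in> carrier R - {\<zero>}" "b \<otimes> d \<otimes> f \<in> carrier R - {\<zero>}"
      using ab nonzero_mult by blast+
    show "x \<oplus>\<^bsub>?F\<^esub> y \<oplus>\<^bsub>?F\<^esub> z = x \<oplus>\<^bsub>?F\<^esub> (y \<oplus>\<^bsub>?F\<^esub> z)" "x \<otimes>\<^bsub>?F\<^esub> y \<otimes>\<^bsub>?F\<^esub> z = x \<otimes>\<^bsub>?F\<^esub> (y \<otimes>\<^bsub>?F\<^esub> z)"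
      unfolding ab using ab nz by (simp_all add: fraction_mult fraction_add ac)
    show "(x \<oplus>\<^bsub>?F\<^esub> y) \<otimes>\<^bsub>?F\<^esub> z = x \<otimes>\<^bsub>?F\<^esub> z \<oplus>\<^bsub>?F\<^esub> y \<otimes>\<^bsub>?F\<^esub> z"
      unfolding ab using ab nz by (simp add: fraction_mult fraction_add fraction_eq_iff ac integral_iff)
  qed (auto simp: simps)
  show "\<zero>\<^bsub>?F\<^esub> \<noteq> \<one>\<^bsub>?F\<^esub>" by (simp add: simps)
  fix x assume "x \<in> carrier ?F" "x \<noteq> \<zero>\<^bsub>?F\<^esub>"
  then obtain a b where ab: "a \<in> carrier R" "b \<in> carrier R - {\<zero>}" "x = fraction R a b"
    by (elim fraction_fieldE) blast
  then have "a \<noteq> \<zero>" using \<open>x \<noteq> \<zero>\<^bsub>?F\<^esub>\<close> by (auto simp: simps)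
  note ab = ab this
  show "\<exists>y\<in>carrier ?F. x \<otimes>\<^bsub>?F\<^esub> y = \<one>\<^bsub>?F\<^esub>"
  proof
    show "x \<otimes>\<^bsub>?F\<^esub> fraction R b a = \<one>\<^bsub>?F\<^esub>" using ab by (simp add: simps m_comm)
    show "fraction R b a \<in> carrier ?F" using ab by (auto intro: fraction_in_carrier)
  qed
qed

lemma ring_hom_fraction: "(\<lambda>a. fraction R a \<one>) \<in> ring_hom R (fraction_field R)"
  by (rule ring_hom_memI)
     (auto simp: fraction_mult fraction_add fraction_field_one fraction_in_carrier)

end

lemma field_residue_field:
  assumes "p \<in> Spec A"
  shows "field (residue_field A p)"
  unfolding residue_field_def
  using assms by (auto simp: Spec_def intro!: domain.field_fraction_field primeideal.quotient_is_domain)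

lemma ring_hom_to_residue_field:
  assumes "p \<in> Spec A"
  shows "to_residue_field A p \<in> ring_hom A (residue_field A p)"
proof -
  interpret primeideal p A using assms by (simp add: Spec_def)
  have "(\<lambda>a. fraction (A Quot p) a \<one>\<^bsub>A Quot p\<^esub>) \<circ> (+>\<^bsub>A\<^esub>) p \<in> ring_hom A (residue_field A p)"
    unfolding residue_field_def
    using rcos_ring_hom domain.ring_hom_fraction[OF quotient_is_domain] by (rule ring_hom_trans)
  also have "(\<lambda>a. fraction (A Quot p) a \<one>\<^bsub>A Quot p\<^esub>) \<circ> (+>\<^bsub>A\<^esub>) p = to_residue_field A p"
    by (auto simp: to_residue_field_def)
  finally show ?thesis .
qed

subsection \<open>Matrix monoids\<close>

lemma units_hom:
  assumes "group G" and "monoid M" and "\<And>g. g \<in> carrier G \<Longrightarrow> f g \<in> carrier M"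
    and "\<And>g h. g \<in> carrier G \<Longrightarrow> h \<in> carrier G \<Longrightarrow> f (g \<otimes>\<^bsub>G\<^esub> h) = f g \<otimes>\<^bsub>M\<^esub> f h"
    and "f \<one>\<^bsub>G\<^esub> = \<one>\<^bsub>M\<^esub>"
  shows "f \<in> hom G (units_of M)"
proof -
  interpret G: group G by fact
  interpret M: monoid M by fact
  have "f g \<in> Units M" if "g \<in> carrier G" for g
    using that assms(3) assms(4)[of g "inv\<^bsub>G\<^esub> g"] assms(4)[of "inv\<^bsub>G\<^esub> g" g] assms(5)
    by (auto simp: Units_def intro!: bexI[of _ "f (inv\<^bsub>G\<^esub> g)"])
  then show ?thesis
    using assms(4) by (auto simp: hom_def units_of_def)
qed

context cring
begin

lemma mat_mult_apply:
  "i < n \<Longrightarrow> j < n \<Longrightarrow> (A \<otimes>\<^bsub>mat_monoid n R\<^esub> B) (i, j) = (\<Oplus>k\<in>{..<n}. A (i, k) \<otimes> B (k, j))"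
  by (simp add: mat_monoid_def)

lemma mat_one_apply:
  "i < n \<Longrightarrow> j < n \<Longrightarrow> \<one>\<^bsub>mat_monoid n R\<^esub> (i, j) = (if i = j then \<one> else \<zero>)"
  by (simp add: mat_monoid_def)

lemma mat_carrierD:
  "A \<in> carrier (mat_monoid n R) \<Longrightarrow> i < n \<Longrightarrow> j < n \<Longrightarrow> A (i, j) \<in> carrier R"
  by (auto simp: mat_monoid_def dest: PiE_mem)

lemma mat_eqI:
  assumes "A \<in> carrier (mat_monoid n R)" "B \<in> carrier (mat_monoid n R)"
    and "\<And>i j. i < n \<Longrightarrow> j < n \<Longrightarrow> A (i, j) = B (i, j)"
  shows "A = B"
  using assms by (intro PiE_ext[of A "mat_index n" "\<lambda>_. carrier R" B]) (auto simp: mat_monoid_def)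

lemma mat_mult_closed:
  assumes "A \<in> carrier (mat_monoid n R)" "B \<in> carrier (mat_monoid n R)"
  shows "A \<otimes>\<^bsub>mat_monoid n R\<^esub> B \<in> carrier (mat_monoid n R)"
proof -
  have "(A \<otimes>\<^bsub>mat_monoid n R\<^esub> B) \<in> mat_index n \<rightarrow>\<^sub>E carrier R"
  proof (rule PiE_I)
    fix x assume "x \<in> mat_index n"
    then obtain i j where x: "x = (i, j)" "i < n" "j < n" by auto
    then show "(A \<otimes>\<^bsub>mat_monoid n R\<^esub> B) x \<in> carrier R"
      using mat_carrierD[OF assms(1)] mat_carrierD[OF assms(2)] by (auto simp: mat_mult_apply)
  qed (auto simp: mat_monoid_def)
  then show ?thesis by (simp add: mat_monoid_def)
qed

lemma mat_one_closed: "\<one>\<^bsub>mat_monoid n R\<^esub> \<in> carrier (mat_monoid n R)"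
  by (auto simp: mat_monoid_def)

lemma finsum_swap:
  assumes "finite I" "finite J" "\<And>i j. i \<in> I \<Longrightarrow> j \<in> J \<Longrightarrow> f i j \<in> carrier R"
  shows "(\<Oplus>i\<in>I. \<Oplus>j\<in>J. f i j) = (\<Oplus>j\<in>J. \<Oplus>i\<in>I. f i j)"
  using assms(1,3)
proof (induction I rule: finite_induct)
  case empty
  then show ?case by (simp add: finsum_zero)
next
  case (insert x I)
  have "(\<Oplus>i\<in>insert x I. \<Oplus>j\<in>J. f i j) = (\<Oplus>j\<in>J. f x j) \<oplus> (\<Oplus>i\<in>I. \<Oplus>j\<in>J. f i j)"
    using insert by (intro finsum_insert) auto
  also have "\<dots> = (\<Oplus>j\<in>J. f x j) \<oplus> (\<Oplus>j\<in>J. \<Oplus>i\<in>I. f i j)"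
    using insert by simp
  also have "\<dots> = (\<Oplus>j\<in>J. f x j \<oplus> (\<Oplus>i\<in>I. f i j))"
    using insert by (intro finsum_addf[symmetric]) auto
  also have "\<dots> = (\<Oplus>j\<in>J. \<Oplus>i\<in>insert x I. f i j)"
    using insert by (intro finsum_cong' refl finsum_insert[symmetric] finsum_closed) auto
  finally show ?case .
qed

lemma mat_assoc:
  assumes A: "A \<in> carrier (mat_monoid n R)" and B: "B \<in> carrier (mat_monoid n R)"
    and C: "C \<in> carrier (mat_monoid n R)"
  shows "A \<otimes>\<^bsub>mat_monoid n R\<^esub> B \<otimes>\<^bsub>mat_monoid n R\<^esub> C = A \<otimes>\<^bsub>mat_monoid n R\<^esub> (B \<otimes>\<^bsub>mat_monoid n R\<^esub> C)"
proof (rule mat_eqI)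
  note c = mat_carrierD[OF A] mat_carrierD[OF B] mat_carrierD[OF C]
  fix i j assume ij: "i < n" "j < n"
  have "(A \<otimes>\<^bsub>mat_monoid n R\<^esub> B \<otimes>\<^bsub>mat_monoid n R\<^esub> C) (i, j)
    = (\<Oplus>k\<in>{..<n}. (\<Oplus>l\<in>{..<n}. A (i, l) \<otimes> B (l, k)) \<otimes> C (k, j))"
    using ij c unfolding mat_mult_apply[OF ij]
    by (intro finsum_cong' refl) (auto simp: mat_mult_apply)
  also have "\<dots> = (\<Oplus>k\<in>{..<n}. \<Oplus>l\<in>{..<n}. A (i, l) \<otimes> B (l, k) \<otimes> C (k, j))"
    using ij c by (intro finsum_cong' refl finsum_ldistr) auto
  also have "\<dots> = (\<Oplus>l\<in>{..<n}. \<Oplus>k\<in>{..<n}. A (i, l) \<otimes> B (l, k) \<otimes> C (k, j))"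
    using ij c by (intro finsum_swap) auto
  also have "\<dots> = (\<Oplus>l\<in>{..<n}. \<Oplus>k\<in>{..<n}. A (i, l) \<otimes> (B (l, k) \<otimes> C (k, j)))"
    using ij c by (intro finsum_cong' refl) (auto simp: m_assoc)
  also have "\<dots> = (\<Oplus>l\<in>{..<n}. A (i, l) \<otimes> (\<Oplus>k\<in>{..<n}. B (l, k) \<otimes> C (k, j)))"
    using ij c by (intro finsum_cong' refl finsum_rdistr[symmetric]) auto
  also have "\<dots> = (A \<otimes>\<^bsub>mat_monoid n R\<^esub> (B \<otimes>\<^bsub>mat_monoid n R\<^esub> C)) (i, j)"
    using ij c unfolding mat_mult_apply[OF ij]
    by (intro finsum_cong' refl) (auto simp: mat_mult_apply)
  finally show "(A \<otimes>\<^bsub>mat_monoid n R\<^esub> B \<otimes>\<^bsub>mat_monoid n R\<^esub> C) (i, j)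
    = (A \<otimes>\<^bsub>mat_monoid n R\<^esub> (B \<otimes>\<^bsub>mat_monoid n R\<^esub> C)) (i, j)" .
qed (auto intro!: mat_mult_closed A B C)

lemma monoid_mat_monoid: "monoid (mat_monoid n R)"
proof (rule monoidI)
  fix A assume A: "A \<in> carrier (mat_monoid n R)"
  note c = mat_carrierD[OF A]
  show "\<one>\<^bsub>mat_monoid n R\<^esub> \<otimes>\<^bsub>mat_monoid n R\<^esub> A = A"
  proof (rule mat_eqI[OF mat_mult_closed[OF mat_one_closed A] A])
    fix i j assume ij: "i < n" "j < n"
    have "(\<one>\<^bsub>mat_monoid n R\<^esub> \<otimes>\<^bsub>mat_monoid n R\<^esub> A) (i, j)
      = (\<Oplus>k\<in>{..<n}. if i = k then A (k, j) else \<zero>)"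
      using ij c unfolding mat_mult_apply[OF ij]
      by (intro finsum_cong' refl) (auto simp: mat_one_apply)
    also have "\<dots> = A (i, j)"
      using ij c by (intro finsum_singleton) auto
    finally show "(\<one>\<^bsub>mat_monoid n R\<^esub> \<otimes>\<^bsub>mat_monoid n R\<^esub> A) (i, j) = A (i, j)" .
  qed
  show "A \<otimes>\<^bsub>mat_monoid n R\<^esub> \<one>\<^bsub>mat_monoid n R\<^esub> = A"
  proof (rule mat_eqI[OF mat_mult_closed[OF A mat_one_closed] A])
    fix i j assume ij: "i < n" "j < n"
    have "(A \<otimes>\<^bsub>mat_monoid n R\<^esub> \<one>\<^bsub>mat_monoid n R\<^esub>) (i, j)
      = (\<Oplus>k\<in>{..<n}. if j = k then A (i, k) else \<zero>)"
      using ij c unfolding mat_mult_apply[OF ij]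
      by (intro finsum_cong' refl) (auto simp: mat_one_apply)
    also have "\<dots> = A (i, j)"
      using ij c by (intro finsum_singleton) auto
    finally show "(A \<otimes>\<^bsub>mat_monoid n R\<^esub> \<one>\<^bsub>mat_monoid n R\<^esub>) (i, j) = A (i, j)" .
  qed
qed (auto intro: mat_mult_closed mat_one_closed mat_assoc)

end

lemma mat_map_hom:
  assumes "cring R" "cring S" and \<phi>: "\<phi> \<in> ring_hom R S"
  shows "mat_map n \<phi> \<in> hom (mat_monoid n R) (mat_monoid n S)"
    and "mat_map n \<phi> \<one>\<^bsub>mat_monoid n R\<^esub> = \<one>\<^bsub>mat_monoid n S\<^esub>"
proof -
  interpret R: cring R by fact
  interpret S: cring S by fact
  interpret h: ring_hom_cring R S \<phi> using assms by (simp add: ring_hom_cring_def ring_hom_cring_axioms_def)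
  have closed: "mat_map n \<phi> A \<in> carrier (mat_monoid n S)" if "A \<in> carrier (mat_monoid n R)" for A
    using R.mat_carrierD[OF that] by (auto simp: mat_map_def mat_monoid_def)
  show "mat_map n \<phi> \<one>\<^bsub>mat_monoid n R\<^esub> = \<one>\<^bsub>mat_monoid n S\<^esub>"
    by (rule S.mat_eqI[OF closed[OF R.mat_one_closed] S.mat_one_closed])
       (auto simp: mat_map_def R.mat_one_apply S.mat_one_apply)
  have "mat_map n \<phi> (A \<otimes>\<^bsub>mat_monoid n R\<^esub> B) = mat_map n \<phi> A \<otimes>\<^bsub>mat_monoid n S\<^esub> mat_map n \<phi> B"
    if A: "A \<in> carrier (mat_monoid n R)" and B: "B \<in> carrier (mat_monoid n R)" for A B
  proof (rule S.mat_eqI[OF closed[OF R.mat_mult_closed[OF A B]] S.mat_mult_closed[OF closed[OF A] closed[OF B]]])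
    note c = R.mat_carrierD[OF A] R.mat_carrierD[OF B]
    fix i j assume ij: "i < n" "j < n"
    have "mat_map n \<phi> (A \<otimes>\<^bsub>mat_monoid n R\<^esub> B) (i, j) = \<phi> (\<Oplus>\<^bsub>R\<^esub>k\<in>{..<n}. A (i, k) \<otimes>\<^bsub>R\<^esub> B (k, j))"
      using ij by (simp add: mat_map_def R.mat_mult_apply)
    also have "\<dots> = (\<Oplus>\<^bsub>S\<^esub>k\<in>{..<n}. \<phi> (A (i, k) \<otimes>\<^bsub>R\<^esub> B (k, j)))"
      using ij c by (subst h.hom_finsum) (auto simp: comp_def)
    also have "\<dots> = (\<Oplus>\<^bsub>S\<^esub>k\<in>{..<n}. mat_map n \<phi> A (i, k) \<otimes>\<^bsub>S\<^esub> mat_map n \<phi> B (k, j))"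
      using ij c by (intro S.finsum_cong' refl) (auto simp: mat_map_def)
    also have "\<dots> = (mat_map n \<phi> A \<otimes>\<^bsub>mat_monoid n S\<^esub> mat_map n \<phi> B) (i, j)"
      using ij by (simp add: S.mat_mult_apply)
    finally show "mat_map n \<phi> (A \<otimes>\<^bsub>mat_monoid n R\<^esub> B) (i, j)
      = (mat_map n \<phi> A \<otimes>\<^bsub>mat_monoid n S\<^esub> mat_map n \<phi> B) (i, j)" .
  qed
  then show "mat_map n \<phi> \<in> hom (mat_monoid n R) (mat_monoid n S)"
    using closed by (auto simp: hom_def)
qed

lemma hom_GL_mat_map:
  assumes "group G" "cring R" "cring S" and \<phi>: "\<phi> \<in> ring_hom R S" and \<rho>: "\<rho> \<in> hom G (GL n R)"
  shows "(\<lambda>g. mat_map n \<phi> (\<rho> g)) \<in> hom G (GL n S)"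
  unfolding GL_def
proof (rule units_hom)
  interpret G: group G by fact
  interpret M: monoid "mat_monoid n R" using assms(2) by (rule cring.monoid_mat_monoid)
  note hom = mat_map_hom[OF assms(2-4), of n]
  interpret U: group "units_of (mat_monoid n R)" by (rule M.units_group)
  interpret \<rho>: group_hom G "units_of (mat_monoid n R)" \<rho>
    using \<rho> by unfold_locales (simp add: GL_def)
  have c: "\<rho> g \<in> carrier (mat_monoid n R)" if "g \<in> carrier G" for g
    using \<rho>.hom_closed[OF that] M.Units_closed by (simp add: units_of_def)
  show "monoid (mat_monoid n S)" using assms(3) by (rule cring.monoid_mat_monoid)
  show "mat_map n \<phi> (\<rho> g) \<in> carrier (mat_monoid n S)" if "g \<in> carrier G" for g
    using hom(1) c[OF that] by (rule hom_in_carrier)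
  show "mat_map n \<phi> (\<rho> (g \<otimes>\<^bsub>G\<^esub> h)) = mat_map n \<phi> (\<rho> g) \<otimes>\<^bsub>mat_monoid n S\<^esub> mat_map n \<phi> (\<rho> h)"
    if "g \<in> carrier G" "h \<in> carrier G" for g h
    using hom_mult[OF hom(1) c c] that by (simp add: units_of_def)
  show "mat_map n \<phi> (\<rho> \<one>\<^bsub>G\<^esub>) = \<one>\<^bsub>mat_monoid n S\<^esub>"
    using hom(2) by (simp add: units_of_def)
qed fact

subsection \<open>The universal representation and its specializations\<close>

lemma int_poly_ring_simps:
  "\<zero>\<^bsub>int_poly_ring S\<^esub> = 0" "\<one>\<^bsub>int_poly_ring S\<^esub> = 1"
  "p \<oplus>\<^bsub>int_poly_ring S\<^esub> q = p + q" "p \<otimes>\<^bsub>int_poly_ring S\<^esub> q = p * q"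
  by (simp_all add: int_poly_ring_def)

lemma cring_int_poly_ring: "cring (int_poly_ring S)"
proof (intro cringI abelian_groupI comm_monoidI)
  let ?P = "int_poly_ring S"
  have car: "p \<in> carrier ?P \<longleftrightarrow> (\<forall>m\<in>Poly_Mapping.keys p. Poly_Mapping.keys m \<subseteq> S)" for p
    by (simp add: int_poly_ring_def)
  show "p \<oplus>\<^bsub>?P\<^esub> q \<in> carrier ?P" if "p \<in> carrier ?P" "q \<in> carrier ?P" for p q
    using that Poly_Mapping.keys_add[of p q] unfolding car int_poly_ring_simps by blast
  show "p \<otimes>\<^bsub>?P\<^esub> q \<in> carrier ?P" if "p \<in> carrier ?P" "q \<in> carrier ?P" for p q
  proof -
    have "Poly_Mapping.keys m \<subseteq> S" if m: "m \<in> Poly_Mapping.keys (p * q)" for m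
    proof -
      obtain a b where "a \<in> Poly_Mapping.keys p" "b \<in> Poly_Mapping.keys q" "m = a + b"
        using m Poly_Mapping.keys_mult[of p q] by blast
      then show ?thesis
        using \<open>p \<in> _\<close> \<open>q \<in> _\<close> Poly_Mapping.keys_add[of a b] unfolding car by blast
    qed
    then show ?thesis unfolding car int_poly_ring_simps by blast
  qed
  show "\<exists>q\<in>carrier ?P. q \<oplus>\<^bsub>?P\<^esub> p = \<zero>\<^bsub>?P\<^esub>" if "p \<in> carrier ?P" for p
    using that by (intro bexI[of _ "- p"]) (auto simp: int_poly_ring_simps car)
qed (auto simp: int_poly_ring_simps algebra_simps int_poly_ring_def)

lemma poly_var_in_carrier: "v \<in> S \<Longrightarrow> poly_var v \<in> carrier (int_poly_ring S)"
  by (auto simp: int_poly_ring_def poly_var_def)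

context
  fixes n :: nat and G :: "('g, 'h) monoid_scheme"
begin

lemma cring_rep_poly_ring: "cring (rep_poly_ring n G)"
  unfolding rep_poly_ring_def by (rule cring_int_poly_ring)

lemma generic_mat_closed:
  "g \<in> carrier G \<Longrightarrow> generic_mat n g \<in> carrier (mat_monoid n (rep_poly_ring n G))"
  unfolding mat_monoid_def generic_mat_def rep_poly_ring_def
  by (auto intro!: poly_var_in_carrier)

lemma rep_relations_subset:
  assumes "group G"
  shows "rep_relations n G \<subseteq> carrier (rep_poly_ring n G)"
proof -
  interpret G: group G by fact
  interpret P: cring "rep_poly_ring n G" by (rule cring_rep_poly_ring)
  note c = P.mat_carrierD[OF generic_mat_closed] P.mat_carrierD[OF P.mat_one_closed[of n]]
    P.mat_carrierD[OF P.mat_mult_closed[OF generic_mat_closed generic_mat_closed]]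
  show ?thesis
    unfolding rep_relations_def Let_def by (auto intro!: P.minus_closed c)
qed

lemma ideal_rep_ideal:
  assumes "group G"
  shows "ideal (rep_ideal n G) (rep_poly_ring n G)"
  unfolding rep_ideal_def
  using ring.genideal_ideal[OF _ rep_relations_subset[OF assms]] cring_rep_poly_ring
  by (simp add: cring.axioms(1))

lemma cring_rep_ring:
  assumes "group G"
  shows "cring (rep_ring n G)"
  unfolding rep_ring_def
  using ideal.quotient_is_cring[OF ideal_rep_ideal[OF assms] cring_rep_poly_ring] .

lemma universal_rep_hom:
  assumes "group G"
  shows "universal_rep n G \<in> hom G (GL n (rep_ring n G))"
  unfolding GL_def
proof (rule units_hom)
  interpret G: group G by fact
  interpret P: cring "rep_poly_ring n G" by (rule cring_rep_poly_ring)
  interpret I: ideal "rep_ideal n G" "rep_poly_ring n G" using assms by (rule ideal_rep_ideal)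
  interpret A: cring "rep_ring n G" using assms by (rule cring_rep_ring)
  let ?P = "rep_poly_ring n G" and ?I = "rep_ideal n G"
  let ?M = "mat_monoid n ?P" and ?N = "mat_monoid n (rep_ring n G)"
  let ?q = "(+>\<^bsub>?P\<^esub>) ?I"
  have q: "?q \<in> ring_hom ?P (rep_ring n G)"
    unfolding rep_ring_def by (rule I.rcos_ring_hom)
  note hom = mat_map_hom[OF P.is_cring A.is_cring q, of n]
  have rel: "rep_relations n G \<subseteq> ?I"
    unfolding rep_ideal_def by (rule P.genideal_self[OF rep_relations_subset[OF assms]])
  have eqI: "mat_map n ?q B = mat_map n ?q C"
    if B: "B \<in> carrier ?M" and C: "C \<in> carrier ?M"
      and *: "\<And>x. x \<in> mat_index n \<Longrightarrow> B x \<ominus>\<^bsub>?P\<^esub> C x \<in> rep_relations n G" for B C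
    unfolding mat_map_def
  proof (rule restrict_ext)
    fix x assume x: "x \<in> mat_index n"
    then have c: "B x \<in> carrier ?P" "C x \<in> carrier ?P"
      using P.mat_carrierD[OF B] P.mat_carrierD[OF C] by auto
    have "B x \<ominus>\<^bsub>?P\<^esub> C x \<in> ?I" using *[OF x] rel by blast
    then show "?q (B x) = ?q (C x)"
      using P.quotient_eq_iff_same_a_r_cos[OF I.ideal_axioms c] by simp
  qed
  show "monoid ?N" by (rule A.monoid_mat_monoid)
  show "universal_rep n G g \<in> carrier ?N" if "g \<in> carrier G" for g
    unfolding universal_rep_def using hom(1) generic_mat_closed[OF that] by (rule hom_in_carrier)
  show "universal_rep n G (g \<otimes>\<^bsub>G\<^esub> h) = universal_rep n G g \<otimes>\<^bsub>?N\<^esub> universal_rep n G h"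
    if g: "g \<in> carrier G" and h: "h \<in> carrier G" for g h
  proof -
    have "universal_rep n G (g \<otimes>\<^bsub>G\<^esub> h) = mat_map n ?q (generic_mat n g \<otimes>\<^bsub>?M\<^esub> generic_mat n h)"
      unfolding universal_rep_def
      by (rule eqI) (use g h in \<open>auto intro!: generic_mat_closed P.mat_mult_closed
        simp: rep_relations_def Let_def, blast?\<close>)
    then show ?thesis
      using hom_mult[OF hom(1) generic_mat_closed[OF g] generic_mat_closed[OF h]]
      by (simp add: universal_rep_def)
  qed
  have "universal_rep n G \<one>\<^bsub>G\<^esub> = mat_map n ?q \<one>\<^bsub>?M\<^esub>"
    unfolding universal_rep_def
    by (rule eqI) (auto intro!: generic_mat_closed P.mat_one_closed simp: rep_relations_def Let_def)
  then show "universal_rep n G \<one>\<^bsub>G\<^esub> = \<one>\<^bsub>?N\<^esub>" using hom(2) by simp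
qed fact

lemma topspace_Rep:
  assumes "group G"
  shows "topspace (Rep n G) = Spec (rep_ring n G)"
  unfolding Rep_def by (rule topspace_zariski[OF cring_rep_ring[OF assms]])

lemma rep_at_hom:
  assumes "group G" "x \<in> topspace (Rep n G)"
  shows "rep_at n G x \<in> hom G (GL n (residue_field_at n G x))"
proof -
  have x: "x \<in> Spec (rep_ring n G)" using assms topspace_Rep by simp
  have "cring (residue_field_at n G x)" using field_residue_field[OF x] by (simp add: field_def domain_def)
  from hom_GL_mat_map[OF assms(1) cring_rep_ring[OF assms(1)] this
      ring_hom_to_residue_field[OF x] universal_rep_hom[OF assms(1)]]
  show ?thesis unfolding rep_at_def[abs_def] .
qed

end

subsection \<open>Evaluation of integer polynomials\<close>

lemma update_eq_add_single:
  assumes "k \<notin> Poly_Mapping.keys f"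
  shows "Poly_Mapping.update k v f = Poly_Mapping.single k v + (f :: 'k \<Rightarrow>\<^sub>0 'v::comm_monoid_add)"
  using assms
  by (intro poly_mapping_eqI) (auto simp: lookup_update lookup_add lookup_single when_def in_keys_iff)

lemma single_add_induct [case_names zero add]:
  fixes f :: "'k \<Rightarrow>\<^sub>0 'v::comm_monoid_add"
  assumes "P 0"
    and "\<And>f k v. k \<notin> Poly_Mapping.keys f \<Longrightarrow> v \<noteq> 0 \<Longrightarrow> P f \<Longrightarrow> P (Poly_Mapping.single k v + f)"
  shows "P f"
  by (induction f rule: update_induct) (use assms in \<open>auto simp: update_eq_add_single\<close>)

context cring
begin

definition eval_monom :: "('v \<Rightarrow> 'a) \<Rightarrow> ('v \<Rightarrow>\<^sub>0 nat) \<Rightarrow> 'a" where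
  "eval_monom a m = (\<Otimes>v\<in>Poly_Mapping.keys m. a v [^] Poly_Mapping.lookup m v)"

definition eval_int_poly :: "('v \<Rightarrow> 'a) \<Rightarrow> 'v int_poly \<Rightarrow> 'a" where
  "eval_int_poly a p = (\<Oplus>m\<in>Poly_Mapping.keys p. [Poly_Mapping.lookup p m] \<cdot> eval_monom a m)"

context
  fixes a :: "'v \<Rightarrow> 'a"
  assumes a: "\<And>v. a v \<in> carrier R"
begin

lemma eval_monom_closed [simp]: "eval_monom a m \<in> carrier R"
  unfolding eval_monom_def using a by (intro finprod_closed) auto

lemma eval_monom_superset:
  assumes "finite F" "Poly_Mapping.keys m \<subseteq> F"
  shows "eval_monom a m = (\<Otimes>v\<in>F. a v [^] Poly_Mapping.lookup m v)"
  unfolding eval_monom_def using assms a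
  by (intro finprod_mono_neutral_cong_left) (auto simp: in_keys_iff)

lemma eval_monom_add: "eval_monom a (m + m') = eval_monom a m \<otimes> eval_monom a m'"
proof -
  let ?F = "Poly_Mapping.keys m \<union> Poly_Mapping.keys m'"
  have "eval_monom a (m + m') = (\<Otimes>v\<in>?F. a v [^] Poly_Mapping.lookup (m + m') v)"
    using Poly_Mapping.keys_add[of m m'] by (intro eval_monom_superset) auto
  also have "\<dots> = (\<Otimes>v\<in>?F. a v [^] Poly_Mapping.lookup m v \<otimes> a v [^] Poly_Mapping.lookup m' v)"
    using a by (intro finprod_cong') (auto simp: lookup_add nat_pow_mult)
  also have "\<dots> = (\<Otimes>v\<in>?F. a v [^] Poly_Mapping.lookup m v) \<otimes> (\<Otimes>v\<in>?F. a v [^] Poly_Mapping.lookup m' v)"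
    using a by (intro finprod_multf) auto
  also have "\<dots> = eval_monom a m \<otimes> eval_monom a m'"
    using eval_monom_superset[of ?F m] eval_monom_superset[of ?F m'] by simp
  finally show ?thesis .
qed

lemma int_mult_closed [simp]: "x \<in> carrier R \<Longrightarrow> [(k::int)] \<cdot> x \<in> carrier R"
  by (rule add.int_pow_closed)

lemma eval_closed [simp]: "eval_int_poly a p \<in> carrier R"
  unfolding eval_int_poly_def by (intro finsum_closed) auto

lemma int_mult_zero [simp]: "[(0::int)] \<cdot> x = \<zero>"
  by (simp add: add_pow_def)

lemma eval_superset:
  assumes "finite F" "Poly_Mapping.keys p \<subseteq> F"
  shows "eval_int_poly a p = (\<Oplus>m\<in>F. [Poly_Mapping.lookup p m] \<cdot> eval_monom a m)"
  unfolding eval_int_poly_def using assms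
  by (intro add.finprod_mono_neutral_cong_left) (auto simp: in_keys_iff)

lemma eval_add: "eval_int_poly a (p + q) = eval_int_poly a p \<oplus> eval_int_poly a q"
proof -
  let ?F = "Poly_Mapping.keys p \<union> Poly_Mapping.keys q"
  have "eval_int_poly a (p + q) = (\<Oplus>m\<in>?F. [Poly_Mapping.lookup (p + q) m] \<cdot> eval_monom a m)"
    using Poly_Mapping.keys_add[of p q] by (intro eval_superset) auto
  also have "\<dots> = (\<Oplus>m\<in>?F. ([Poly_Mapping.lookup p m] \<cdot> eval_monom a m) \<oplus> ([Poly_Mapping.lookup q m] \<cdot> eval_monom a m))"
    by (intro finsum_cong') (auto simp: lookup_add add.int_pow_mult)
  also have "\<dots> = (\<Oplus>m\<in>?F. [Poly_Mapping.lookup p m] \<cdot> eval_monom a m) \<oplus> (\<Oplus>m\<in>?F. [Poly_Mapping.lookup q m] \<cdot> eval_monom a m)"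
    by (intro finsum_addf) auto
  also have "\<dots> = eval_int_poly a p \<oplus> eval_int_poly a q"
    using eval_superset[of ?F p] eval_superset[of ?F q] by simp
  finally show ?thesis .
qed

lemma eval_single: "eval_int_poly a (Poly_Mapping.single m c) = [c] \<cdot> eval_monom a m"
  using eval_superset[of "{m}" "Poly_Mapping.single m c"] by (simp split: if_splits)

lemma eval_zero: "eval_int_poly a 0 = \<zero>"
  by (simp add: eval_int_poly_def)

lemma eval_single_mult:
  "eval_int_poly a (Poly_Mapping.single m c * q) = ([c] \<cdot> eval_monom a m) \<otimes> eval_int_poly a q"
proof (induction q rule: single_add_induct)
  case zero
  show ?case by (simp add: eval_zero)
next
  case (add q l d)
  have "[(c * d)] \<cdot> (eval_monom a m \<otimes> eval_monom a l) = ([c] \<cdot> eval_monom a m) \<otimes> ([d] \<cdot> eval_monom a l)"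
    by (simp add: add_pow_ldistr_int add_pow_rdistr_int)
       (simp add: add.int_pow_pow mult.commute)
  then show ?case
    using add.IH
    by (simp add: distrib_left eval_add mult_single eval_single eval_monom_add r_distr)
qed

lemma eval_mult: "eval_int_poly a (p * q) = eval_int_poly a p \<otimes> eval_int_poly a q"
proof (induction p rule: single_add_induct)
  case zero
  show ?case by (simp add: eval_zero)
next
  case (add p l d)
  then show ?case by (simp add: distrib_right eval_add eval_single_mult eval_single l_distr)
qed

lemma eval_one: "eval_int_poly a 1 = \<one>"
  using eval_single[of 0 1] by (simp add: eval_monom_def add.int_pow_1)

lemma eval_poly_var: "eval_int_poly a (poly_var v) = a v"
proof -
  have "eval_monom a (Poly_Mapping.single v 1) = a v"
    using eval_monom_superset[of "{v}" "Poly_Mapping.single v 1"] a by simp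
  then show ?thesis using a by (simp add: poly_var_def eval_single add.int_pow_1)
qed

lemma eval_ring_hom: "eval_int_poly a \<in> ring_hom (int_poly_ring S) R"
  by (rule ring_hom_memI) (auto simp: int_poly_ring_simps eval_add eval_mult eval_one)

end

end

lemma int_poly_ring_hom_unique:
  assumes "cring R" and f: "f \<in> ring_hom (int_poly_ring S) R" and f': "f' \<in> ring_hom (int_poly_ring S) R"
    and vars: "\<And>v. v \<in> S \<Longrightarrow> f (poly_var v) = f' (poly_var v)"
    and p: "p \<in> carrier (int_poly_ring S)"
  shows "f p = f' p"
proof -
  let ?P = "int_poly_ring S"
  interpret R: cring R by fact
  interpret P: cring ?P by (rule cring_int_poly_ring)
  interpret f: ring_hom_ring ?P R f using f by (rule ring_hom_ringI2[OF P.ring_axioms R.ring_axioms])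
  interpret f': ring_hom_ring ?P R f' using f' by (rule ring_hom_ringI2[OF P.ring_axioms R.ring_axioms])
  have car: "p \<in> carrier ?P \<longleftrightarrow> (\<forall>m\<in>Poly_Mapping.keys p. Poly_Mapping.keys m \<subseteq> S)" for p
    by (simp add: int_poly_ring_def)
  have mult: "f (x * y) = f' (x * y)" if "f x = f' x" "f y = f' y" "x \<in> carrier ?P" "y \<in> carrier ?P" for x y
    using that f.hom_mult[of x y] f'.hom_mult[of x y] by (simp add: int_poly_ring_simps)
  have plus: "f (x + y) = f' (x + y)" if "f x = f' x" "f y = f' y" "x \<in> carrier ?P" "y \<in> carrier ?P" for x y
    using that f.hom_add[of x y] f'.hom_add[of x y] by (simp add: int_poly_ring_simps)
  have one: "f 1 = f' 1" and null: "f 0 = f' 0"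
    using f.hom_one f'.hom_one f.hom_zero f'.hom_zero by (simp_all add: int_poly_ring_simps)
  have pow: "f (Poly_Mapping.single (Poly_Mapping.single v k) 1) = f' (Poly_Mapping.single (Poly_Mapping.single v k) 1)"
    if v: "v \<in> S" for v k
  proof (induction k)
    case 0
    show ?case using one by simp
  next
    case (Suc k)
    have "Poly_Mapping.single (Poly_Mapping.single v (Suc k)) (1::int)
      = poly_var v * Poly_Mapping.single (Poly_Mapping.single v k) 1"
      by (simp add: poly_var_def mult_single flip: single_add)
    then show ?case using mult[OF vars[OF v] Suc] v by (simp add: car poly_var_def)
  qed
  have monom: "f (Poly_Mapping.single m 1) = f' (Poly_Mapping.single m 1)"
    if "Poly_Mapping.keys m \<subseteq> S" for m
    using that
  proof (induction m rule: single_add_induct)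
    case zero
    show ?case using one by simp
  next
    case (add m v k)
    have keys: "Poly_Mapping.keys (Poly_Mapping.single v k + m) = insert v (Poly_Mapping.keys m)"
      using add.hyps by (auto simp: in_keys_iff lookup_add lookup_single when_def split: if_splits)
    have "Poly_Mapping.single (Poly_Mapping.single v k + m) (1::int)
      = Poly_Mapping.single (Poly_Mapping.single v k) 1 * Poly_Mapping.single m 1"
      by (simp add: mult_single)
    then show ?case
      using mult[OF pow[of v k] add.IH] add.prems unfolding keys by (simp add: car)
  qed
  have single: "f (Poly_Mapping.single m c) = f' (Poly_Mapping.single m c)"
    if m: "Poly_Mapping.keys m \<subseteq> S" for m c
  proof (induction c rule: int_induct[where k = 0])
    case base
    show ?case using null by simp
  next
    case (step1 i)
    then show ?case using plus[OF step1.IH monom[OF m]] m by (simp add: car single_add)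
  next
    case (step2 i)
    have c: "Poly_Mapping.single m (i - 1) \<in> carrier ?P" "Poly_Mapping.single m 1 \<in> carrier ?P"
      using m by (simp_all add: car)
    have *: "Poly_Mapping.single m i = Poly_Mapping.single m (i - 1) \<oplus>\<^bsub>?P\<^esub> Poly_Mapping.single m 1"
      by (simp add: int_poly_ring_simps flip: single_add)
    have "f (Poly_Mapping.single m (i - 1)) \<oplus>\<^bsub>R\<^esub> f (Poly_Mapping.single m 1)
      = f' (Poly_Mapping.single m (i - 1)) \<oplus>\<^bsub>R\<^esub> f (Poly_Mapping.single m 1)"
      using step2.IH monom[OF m] f.hom_add[OF c] f'.hom_add[OF c] unfolding * by simp
    then show ?case using c by simp
  qed
  show ?thesis
    using p
  proof (induction p rule: single_add_induct)
    case zero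
    show ?case by (rule null)
  next
    case (add p m c)
    have keys: "Poly_Mapping.keys (Poly_Mapping.single m c + p) = insert m (Poly_Mapping.keys p)"
      using add.hyps by (auto simp: in_keys_iff lookup_add lookup_single when_def split: if_splits)
    have "Poly_Mapping.keys m \<subseteq> S" "p \<in> carrier ?P"
      using add.prems unfolding car keys by auto
    then show ?case by (intro plus single add.IH) (auto simp: car)
  qed
qed

subsection \<open>The universal property of \<open>rep_ring\<close>\<close>

text \<open>\<open>rep_ring n G\<close> represents the functor \<open>R \<mapsto> Hom(G, GL_n(R))\<close> on commutative rings;
  equivalently, \<open>Spec (rep_ring n G)\<close> represents \<open>X \<mapsto> Hom(G, GL_n(\<Gamma>(X, O_X)))\<close> on schemes.\<close>

lemma rep_ring_universal:
  assumes "group G" and "cring R" and \<rho>: "\<rho> \<in> hom G (GL n R)"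
  shows "\<exists>!h. h \<in> ring_hom (rep_ring n G) R \<and> h \<in> extensional (carrier (rep_ring n G)) \<and>
           (\<forall>g\<in>carrier G. mat_map n h (universal_rep n G g) = \<rho> g)"
proof -
  interpret G: group G by fact
  interpret R: cring R by fact
  interpret P: cring "rep_poly_ring n G" by (rule cring_rep_poly_ring)
  interpret I: ideal "rep_ideal n G" "rep_poly_ring n G" using assms(1) by (rule ideal_rep_ideal)
  let ?P = "rep_poly_ring n G" and ?I = "rep_ideal n G" and ?A = "rep_ring n G"
  let ?M = "mat_monoid n ?P" and ?N = "mat_monoid n R"
  let ?q = "(+>\<^bsub>?P\<^esub>) ?I"
  interpret A: cring ?A using assms(1) by (rule cring_rep_ring)
  interpret N: monoid ?N by (rule R.monoid_mat_monoid)
  interpret U: group "units_of ?N" by (rule N.units_group)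
  interpret \<rho>: group_hom G "units_of ?N" \<rho>
    using \<rho> by unfold_locales (simp add: GL_def)
  have q: "?q \<in> ring_hom ?P ?A"
    unfolding rep_ring_def by (rule I.rcos_ring_hom)
  have \<rho>c: "\<rho> g \<in> carrier ?N" if "g \<in> carrier G" for g
    using \<rho>.hom_closed[OF that] N.Units_closed by (simp add: units_of_def)
  define a where "a = (\<lambda>(g, x). if g \<in> carrier G \<and> x \<in> mat_index n then \<rho> g x else \<one>\<^bsub>R\<^esub>)"
  have a: "a v \<in> carrier R" for v
    using R.mat_carrierD[OF \<rho>c] by (auto simp: a_def split: prod.split)
  define e where "e = R.eval_int_poly a"
  have e: "e \<in> ring_hom ?P R"
    unfolding e_def rep_poly_ring_def using a by (rule R.eval_ring_hom)
  interpret e: ring_hom_ring ?P R e using e by (rule ring_hom_ringI2[OF P.ring_axioms R.ring_axioms])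
  note me = mat_map_hom[OF P.is_cring R.is_cring e, of n]
  have gen: "mat_map n e (generic_mat n g) = \<rho> g" if g: "g \<in> carrier G" for g
  proof (rule R.mat_eqI[OF hom_in_carrier[OF me(1) generic_mat_closed[OF g]] \<rho>c[OF g]])
    fix i j assume "i < n" "j < n"
    then show "mat_map n e (generic_mat n g) (i, j) = \<rho> g (i, j)"
      using R.eval_poly_var[of a "(g, i, j)"] a g by (simp add: mat_map_def generic_mat_def e_def a_def)
  qed
  have ev: "e (B x) = mat_map n e B x" if "x \<in> mat_index n" for B x
    using that by (simp add: mat_map_def)
  have "?I \<subseteq> a_kernel ?P R e"
    unfolding rep_ideal_def
  proof (rule P.genideal_minimal[OF e.kernel_is_ideal], rule subsetI)
    fix r assume r: "r \<in> rep_relations n G"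
    have "\<exists>B C x. r = B x \<ominus>\<^bsub>?P\<^esub> C x \<and> B \<in> carrier ?M \<and> C \<in> carrier ?M \<and> x \<in> mat_index n
        \<and> mat_map n e B = mat_map n e C"
      using r unfolding rep_relations_def Let_def
    proof (elim UnE CollectE exE conjE)
      fix g h x assume *: "r = generic_mat n (g \<otimes>\<^bsub>G\<^esub> h) x \<ominus>\<^bsub>?P\<^esub> (generic_mat n g \<otimes>\<^bsub>?M\<^esub> generic_mat n h) x"
        "g \<in> carrier G" "h \<in> carrier G" "x \<in> mat_index n"
      have "mat_map n e (generic_mat n (g \<otimes>\<^bsub>G\<^esub> h)) = mat_map n e (generic_mat n g \<otimes>\<^bsub>?M\<^esub> generic_mat n h)"
        using * \<rho>.hom_mult by (simp add: gen hom_mult[OF me(1)] generic_mat_closed units_of_def)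
      then show ?thesis
        using * generic_mat_closed[OF *(2)] generic_mat_closed[OF *(3)]
          generic_mat_closed[OF G.m_closed[OF *(2,3)]] P.mat_mult_closed
        by - (rule exI[of _ "generic_mat n (g \<otimes>\<^bsub>G\<^esub> h)"],
            rule exI[of _ "generic_mat n g \<otimes>\<^bsub>?M\<^esub> generic_mat n h"], rule exI[of _ x], simp)
    next
      fix x assume *: "r = generic_mat n \<one>\<^bsub>G\<^esub> x \<ominus>\<^bsub>?P\<^esub> \<one>\<^bsub>?M\<^esub> x" "x \<in> mat_index n"
      have "mat_map n e (generic_mat n \<one>\<^bsub>G\<^esub>) = mat_map n e \<one>\<^bsub>?M\<^esub>"
        using \<rho>.hom_one by (simp add: gen me(2) units_of_def)
      then show ?thesis
        using * generic_mat_closed[OF G.one_closed] P.mat_one_closed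
        by - (rule exI[of _ "generic_mat n \<one>\<^bsub>G\<^esub>"], rule exI[of _ "\<one>\<^bsub>?M\<^esub>"],
            rule exI[of _ x], simp)
    qed
    then obtain B C x where *: "r = B x \<ominus>\<^bsub>?P\<^esub> C x" "B \<in> carrier ?M" "C \<in> carrier ?M"
      "x \<in> mat_index n" "mat_map n e B = mat_map n e C" by blast
    have c: "B x \<in> carrier ?P" "C x \<in> carrier ?P"
      using P.mat_carrierD[OF *(2)] P.mat_carrierD[OF *(3)] *(4) by auto
    moreover have "e (B x) = e (C x)" unfolding ev[OF *(4), of B] ev[OF *(4), of C] *(5) ..
    ultimately show "r \<in> a_kernel ?P R e"
      unfolding a_kernel_def' *(1) by (simp add: P.minus_eq R.r_neg)
  qed
  then have ker: "e p = \<zero>\<^bsub>R\<^esub>" if "p \<in> ?I" for p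
    using that unfolding a_kernel_def' by blast
  have e_eq: "e p = e p'" if "p \<in> carrier ?P" "p' \<in> carrier ?P" "?q p = ?q p'" for p p'
  proof -
    have "p \<ominus>\<^bsub>?P\<^esub> p' \<in> ?I"
      using P.quotient_eq_iff_same_a_r_cos[OF I.ideal_axioms that(1,2)] that(3) by simp
    from ker[OF this] have "e p \<ominus>\<^bsub>R\<^esub> e p' = \<zero>\<^bsub>R\<^esub>" using that by (simp add: P.minus_eq R.minus_eq)
    then show ?thesis using that by (simp add: R.r_right_minus_eq)
  qed
  have carA: "c \<in> carrier ?A \<Longrightarrow> \<exists>p\<in>carrier ?P. c = ?q p" for c
    unfolding rep_ring_def FactRing_def A_RCOSETS_def' by auto
  have qA: "?q p \<in> carrier ?A" if "p \<in> carrier ?P" for p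
    using ring_hom_closed[OF q that] .
  define h where "h = (\<lambda>c\<in>carrier ?A. e (SOME p. p \<in> carrier ?P \<and> c = ?q p))"
  have h_q: "h (?q p) = e p" if p: "p \<in> carrier ?P" for p
  proof -
    let ?p' = "SOME p'. p' \<in> carrier ?P \<and> ?q p = ?q p'"
    have "?p' \<in> carrier ?P \<and> ?q p = ?q ?p'" by (rule someI[of _ p]) (use p in simp)
    then show ?thesis using e_eq[of ?p' p] p qA[OF p] by (simp add: h_def)
  qed
  have h: "h \<in> ring_hom ?A R"
  proof (rule ring_hom_memI)
    fix c d assume "c \<in> carrier ?A" "d \<in> carrier ?A"
    then obtain p p' where p: "p \<in> carrier ?P" "c = ?q p" "p' \<in> carrier ?P" "d = ?q p'"
      using carA[of c] carA[of d] by blast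
    show "h c \<in> carrier R" using p by (simp add: h_q)
    show "h (c \<otimes>\<^bsub>?A\<^esub> d) = h c \<otimes>\<^bsub>R\<^esub> h d"
      using ring_hom_mult[OF q p(1,3)] h_q[OF P.m_closed[OF p(1,3)]] h_q[OF p(1)] h_q[OF p(3)]
        e.hom_mult[OF p(1,3)] unfolding p(2,4) by simp
    show "h (c \<oplus>\<^bsub>?A\<^esub> d) = h c \<oplus>\<^bsub>R\<^esub> h d"
      using ring_hom_add[OF q p(1,3)] h_q[OF P.a_closed[OF p(1,3)]] h_q[OF p(1)] h_q[OF p(3)]
        e.hom_add[OF p(1,3)] unfolding p(2,4) by simp
  next
    show "h \<one>\<^bsub>?A\<^esub> = \<one>\<^bsub>R\<^esub>"
      using ring_hom_one[OF q] h_q[OF P.one_closed] e.hom_one by simp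
  qed
  have h_univ: "mat_map n h' (universal_rep n G g) = mat_map n (\<lambda>p. h' (?q p)) (generic_mat n g)" for h' g
    by (auto simp: mat_map_def universal_rep_def)
  have h_gen: "mat_map n h (universal_rep n G g) = \<rho> g" if g: "g \<in> carrier G" for g
  proof -
    have "mat_map n (\<lambda>p. h (?q p)) (generic_mat n g) = mat_map n e (generic_mat n g)"
      unfolding mat_map_def
      by (rule restrict_ext) (use P.mat_carrierD[OF generic_mat_closed[OF g]] in \<open>auto simp: h_q\<close>)
    then show ?thesis using h_univ[of h g] gen[OF g] by (metis (no_types, lifting))
  qed
  show ?thesis
  proof (rule ex1I[of _ h], intro conjI ballI h h_gen)
    show "h \<in> extensional (carrier ?A)" by (simp add: h_def)
    fix h' assume h': "h' \<in> ring_hom ?A R \<and> h' \<in> extensional (carrier ?A) \<and>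
      (\<forall>g\<in>carrier G. mat_map n h' (universal_rep n G g) = \<rho> g)"
    have eq: "(h' \<circ> ?q) p = e p" if p: "p \<in> carrier ?P" for p
    proof (rule int_poly_ring_hom_unique[OF R.is_cring])
      show "h' \<circ> ?q \<in> ring_hom (int_poly_ring (carrier G \<times> mat_index n)) R"
        using ring_hom_trans[OF q, of h' R] h' by (simp add: rep_poly_ring_def)
      show "e \<in> ring_hom (int_poly_ring (carrier G \<times> mat_index n)) R"
        using e by (simp add: rep_poly_ring_def)
      show "p \<in> carrier (int_poly_ring (carrier G \<times> mat_index n))"
        using p by (simp add: rep_poly_ring_def)
      fix v assume "v \<in> carrier G \<times> mat_index n"
      then obtain g i j where v: "v = (g, i, j)" "g \<in> carrier G" "i < n" "j < n" by auto
      have "mat_map n (\<lambda>p. h' (?q p)) (generic_mat n g) = mat_map n e (generic_mat n g)"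
        using h' v(2) unfolding h_univ[symmetric] gen[OF v(2)] by blast
      then have "mat_map n (\<lambda>p. h' (?q p)) (generic_mat n g) (i, j) = mat_map n e (generic_mat n g) (i, j)"
        by simp
      then show "(h' \<circ> ?q) (poly_var v) = e (poly_var v)"
        using v by (simp add: mat_map_def generic_mat_def)
    qed
    show "h' = h"
    proof (rule extensionalityI[of _ "carrier ?A"])
      fix c assume "c \<in> carrier ?A"
      then obtain p where "p \<in> carrier ?P" "c = ?q p" using carA by blast
      then show "h' c = h c" using eq[of p] h_q[of p] by simp
    qed (use h' in \<open>auto simp: h_def\<close>)
  qed
qed

subsection \<open>The standard space\<close>

lemma (in field) vectorspace_std_space: "vectorspace R (std_space n R)"
  by (simp add: vectorspace_def func_space_is_module field_axioms)

lemma (in field) dim_std_space: "vectorspace.dim R (std_space n R) = n"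
proof -
  let ?V = "std_space n R"
  interpret V: vectorspace R ?V by (rule vectorspace_std_space)
  define \<delta> where "\<delta> = (\<lambda>i. \<lambda>j\<in>{..<n}. if i = j then \<one> else \<zero>)"
  let ?B = "\<delta> ` {..<n}"
  have carV: "carrier ?V = {..<n} \<rightarrow>\<^sub>E carrier R" by (simp add: func_space_def)
  have \<delta>V: "\<delta> i \<in> carrier ?V" for i by (auto simp: carV \<delta>_def)
  have inj: "inj_on \<delta> {..<n}"
  proof (rule inj_onI)
    fix i j assume "i \<in> {..<n}" "j \<in> {..<n}" "\<delta> i = \<delta> j"
    then have "\<delta> i j = \<delta> j j" by simp
    then show "i = j" using \<open>j \<in> {..<n}\<close> by (simp add: \<delta>_def split: if_splits)
  qed
  have at: "(\<Oplus>\<^bsub>?V\<^esub>x\<in>F. f x) j = (\<Oplus>x\<in>F. f x j)"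
    if "finite F" "\<And>x. x \<in> F \<Longrightarrow> f x \<in> carrier ?V" "j < n" for F :: "nat set" and f j
    using that(1,2)
  proof (induction F rule: finite_induct)
    case empty
    have "\<zero>\<^bsub>?V\<^esub> j = \<zero>" using that(3) by (simp add: func_space_def)
    then show ?case by (simp add: V.M.finsum_empty)
  next
    case (insert x F)
    have "(\<Oplus>\<^bsub>?V\<^esub>x\<in>insert x F. f x) = f x \<oplus>\<^bsub>?V\<^esub> (\<Oplus>\<^bsub>?V\<^esub>x\<in>F. f x)"
      using insert by (intro V.M.finsum_insert) auto
    then have "(\<Oplus>\<^bsub>?V\<^esub>x\<in>insert x F. f x) j = f x j \<oplus> (\<Oplus>\<^bsub>?V\<^esub>x\<in>F. f x) j"
      using that(3) by (simp add: func_space_def)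
    also have "\<dots> = f x j \<oplus> (\<Oplus>x\<in>F. f x j)" using insert by simp
    also have "\<dots> = (\<Oplus>x\<in>insert x F. f x j)"
      using insert.hyps insert.prems that(3) unfolding carV
      by (intro finsum_insert[symmetric]) auto
    finally show ?case .
  qed
  have lin: "V.lincomb a ?B j = a (\<delta> j)" if a: "a \<in> ?B \<rightarrow> carrier R" and j: "j < n" for a j
  proof -
    have ac: "a (\<delta> i) \<in> carrier R" if "i < n" for i using a that by auto
    have \<delta>_at: "\<delta> i j = (if i = j then \<one> else \<zero>)" for i using j by (simp add: \<delta>_def)
    have "V.lincomb a ?B = (\<Oplus>\<^bsub>?V\<^esub>i\<in>{..<n}. a (\<delta> i) \<odot>\<^bsub>?V\<^esub> \<delta> i)"
      unfolding V.lincomb_def using a inj \<delta>V by (intro V.M.finsum_reindex) auto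
    then have "V.lincomb a ?B j = (\<Oplus>i\<in>{..<n}. (a (\<delta> i) \<odot>\<^bsub>?V\<^esub> \<delta> i) j)"
      using at[of "{..<n}" "\<lambda>i. a (\<delta> i) \<odot>\<^bsub>?V\<^esub> \<delta> i" j] a j \<delta>V by auto
    also have "\<dots> = (\<Oplus>i\<in>{..<n}. if j = i then a (\<delta> i) else \<zero>)"
      using ac j by (intro finsum_cong') (auto simp: func_space_def \<delta>_at)
    also have "\<dots> = a (\<delta> j)" using ac j by (intro finsum_singleton) auto
    finally show ?thesis .
  qed
  have BV: "?B \<subseteq> carrier ?V" using \<delta>V by auto
  have "V.lin_indpt ?B"
  proof (rule V.finite_lin_indpt2)
    fix a assume a: "a \<in> ?B \<rightarrow> carrier R" "V.lincomb a ?B = \<zero>\<^bsub>?V\<^esub>"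
    have "a (\<delta> j) = \<zero>" if "j < n" for j
      using lin[OF a(1) that] that unfolding a(2) by (simp add: func_space_def)
    then show "\<forall>v\<in>?B. a v = \<zero>" by auto
  qed (use BV in auto)
  moreover have "V.span ?B = carrier ?V"
  proof (intro subset_antisym subsetI)
    fix v assume "v \<in> V.span ?B"
    then show "v \<in> carrier ?V" using V.span_is_subset2[OF BV] by blast
  next
    fix v assume v: "v \<in> carrier ?V"
    define a where "a = (\<lambda>b. v (the_inv_into {..<n} \<delta> b))"
    have a_\<delta>: "a (\<delta> i) = v i" if "i < n" for i
      using the_inv_into_f_f[OF inj, of i] that by (simp add: a_def)
    then have a: "a \<in> ?B \<rightarrow> carrier R" using v by (auto simp: carV)
    have "V.lincomb a ?B = v"
    proof (rule PiE_ext)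
      show "V.lincomb a ?B \<in> {..<n} \<rightarrow>\<^sub>E carrier R" using V.lincomb_closed[OF BV a] carV by simp
      show "v \<in> {..<n} \<rightarrow>\<^sub>E carrier R" using v carV by simp
    qed (use lin[OF a] a_\<delta> in auto)
    then show "v \<in> V.span ?B"
      unfolding V.finite_span[OF finite_imageI[OF finite_lessThan] BV] using a by blast
  qed
  ultimately have "V.basis ?B" using BV unfolding V.basis_def by simp
  then have "V.dim = card ?B" by (intro V.dim_basis) auto
  then show ?thesis using card_image[OF inj] by simp
qed

end

theory Submission
  imports Defs
begin

text \<open>Over the algebraic closure \<open>L_x\<close> of \<open>k(x)\<close>, the representation \<open>\<rho>_x\<close> is not \<open>m\<close>-thick iff there are
  subspaces \<open>V1\<close>, \<open>V2\<close> of dimensions \<open>m\<close> and \<open>n - m\<close> such that \<open>\<rho>(g) V1\<close> meets \<open>V2\<close> nontrivially for all \<open>g\<close>.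
  The set \<open>C\<close> of these points is the image of a closed subset of \<open>Rep_n(G)\<close> times two Grassmannians,
  hence closed because Grassmannians are proper. Properness enters in its valuative form, and without
  any finiteness assumption on \<open>G\<close>. Let the prime \<open>p\<close> lie in the closure of \<open>C\<close>. An ultrafilter on \<open>C\<close> that
  contains \<open>{q. f \<notin> q}\<close> for all \<open>f \<notin> p\<close> gives an ultraproduct \<open>F\<close> of the fields \<open>L_q\<close>, which again carries
  such subspaces, and the kernel of \<open>A \<rightarrow> F\<close> is contained in \<open>p\<close>. By Chevalley's extension theorem the
  induced map from the image of \<open>A\<close> to \<open>L_p\<close> extends to a valuation ring of \<open>F\<close>. Subspaces of \<open>F^n\<close> have
  bases in reduced echelon form over the valuation ring, and these specialize to \<open>L_p\<close>.\<close>

section \<open>Extending homomorphisms to valuation rings\<close>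

text \<open>A point in the closure of \<open>C\<close> is not automatically a specialization of a
  point of \<open>C\<close>, so the valuative argument has no single point to start from. The kernel
  of \<open>A \<rightarrow> F\<close> takes over this role: it is a prime below \<open>p\<close>
  over which degenerate data are known, with values in \<open>F\<close>. The limits of the subspaces
  are defined over \<open>L_p\<close> and possibly not over \<open>k(p)\<close>. Chevalley's
  extension sends an element of \<open>F\<close> to a root of a polynomial, and the root has to
  exist in the target. This is where absolute thickness, and not mere thickness, is forced. An
  infinite \<open>G\<close> does no harm, because the two subspaces are chosen once, while each
  \<open>g\<close> only asks for its own common vector, which is normalized separately from all
  others. The closures of all residue fields of one ring have the same HOL type, so they form a
  family \<open>L\<close> whose product is again a ring in HOL.\<close>

lemma coeff_UP: "f \<in> carrier (UP R) \<Longrightarrow> up_ring.coeff (UP R) f i = f i"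
  by (simp add: UP_def)

lemma UP_bounded:
  assumes "f \<in> carrier (UP R)"
  obtains N where "\<And>i. N < i \<Longrightarrow> f i = \<zero>\<^bsub>R\<^esub>"
  using assms by (auto simp: UP_def up_def bound_def)

text \<open>Algebraic closedness speaks about list polynomials, while the extension argument uses
  the coefficient functions of \<open>UP\<close>; this translates between the two.\<close>

lemma (in algebraically_closed) exists_root:
  fixes b :: "nat \<Rightarrow> 'a" and d :: nat
  assumes b: "\<And>i. i \<le> d \<Longrightarrow> b i \<in> carrier L" and lead: "b d \<noteq> \<zero>" and "0 < d"
  obtains \<omega> where "\<omega> \<in> carrier L" "(\<Oplus>i\<in>{..d}. b i \<otimes> \<omega> [^] i) = \<zero>"
proof -
  \<comment> \<open>List polynomials carry the leading coefficient first, so the coefficients are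
    listed backwards and the induction adds one leading term at a time.\<close>
  define p where "p k = map b (rev [0..<k])" for k
  have eval_p: "eval (p (Suc k)) \<omega> = (\<Oplus>i\<in>{..k}. b i \<otimes> \<omega> [^] i)"
    if "k \<le> d" "\<omega> \<in> carrier L" for k \<omega>
    using that(1)
  proof (induction k)
    case 0
    then show ?case using that b[of 0] by (simp add: p_def)
  next
    case (Suc k)
    have "eval (p (Suc (Suc k))) \<omega> = b (Suc k) \<otimes> \<omega> [^] (Suc k) \<oplus> eval (p (Suc k)) \<omega>"
      by (simp add: p_def)
    also have "\<dots> = b (Suc k) \<otimes> \<omega> [^] (Suc k) \<oplus> (\<Oplus>i\<in>{..k}. b i \<otimes> \<omega> [^] i)"
      using Suc by simp
    also have "\<dots> = (\<Oplus>i\<in>{..Suc k}. b i \<otimes> \<omega> [^] i)"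
      using Suc.prems that b by (subst finsum_Suc) (auto simp: Pi_def)
    finally show ?case .
  qed
  let ?p = "p (Suc d)"
  have p: "?p \<in> carrier (poly_ring L)"
    using b lead by (auto simp: univ_poly_def polynomial_def p_def)
  have deg: "degree ?p = d" by (simp add: p_def)
  have "splitted ?p" using p by (rule roots_over_carrier)
  then have "roots ?p \<noteq> {#}"
    using deg \<open>0 < d\<close> unfolding splitted_def by auto
  then obtain \<omega> where "\<omega> \<in># roots ?p" by blast
  then have "is_root ?p \<omega>" using roots_mem_iff_is_root[OF p] by simp
  then have "\<omega> \<in> carrier L" "eval ?p \<omega> = \<zero>" by (auto simp: is_root_def)
  then show thesis using eval_p[of d \<omega>] that by simp
qed

text \<open>Clearing denominators in a polynomial in \<open>1/y\<close> reverses it. This moves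
  relations for the inverse of an element of \<open>A\<close> into \<open>A\<close>, and turns
  relations for \<open>1/x\<close> into relations for \<open>x\<close>.\<close>

lemma (in field) reverse_sum:
  fixes a :: "nat \<Rightarrow> 'a" and N :: nat
  assumes "y \<in> carrier R" "y \<noteq> \<zero>" "\<And>i. i \<le> N \<Longrightarrow> a i \<in> carrier R"
  shows "y [^] N \<otimes> (\<Oplus>i\<in>{..N}. a i \<otimes> inv y [^] i) = (\<Oplus>i\<in>{..N}. a i \<otimes> y [^] (N - i))"
proof -
  have y: "inv y \<in> carrier R" using assms by (simp add: field_Units)
  have pow: "y [^] N \<otimes> inv y [^] i = y [^] (N - i)" if "i \<le> N" for i
  proof -
    have "y [^] N = y [^] (N - i) \<otimes> y [^] i" using that assms by (simp add: nat_pow_mult)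
    moreover have "y [^] i \<otimes> inv y [^] i = \<one>"
      using assms y by (simp add: nat_pow_distrib[symmetric] field_Units)
    ultimately show ?thesis using assms y by (simp add: m_assoc)
  qed
  have "y [^] N \<otimes> (\<Oplus>i\<in>{..N}. a i \<otimes> inv y [^] i) = (\<Oplus>i\<in>{..N}. y [^] N \<otimes> (a i \<otimes> inv y [^] i))"
    using assms y by (intro finsum_rdistr) auto
  also have "\<dots> = (\<Oplus>i\<in>{..N}. a i \<otimes> y [^] (N - i))"
  proof (intro finsum_cong' refl)
    fix i assume "i \<in> {..N}"
    then show "y [^] N \<otimes> (a i \<otimes> inv y [^] i) = a i \<otimes> y [^] (N - i)"
      using assms y m_lcomm[of "y [^] N" "a i" "inv y [^] i"] by (simp add: pow)
  qed (use assms in auto)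
  finally show ?thesis .
qed

text \<open>The homomorphism theorem with the image of \<open>f\<close> as a subring instead of a
  quotient: the choice of a preimage does not matter because \<open>ker f\<close> lies in
  \<open>ker g\<close>. It yields the extension to \<open>A[x]\<close> and, later, the map to which
  Chevalley's theorem is applied.\<close>

lemma ring_hom_factor:
  assumes "ring R" "ring S" "ring T" and f: "f \<in> ring_hom R S" and g: "g \<in> ring_hom R T"
    and ker: "\<And>r. r \<in> carrier R \<Longrightarrow> f r = \<zero>\<^bsub>S\<^esub> \<Longrightarrow> g r = \<zero>\<^bsub>T\<^esub>"
  obtains \<psi> where "\<psi> \<in> ring_hom (S\<lparr>carrier := f ` carrier R\<rparr>) T" "\<And>r. r \<in> carrier R \<Longrightarrow> \<psi> (f r) = g r"
proof -
  interpret R: ring R by fact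
  interpret S: ring S by fact
  interpret T: ring T by fact
  interpret f: ring_hom_ring R S f using f by (rule ring_hom_ringI2[OF R.ring_axioms S.ring_axioms])
  interpret g: ring_hom_ring R T g using g by (rule ring_hom_ringI2[OF R.ring_axioms T.ring_axioms])
  define \<psi> where "\<psi> y = g (SOME r. r \<in> carrier R \<and> f r = y)" for y
  have \<psi>: "\<psi> (f r) = g r" if r: "r \<in> carrier R" for r
  proof -
    let ?s = "SOME s. s \<in> carrier R \<and> f s = f r"
    have s: "?s \<in> carrier R \<and> f ?s = f r" by (rule someI[of _ r]) (use r in simp)
    then have "f (?s \<ominus>\<^bsub>R\<^esub> r) = \<zero>\<^bsub>S\<^esub>"
      using r by (simp add: R.minus_eq S.r_neg)
    then have "g (?s \<ominus>\<^bsub>R\<^esub> r) = \<zero>\<^bsub>T\<^esub>" using r s by (intro ker) auto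
    then have "g ?s \<ominus>\<^bsub>T\<^esub> g r = \<zero>\<^bsub>T\<^esub>"
      using r s by (simp add: R.minus_eq T.minus_eq)
    then show ?thesis using r s by (simp add: \<psi>_def)
  qed
  have "\<psi> \<in> ring_hom (S\<lparr>carrier := f ` carrier R\<rparr>) T"
  proof (rule ring_hom_memI)
    fix y z assume "y \<in> carrier (S\<lparr>carrier := f ` carrier R\<rparr>)" "z \<in> carrier (S\<lparr>carrier := f ` carrier R\<rparr>)"
    then obtain r s where rs: "r \<in> carrier R" "s \<in> carrier R" "y = f r" "z = f s" by auto
    show "\<psi> y \<in> carrier T" using rs by (simp add: \<psi>)
    show "\<psi> (y \<otimes>\<^bsub>S\<lparr>carrier := f ` carrier R\<rparr>\<^esub> z) = \<psi> y \<otimes>\<^bsub>T\<^esub> \<psi> z"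
      using rs \<psi>[of "r \<otimes>\<^bsub>R\<^esub> s"] by (simp add: \<psi>)
    show "\<psi> (y \<oplus>\<^bsub>S\<lparr>carrier := f ` carrier R\<rparr>\<^esub> z) = \<psi> y \<oplus>\<^bsub>T\<^esub> \<psi> z"
      using rs \<psi>[of "r \<oplus>\<^bsub>R\<^esub> s"] by (simp add: \<psi>)
  next
    show "\<psi> \<one>\<^bsub>S\<lparr>carrier := f ` carrier R\<rparr>\<^esub> = \<one>\<^bsub>T\<^esub>" using \<psi>[of "\<one>\<^bsub>R\<^esub>"] by simp
  qed
  then show thesis using \<psi> that by blast
qed

text \<open>Maximality refers to extension of the pair \<open>(A, \<phi>)\<close> and not to
  domination of local rings. That \<open>A\<close> is local with maximal ideal
  \<open>ker \<phi>\<close> follows from \<open>inv_in_A\<close>.\<close>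

locale maximal_partial_hom = F: field F + L: algebraically_closed L
  for F :: "('a, 'e) ring_scheme" and L :: "('b, 'f) ring_scheme" +
  fixes A :: "'a set" and \<phi> :: "'a \<Rightarrow> 'b"
  assumes subring: "subring A F" and hom: "\<phi> \<in> ring_hom (F\<lparr>carrier := A\<rparr>) L"
    and maximal: "\<And>B \<psi>. subring B F \<Longrightarrow> A \<subseteq> B \<Longrightarrow> \<psi> \<in> ring_hom (F\<lparr>carrier := B\<rparr>) L \<Longrightarrow>
      (\<And>a. a \<in> A \<Longrightarrow> \<psi> a = \<phi> a) \<Longrightarrow> B \<subseteq> A"
begin

abbreviation K where "K \<equiv> F\<lparr>carrier := A\<rparr>"

sublocale K: domain K using F.subring_is_domain[OF subring] .

sublocale \<phi>: ring_hom_cring K L \<phi>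
  using hom by (intro ring_hom_cring.intro ring_hom_cring_axioms.intro K.is_cring L.is_cring)

lemma in_F [simp]: "a \<in> A \<Longrightarrow> a \<in> carrier F"
  using subringE(1)[OF subring] by auto

lemma id_hom: "id \<in> ring_hom K F"
  by (rule ring_hom_memI) auto

lemma A_closed [simp]:
  "\<zero>\<^bsub>F\<^esub> \<in> A" "\<one>\<^bsub>F\<^esub> \<in> A" "a \<in> A \<Longrightarrow> \<ominus>\<^bsub>F\<^esub> a \<in> A" "a \<in> A \<Longrightarrow> b \<in> A \<Longrightarrow> a \<otimes>\<^bsub>F\<^esub> b \<in> A"
  "a \<in> A \<Longrightarrow> b \<in> A \<Longrightarrow> a \<oplus>\<^bsub>F\<^esub> b \<in> A" "a \<in> A \<Longrightarrow> b \<in> A \<Longrightarrow> a \<ominus>\<^bsub>F\<^esub> b \<in> A"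
  "a \<in> A \<Longrightarrow> a [^]\<^bsub>F\<^esub> (k::nat) \<in> A"
proof -
  show "a \<in> A \<Longrightarrow> a [^]\<^bsub>F\<^esub> (k::nat) \<in> A"
    by (induction k) (use subringE[OF subring] in auto)
qed (use subringE[OF subring] in \<open>auto simp: F.minus_eq\<close>)

lemma \<phi>_simps [simp]:
  "\<phi> \<zero>\<^bsub>F\<^esub> = \<zero>\<^bsub>L\<^esub>" "\<phi> \<one>\<^bsub>F\<^esub> = \<one>\<^bsub>L\<^esub>" "a \<in> A \<Longrightarrow> \<phi> a \<in> carrier L"
  "a \<in> A \<Longrightarrow> b \<in> A \<Longrightarrow> \<phi> (a \<otimes>\<^bsub>F\<^esub> b) = \<phi> a \<otimes>\<^bsub>L\<^esub> \<phi> b"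
  "a \<in> A \<Longrightarrow> b \<in> A \<Longrightarrow> \<phi> (a \<oplus>\<^bsub>F\<^esub> b) = \<phi> a \<oplus>\<^bsub>L\<^esub> \<phi> b"
  "a \<in> A \<Longrightarrow> \<phi> (\<ominus>\<^bsub>F\<^esub> a) = \<ominus>\<^bsub>L\<^esub> \<phi> a"
proof -
  \<comment> \<open>The negative is defined by a description over the carrier, so negatives in
    \<open>K\<close> and in \<open>F\<close> have to be identified.\<close>
  have inv: "\<ominus>\<^bsub>K\<^esub> a = \<ominus>\<^bsub>F\<^esub> a" if "a \<in> A" for a
    using that K.minus_equality[of "\<ominus>\<^bsub>F\<^esub> a" a] by (simp add: F.l_neg)
  show "a \<in> A \<Longrightarrow> \<phi> (\<ominus>\<^bsub>F\<^esub> a) = \<ominus>\<^bsub>L\<^esub> \<phi> a"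
    using \<phi>.hom_a_inv[of a] inv by simp
qed (use \<phi>.hom_zero \<phi>.hom_one \<phi>.hom_mult \<phi>.hom_add \<phi>.hom_closed in auto)

lemma \<phi>_minus [simp]: "a \<in> A \<Longrightarrow> b \<in> A \<Longrightarrow> \<phi> (a \<ominus>\<^bsub>F\<^esub> b) = \<phi> a \<ominus>\<^bsub>L\<^esub> \<phi> b"
  by (simp add: F.minus_eq L.minus_eq)

lemma \<phi>_pow [simp]: "a \<in> A \<Longrightarrow> \<phi> (a [^]\<^bsub>F\<^esub> (k::nat)) = \<phi> a [^]\<^bsub>L\<^esub> k"
  by (induction k) auto

lemma finsum_A:
  assumes "\<And>i. i \<in> I \<Longrightarrow> f i \<in> A"
  shows "(\<Oplus>\<^bsub>F\<^esub>i\<in>I. f i) \<in> A" "\<phi> (\<Oplus>\<^bsub>F\<^esub>i\<in>I. f i) = (\<Oplus>\<^bsub>L\<^esub>i\<in>I. \<phi> (f i))"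
proof -
  have "(\<Oplus>\<^bsub>F\<^esub>i\<in>I. f i) \<in> A \<and> \<phi> (\<Oplus>\<^bsub>F\<^esub>i\<in>I. f i) = (\<Oplus>\<^bsub>L\<^esub>i\<in>I. \<phi> (f i))"
    using assms by (induction I rule: infinite_finite_induct) (auto simp: Pi_def)
  then show "(\<Oplus>\<^bsub>F\<^esub>i\<in>I. f i) \<in> A" "\<phi> (\<Oplus>\<^bsub>F\<^esub>i\<in>I. f i) = (\<Oplus>\<^bsub>L\<^esub>i\<in>I. \<phi> (f i))" by auto
qed

text \<open>Polynomials over \<open>A\<close> are evaluated twice, in \<open>F\<close> through the
  inclusion and in \<open>L\<close> through \<open>\<phi>\<close>. Extending \<open>\<phi>\<close>
  to \<open>A[x]\<close> means comparing the kernels of the two evaluations.\<close>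

abbreviation P where "P \<equiv> UP K"
abbreviation ev where "ev \<equiv> UnivPoly.eval K F id"
abbreviation ev' where "ev' \<equiv> UnivPoly.eval K L \<phi>"

sublocale E: UP_pre_univ_prop K F id P
  by (rule UP_pre_univ_propI) (auto intro: K.is_cring F.is_cring id_hom)

sublocale E': UP_pre_univ_prop K L \<phi> P
  by (rule UP_pre_univ_propI) (auto intro: K.is_cring L.is_cring hom)

lemma coeff_A: "f \<in> carrier P \<Longrightarrow> f i \<in> A"
  using E.coeff_closed[of f i] by (simp add: coeff_UP)

lemma ev_sum:
  assumes "f \<in> carrier P" "x \<in> carrier F" "\<And>i. N < i \<Longrightarrow> f i = \<zero>\<^bsub>F\<^esub>"
  shows "ev x f = (\<Oplus>\<^bsub>F\<^esub>i\<in>{..N}. f i \<otimes>\<^bsub>F\<^esub> x [^]\<^bsub>F\<^esub> i)"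
proof -
  have "f i = \<zero>\<^bsub>F\<^esub>" if "deg K f < i" for i
    using E.deg_aboveD[OF that assms(1)] assms(1) by (simp add: coeff_UP)
  then show ?thesis
    using assms coeff_A[OF assms(1)] unfolding E.eval_on_carrier[OF assms(1)]
    by (intro F.add.finprod_mono_neutral_cong) (auto simp: coeff_UP)
qed

text \<open>Only the reductions of the coefficients have to vanish beyond \<open>N\<close>, so the
  sum may stop below the degree of \<open>f\<close>.\<close>

lemma ev'_sum:
  assumes "f \<in> carrier P" "\<omega> \<in> carrier L" "\<And>i. N < i \<Longrightarrow> \<phi> (f i) = \<zero>\<^bsub>L\<^esub>"
  shows "ev' \<omega> f = (\<Oplus>\<^bsub>L\<^esub>i\<in>{..N}. \<phi> (f i) \<otimes>\<^bsub>L\<^esub> \<omega> [^]\<^bsub>L\<^esub> i)"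
proof -
  have "f i = \<zero>\<^bsub>F\<^esub>" if "deg K f < i" for i
    using E.deg_aboveD[OF that assms(1)] assms(1) by (simp add: coeff_UP)
  then show ?thesis
    using assms coeff_A[OF assms(1)] unfolding E.eval_on_carrier[OF assms(1)]
    by (intro L.add.finprod_mono_neutral_cong) (auto simp: coeff_UP)
qed

text \<open>Sending \<open>x\<close> to \<open>\<omega>\<close> extends \<open>\<phi>\<close> to \<open>A[x]\<close>, which must be \<open>A\<close> by maximality.\<close>

lemma adjoin:
  assumes x: "x \<in> carrier F" and \<omega>: "\<omega> \<in> carrier L"
    and zero: "\<And>f. f \<in> carrier P \<Longrightarrow> ev x f = \<zero>\<^bsub>F\<^esub> \<Longrightarrow> ev' \<omega> f = \<zero>\<^bsub>L\<^esub>"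
  shows "x \<in> A"
proof -
  interpret e: ring_hom_cring P F "ev x"
    using E.eval_ring_hom[OF x]
    by (intro ring_hom_cring.intro ring_hom_cring_axioms.intro E.UP_cring F.is_cring)
  interpret e': ring_hom_cring P L "ev' \<omega>"
    using E'.eval_ring_hom[OF \<omega>]
    by (intro ring_hom_cring.intro ring_hom_cring_axioms.intro E.UP_cring L.is_cring)
  define B where "B = ev x ` carrier P"
  obtain \<psi> where \<psi>: "\<psi> \<in> ring_hom (F\<lparr>carrier := B\<rparr>) L" "\<And>f. f \<in> carrier P \<Longrightarrow> \<psi> (ev x f) = ev' \<omega> f"
    using ring_hom_factor[OF E.P.ring_axioms F.ring_axioms L.ring_axioms e.homh e'.homh zero]
    unfolding B_def by blast
  have const: "ev x (monom P a 0) = a" "ev' \<omega> (monom P a 0) = \<phi> a" if "a \<in> A" for a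
    using that x \<omega> E.eval_const[of x a] E'.eval_const[of \<omega> a] by simp_all
  have B: "subring B F" unfolding B_def
    by (rule ring_hom_ring.img_is_subring[OF ring_hom_ringI2[OF E.P.ring_axioms F.ring_axioms e.homh]])
      (rule E.P.carrier_is_subring)
  have "B \<subseteq> A"
  proof (rule maximal[OF B])
    show "A \<subseteq> B"
    proof
      fix a assume "a \<in> A"
      then show "a \<in> B" unfolding B_def
        by (intro image_eqI[of _ _ "monom P a 0"]) (auto simp: const)
    qed
    show "\<psi> a = \<phi> a" if "a \<in> A" for a
      using \<psi>(2)[of "monom P a 0"] that by (simp add: const)
  qed (rule \<psi>(1))
  moreover have "x \<in> B" unfolding B_def
  proof (rule image_eqI[of _ _ "monom P \<one>\<^bsub>K\<^esub> 1"])
    show "x = ev x (monom P \<one>\<^bsub>K\<^esub> 1)" using E.eval_monom1[OF x] by simp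
  qed (rule E.monom_closed, simp)
  ultimately show ?thesis by blast
qed

text \<open>\<open>\<phi>\<close> extends to \<open>A[1/r]\<close> by sending \<open>1/r\<close> to
  \<open>1/\<phi>(r)\<close>: multiplied by a power of \<open>r\<close>, a polynomial relation for
  \<open>1/r\<close> becomes an equation in \<open>A\<close>, to which \<open>\<phi>\<close>
  applies, and the power of \<open>\<phi>(r)\<close> cancels in \<open>L\<close>.\<close>

lemma inv_in_A:
  assumes "r \<in> A" "\<phi> r \<noteq> \<zero>\<^bsub>L\<^esub>"
  shows "inv\<^bsub>F\<^esub> r \<in> A"
proof (rule adjoin)
  have r: "r \<in> carrier F" "r \<noteq> \<zero>\<^bsub>F\<^esub>" using assms by auto
  show x: "inv\<^bsub>F\<^esub> r \<in> carrier F" and \<omega>: "inv\<^bsub>L\<^esub> \<phi> r \<in> carrier L"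
    using r assms by (simp_all add: F.field_Units L.field_Units)
  fix f assume f: "f \<in> carrier P" "ev (inv\<^bsub>F\<^esub> r) f = \<zero>\<^bsub>F\<^esub>"
  obtain N where N: "\<And>i. N < i \<Longrightarrow> f i = \<zero>\<^bsub>F\<^esub>" using UP_bounded[OF f(1)] by auto
  note fA = coeff_A[OF f(1)]
  have "(\<Oplus>\<^bsub>F\<^esub>i\<in>{..N}. f i \<otimes>\<^bsub>F\<^esub> r [^]\<^bsub>F\<^esub> (N - i)) = r [^]\<^bsub>F\<^esub> N \<otimes>\<^bsub>F\<^esub> ev (inv\<^bsub>F\<^esub> r) f"
    using r fA by (simp add: ev_sum[OF f(1) x N] F.reverse_sum)
  then have "\<phi> (\<Oplus>\<^bsub>F\<^esub>i\<in>{..N}. f i \<otimes>\<^bsub>F\<^esub> r [^]\<^bsub>F\<^esub> (N - i)) = \<zero>\<^bsub>L\<^esub>"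
    using f(2) r by simp
  also have "\<phi> (\<Oplus>\<^bsub>F\<^esub>i\<in>{..N}. f i \<otimes>\<^bsub>F\<^esub> r [^]\<^bsub>F\<^esub> (N - i))
      = (\<Oplus>\<^bsub>L\<^esub>i\<in>{..N}. \<phi> (f i) \<otimes>\<^bsub>L\<^esub> \<phi> r [^]\<^bsub>L\<^esub> (N - i))"
    using assms fA by (subst finsum_A(2)) (auto intro!: L.finsum_cong')
  also have "\<dots> = \<phi> r [^]\<^bsub>L\<^esub> N \<otimes>\<^bsub>L\<^esub> ev' (inv\<^bsub>L\<^esub> \<phi> r) f"
    using assms fA N by (subst ev'_sum[OF f(1) \<omega>, of N]) (auto simp: L.reverse_sum)
  finally have "\<phi> r [^]\<^bsub>L\<^esub> N \<otimes>\<^bsub>L\<^esub> ev' (inv\<^bsub>L\<^esub> \<phi> r) f = \<zero>\<^bsub>L\<^esub>" .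
  moreover have "\<phi> r [^]\<^bsub>L\<^esub> N \<noteq> \<zero>\<^bsub>L\<^esub>"
    using assms by (induction N) (auto simp: L.integral_iff)
  moreover have "ev' (inv\<^bsub>L\<^esub> \<phi> r) f \<in> carrier L"
    using ring_hom_closed[OF E'.eval_ring_hom[OF \<omega>] f(1)] .
  ultimately show "ev' (inv\<^bsub>L\<^esub> \<phi> r) f = \<zero>\<^bsub>L\<^esub>"
    using assms by (auto simp: L.integral_iff)
qed

text \<open>After division by the unit \<open>a 0\<close> this says that 1 lies in the ideal of
  \<open>A[x]\<close> generated by \<open>ker \<phi>\<close>, the obstruction to extending
  \<open>\<phi>\<close> to \<open>x\<close>.\<close>

definition relation :: "'a \<Rightarrow> nat \<Rightarrow> (nat \<Rightarrow> 'a) \<Rightarrow> bool" where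
  "relation x N a \<longleftrightarrow> (\<forall>i\<le>N. a i \<in> A) \<and> \<phi> (a 0) \<noteq> \<zero>\<^bsub>L\<^esub> \<and> (\<forall>i\<le>N. 0 < i \<longrightarrow> \<phi> (a i) = \<zero>\<^bsub>L\<^esub>) \<and>
     (\<Oplus>\<^bsub>F\<^esub>i\<in>{..N}. a i \<otimes>\<^bsub>F\<^esub> x [^]\<^bsub>F\<^esub> i) = \<zero>\<^bsub>F\<^esub>"

text \<open>Without a relation, \<open>\<phi>\<close> would extend to \<open>A[x]\<close>. Reduce
  the polynomials that vanish at \<open>x\<close> modulo \<open>ker \<phi>\<close>, and take one
  whose nonzero reduction has least degree. That degree is positive, so the reduction has a root
  \<open>\<omega>\<close> in \<open>L\<close>; by division with remainder every other reduction
  vanishes at \<open>\<omega>\<close> as well, and \<open>x\<close> may be sent to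
  \<open>\<omega>\<close>.\<close>

lemma relation_exists:
  assumes x: "x \<in> carrier F" "x \<notin> A"
  obtains N a where "relation x N a"
proof (rule ccontr)
  assume "\<not> thesis"
  with that have no_rel: "\<not> relation x N a" for N a by blast
  define J where "J = {f \<in> carrier P. ev x f = \<zero>\<^bsub>F\<^esub>}"
  \<comment> \<open>\<open>d\<close> is the degree of the reduction of \<open>f\<close>, which may
    be smaller than the degree of \<open>f\<close>.\<close>
  define lead where "lead d f \<longleftrightarrow> \<phi> (f d) \<noteq> \<zero>\<^bsub>L\<^esub> \<and> (\<forall>i>d. \<phi> (f i) = \<zero>\<^bsub>L\<^esub>)" for d :: nat and f :: "nat \<Rightarrow> 'a"
  have ex_lead: "\<exists>d. lead d f" if f: "f \<in> carrier P" "\<phi> (f k) \<noteq> \<zero>\<^bsub>L\<^esub>" for f k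
  proof -
    obtain N where N: "\<And>i. N < i \<Longrightarrow> f i = \<zero>\<^bsub>F\<^esub>" using UP_bounded[OF f(1)] by auto
    let ?S = "{i. \<phi> (f i) \<noteq> \<zero>\<^bsub>L\<^esub>}"
    have "?S \<subseteq> {..N}" using N by (auto simp: not_less[symmetric])
    then have "finite ?S" "?S \<noteq> {}" using f(2) by (auto intro: finite_subset)
    then have "Max ?S \<in> ?S" "\<And>i. i \<in> ?S \<Longrightarrow> i \<le> Max ?S" using Max_in Max_ge by blast+
    then have "lead (Max ?S) f"
      unfolding lead_def by (metis (mono_tags, lifting) leD mem_Collect_eq)
    then show ?thesis ..
  qed
  have "\<exists>f\<in>J. \<exists>k. \<phi> (f k) \<noteq> \<zero>\<^bsub>L\<^esub>"
  proof (rule ccontr)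
    assume *: "\<not> ?thesis"
    \<comment> \<open>If all of \<open>J\<close> reduces to 0, no value for \<open>x\<close> is
      excluded; 0 is taken.\<close>
    have "x \<in> A"
    proof (rule adjoin[OF x(1) L.zero_closed])
      fix f assume "f \<in> carrier P" "ev x f = \<zero>\<^bsub>F\<^esub>"
      moreover from this have "\<phi> (f k) = \<zero>\<^bsub>L\<^esub>" for k using * by (auto simp: J_def)
      ultimately show "ev' \<zero>\<^bsub>L\<^esub> f = \<zero>\<^bsub>L\<^esub>" by (subst ev'_sum[of f _ 0]) auto
    qed
    then show False using x by simp
  qed
  then have "\<exists>d. \<exists>f\<in>J. lead d f" using ex_lead unfolding J_def by blast
  define d where "d = (LEAST d. \<exists>f\<in>J. lead d f)"
  have "\<exists>f\<in>J. lead d f" unfolding d_def by (rule LeastI_ex) fact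
  then obtain h where h: "h \<in> J" "lead d h" by blast
  have d_le: "d \<le> e" if "f \<in> J" "lead e f" for e f
    unfolding d_def using that by (intro Least_le) blast
  have hP: "h \<in> carrier P" and hA: "h i \<in> A" for i using h coeff_A by (auto simp: J_def)
  have hd: "\<phi> (h d) \<noteq> \<zero>\<^bsub>L\<^esub>" and h0: "\<And>i. d < i \<Longrightarrow> \<phi> (h i) = \<zero>\<^bsub>L\<^esub>" using h by (auto simp: lead_def)
  have "0 < d"
  proof (rule ccontr)
    assume "\<not> 0 < d"
    obtain N where N: "\<And>i. N < i \<Longrightarrow> h i = \<zero>\<^bsub>F\<^esub>" using UP_bounded[OF hP] by auto
    \<comment> \<open>A nonzero constant reduction means that the constant term avoids
      \<open>ker \<phi>\<close> and all other coefficients lie in it, which is a relation.\<close>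
    have "relation x N h"
      unfolding relation_def using \<open>\<not> 0 < d\<close> hA hd h0 h(1) ev_sum[OF hP x(1) N] by (auto simp: J_def)
    then show False using no_rel by simp
  qed
  obtain \<omega> where \<omega>: "\<omega> \<in> carrier L" "(\<Oplus>\<^bsub>L\<^esub>i\<in>{..d}. \<phi> (h i) \<otimes>\<^bsub>L\<^esub> \<omega> [^]\<^bsub>L\<^esub> i) = \<zero>\<^bsub>L\<^esub>"
    using L.exists_root[of d "\<lambda>i. \<phi> (h i)"] hA hd \<open>0 < d\<close> by auto
  have h\<omega>: "ev' \<omega> h = \<zero>\<^bsub>L\<^esub>" using ev'_sum[OF hP \<omega>(1) h0] \<omega>(2) by simp
  interpret e: ring_hom_cring P F "ev x"
    using E.eval_ring_hom[OF x(1)]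
    by (intro ring_hom_cring.intro ring_hom_cring_axioms.intro E.UP_cring F.is_cring)
  interpret e': ring_hom_cring P L "ev' \<omega>"
    using E'.eval_ring_hom[OF \<omega>(1)]
    by (intro ring_hom_cring.intro ring_hom_cring_axioms.intro E.UP_cring L.is_cring)
  \<comment> \<open>Division by \<open>h\<close> modulo \<open>ker \<phi>\<close>, by induction on a
    strict bound \<open>e\<close> for the degree of the reduction. Minimality of \<open>d\<close>
    ends the division with remainder 0.\<close>
  have "ev' \<omega> f = \<zero>\<^bsub>L\<^esub>" if "f \<in> J" "\<And>i. e \<le> i \<Longrightarrow> \<phi> (f i) = \<zero>\<^bsub>L\<^esub>" for e f
    using that
  proof (induction e arbitrary: f)
    case 0
    then show ?case using \<omega>(1) by (subst ev'_sum[of f _ 0]) (auto simp: J_def)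
  next
    case (Suc e)
    have fP: "f \<in> carrier P" and fx: "ev x f = \<zero>\<^bsub>F\<^esub>" and fA: "f i \<in> A" for i
      using Suc.prems coeff_A by (auto simp: J_def)
    show ?case
    proof (cases "\<phi> (f e) = \<zero>\<^bsub>L\<^esub>")
      case True
      then have "\<phi> (f i) = \<zero>\<^bsub>L\<^esub>" if "e \<le> i" for i
        using Suc.prems(2)[of i] that by (cases "i = e") auto
      then show ?thesis using Suc by blast
    next
      case False
      then have "lead e f" using Suc.prems by (auto simp: lead_def)
      then have "d \<le> e" using Suc.prems d_le by blast
      \<comment> \<open>\<open>h\<close> is not monic, but \<open>h d\<close> lies outside
        \<open>ker \<phi>\<close> and is therefore a unit of \<open>A\<close>, so the quotient of
        the leading coefficients stays in \<open>A\<close>.\<close>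
      define c where "c = f e \<otimes>\<^bsub>F\<^esub> inv\<^bsub>F\<^esub> h d"
      have inv: "inv\<^bsub>F\<^esub> h d \<in> A" using hA hd by (rule inv_in_A)
      then have cA: "c \<in> A" using fA by (simp add: c_def)
      have "h d \<noteq> \<zero>\<^bsub>F\<^esub>" using hd by auto
      then have "inv\<^bsub>F\<^esub> h d \<otimes>\<^bsub>F\<^esub> h d = \<one>\<^bsub>F\<^esub>" using hA by (simp add: F.field_Units)
      then have c: "c \<otimes>\<^bsub>F\<^esub> h d = f e"
        using fA[of e] hA[of d] inv unfolding c_def by (simp add: F.m_assoc)
      define g where "g = monom P c (e - d) \<otimes>\<^bsub>P\<^esub> h"
      have gP: "g \<in> carrier P" using cA hP by (simp add: g_def)
      have g: "g (i + (e - d)) = c \<otimes>\<^bsub>F\<^esub> h i" for i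
        using E.coeff_monom_mult[of c h "e - d" i] cA hP gP by (simp add: g_def coeff_UP)
      have "f \<ominus>\<^bsub>P\<^esub> g \<in> J"
        using fP gP fx h(1) cA by (simp add: J_def E.P.minus_eq) (simp add: g_def)
      moreover have "\<phi> ((f \<ominus>\<^bsub>P\<^esub> g) i) = \<zero>\<^bsub>L\<^esub>" if "e \<le> i" for i
      proof -
        have "(f \<ominus>\<^bsub>P\<^esub> g) i = f i \<ominus>\<^bsub>K\<^esub> g i"
          using E.coeff_minus[OF fP gP, of i] fP gP by (simp add: coeff_UP)
        also have "\<dots> = f i \<oplus>\<^bsub>F\<^esub> \<ominus>\<^bsub>K\<^esub> g i" by (simp add: K.minus_eq)
        finally have "\<phi> ((f \<ominus>\<^bsub>P\<^esub> g) i) = \<phi> (f i) \<ominus>\<^bsub>L\<^esub> \<phi> (g i)"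
          using fA[of i] coeff_A[OF gP, of i] \<phi>.hom_a_inv[of "g i"] K.a_inv_closed[of "g i"]
          by (simp add: L.minus_eq)
        moreover have "\<phi> (f i) = \<phi> (g i)"
        proof (cases "i = e")
          case True
          then show ?thesis using g[of d] \<open>d \<le> e\<close> by (simp add: c)
        next
          case False
          have "\<phi> (g i) = \<phi> c \<otimes>\<^bsub>L\<^esub> \<phi> (h (i - (e - d)))"
            using g[of "i - (e - d)"] that \<open>d \<le> e\<close> cA hA by simp
          also have "\<dots> = \<zero>\<^bsub>L\<^esub>" using h0[of "i - (e - d)"] False that \<open>d \<le> e\<close> cA by simp
          finally show ?thesis using Suc.prems(2)[of i] False that by simp
        qed
        ultimately show ?thesis using coeff_A[OF gP, of i] by (simp add: L.minus_eq L.r_neg)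
      qed
      ultimately have "ev' \<omega> (f \<ominus>\<^bsub>P\<^esub> g) = \<zero>\<^bsub>L\<^esub>" by (rule Suc.IH)
      moreover have "ev' \<omega> g = \<zero>\<^bsub>L\<^esub>" using cA hP h\<omega> by (simp add: g_def)
      ultimately show ?thesis using fP gP by (simp add: E.P.minus_eq)
    qed
  qed
  note J_zero = this
  have "x \<in> A"
  proof (rule adjoin[OF x(1) \<omega>(1)])
    fix f assume f: "f \<in> carrier P" "ev x f = \<zero>\<^bsub>F\<^esub>"
    obtain N where "\<And>i. N < i \<Longrightarrow> f i = \<zero>\<^bsub>F\<^esub>" using UP_bounded[OF f(1)] by auto
    then show "ev' \<omega> f = \<zero>\<^bsub>L\<^esub>" using J_zero[of f "Suc N"] f by (simp add: J_def)
  qed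
  then show False using x by simp
qed

text \<open>Two relations for \<open>x\<close> and \<open>1/x\<close> of degrees \<open>M \<le> N\<close> eliminate the top coefficient
  of the one for \<open>x\<close>.\<close>

lemma relation_reduce:
  assumes x: "x \<in> carrier F" "x \<noteq> \<zero>\<^bsub>F\<^esub>" and a: "relation x N a" and b: "relation (inv\<^bsub>F\<^esub> x) M b"
    and "M \<le> N"
  obtains N' a' where "N' < N" "relation x N' a'"
proof -
  have inv: "inv\<^bsub>F\<^esub> x \<in> carrier F" using x by (simp add: F.field_Units)
  have aA: "\<And>i. i \<le> N \<Longrightarrow> a i \<in> A" and a_0: "\<phi> (a 0) \<noteq> \<zero>\<^bsub>L\<^esub>"
    and a_pos: "\<And>i. i \<le> N \<Longrightarrow> 0 < i \<Longrightarrow> \<phi> (a i) = \<zero>\<^bsub>L\<^esub>"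
    and a_sum: "(\<Oplus>\<^bsub>F\<^esub>i\<in>{..N}. a i \<otimes>\<^bsub>F\<^esub> x [^]\<^bsub>F\<^esub> i) = \<zero>\<^bsub>F\<^esub>"
    using a by (auto simp: relation_def)
  have bA: "\<And>i. i \<le> M \<Longrightarrow> b i \<in> A" and b_0: "\<phi> (b 0) \<noteq> \<zero>\<^bsub>L\<^esub>"
    and b_sum: "(\<Oplus>\<^bsub>F\<^esub>i\<in>{..M}. b i \<otimes>\<^bsub>F\<^esub> (inv\<^bsub>F\<^esub> x) [^]\<^bsub>F\<^esub> i) = \<zero>\<^bsub>F\<^esub>"
    using b by (auto simp: relation_def)
  have "N \<noteq> 0"
  proof
    assume "N = 0"
    then have "a 0 = \<zero>\<^bsub>F\<^esub>" using a_sum aA by simp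
    then show False using a_0 by simp
  qed
  then obtain N' where N': "N = Suc N'" by (cases N) auto
  \<comment> \<open>Padding to length \<open>N\<close> puts \<open>b 0\<close> at \<open>x^N\<close>
    after the reversal, opposite the coefficient \<open>a N\<close>.\<close>
  define b' where "b' i = (if i \<le> M then b i else \<zero>\<^bsub>F\<^esub>)" for i
  have b'A: "b' i \<in> A" for i using bA by (simp add: b'_def)
  have "(\<Oplus>\<^bsub>F\<^esub>i\<in>{..N}. b' i \<otimes>\<^bsub>F\<^esub> (inv\<^bsub>F\<^esub> x) [^]\<^bsub>F\<^esub> i) = \<zero>\<^bsub>F\<^esub>"
    unfolding b_sum[symmetric] using \<open>M \<le> N\<close> bA inv
    by (intro F.add.finprod_mono_neutral_cong_right) (auto simp: b'_def)
  then have "(\<Oplus>\<^bsub>F\<^esub>i\<in>{..N}. b' i \<otimes>\<^bsub>F\<^esub> x [^]\<^bsub>F\<^esub> (N - i)) = \<zero>\<^bsub>F\<^esub>"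
    using F.reverse_sum[OF x, of N b'] b'A x by simp
  also have "(\<Oplus>\<^bsub>F\<^esub>i\<in>{..N}. b' i \<otimes>\<^bsub>F\<^esub> x [^]\<^bsub>F\<^esub> (N - i))
      = (\<Oplus>\<^bsub>F\<^esub>i\<in>(\<lambda>i. N - i) ` {..N}. b' (N - i) \<otimes>\<^bsub>F\<^esub> x [^]\<^bsub>F\<^esub> i)"
    using b'A x by (subst F.finsum_reindex) (auto simp: inj_on_def intro!: F.finsum_cong')
  also have "(\<lambda>i. N - i) ` {..N} = {..N}"
    by (auto simp: image_iff) (metis atMost_iff diff_diff_cancel diff_le_self)
  finally have b'_sum: "(\<Oplus>\<^bsub>F\<^esub>i\<in>{..N}. b' (N - i) \<otimes>\<^bsub>F\<^esub> x [^]\<^bsub>F\<^esub> i) = \<zero>\<^bsub>F\<^esub>" .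
  define c where "c = a N \<otimes>\<^bsub>F\<^esub> inv\<^bsub>F\<^esub> b 0"
  have invA: "inv\<^bsub>F\<^esub> b 0 \<in> A" using bA b_0 by (intro inv_in_A) auto
  then have cA: "c \<in> A" using aA by (simp add: c_def)
  have "b 0 \<noteq> \<zero>\<^bsub>F\<^esub>" using b_0 by auto
  then have "inv\<^bsub>F\<^esub> b 0 \<otimes>\<^bsub>F\<^esub> b 0 = \<one>\<^bsub>F\<^esub>" using bA by (simp add: F.field_Units)
  then have c: "c \<otimes>\<^bsub>F\<^esub> b 0 = a N"
    using aA bA invA unfolding c_def by (simp add: F.m_assoc)
  \<comment> \<open>As \<open>N\<close> is positive, \<open>a N\<close> and hence \<open>c\<close>
    lie in \<open>ker \<phi>\<close>. Subtracting \<open>c\<close> times the reversed relation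
    leaves all reductions unchanged, in particular the unit constant term.\<close>
  have \<phi>c: "\<phi> c = \<zero>\<^bsub>L\<^esub>" using a_pos[of N] aA invA \<open>N \<noteq> 0\<close> by (simp add: c_def)
  define a' where "a' i = a i \<ominus>\<^bsub>F\<^esub> c \<otimes>\<^bsub>F\<^esub> b' (N - i)" for i
  have a'A: "a' i \<in> A" if "i \<le> N" for i using that aA cA b'A by (simp add: a'_def)
  have \<phi>a': "\<phi> (a' i) = \<phi> (a i)" if "i \<le> N" for i
    using that aA cA b'A by (simp add: a'_def \<phi>c L.minus_eq)
  have "(\<Oplus>\<^bsub>F\<^esub>i\<in>{..N}. a' i \<otimes>\<^bsub>F\<^esub> x [^]\<^bsub>F\<^esub> i)
      = (\<Oplus>\<^bsub>F\<^esub>i\<in>{..N}. a i \<otimes>\<^bsub>F\<^esub> x [^]\<^bsub>F\<^esub> i \<oplus>\<^bsub>F\<^esub> (\<ominus>\<^bsub>F\<^esub> c) \<otimes>\<^bsub>F\<^esub> (b' (N - i) \<otimes>\<^bsub>F\<^esub> x [^]\<^bsub>F\<^esub> i))"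
    using aA cA b'A x
    by (intro F.finsum_cong') (auto simp: a'_def F.minus_eq F.l_distr F.l_minus F.m_assoc)
  also have "\<dots> = (\<Oplus>\<^bsub>F\<^esub>i\<in>{..N}. a i \<otimes>\<^bsub>F\<^esub> x [^]\<^bsub>F\<^esub> i)
      \<oplus>\<^bsub>F\<^esub> (\<Oplus>\<^bsub>F\<^esub>i\<in>{..N}. (\<ominus>\<^bsub>F\<^esub> c) \<otimes>\<^bsub>F\<^esub> (b' (N - i) \<otimes>\<^bsub>F\<^esub> x [^]\<^bsub>F\<^esub> i))"
    using aA cA b'A x by (intro F.finsum_addf) auto
  also have "(\<Oplus>\<^bsub>F\<^esub>i\<in>{..N}. (\<ominus>\<^bsub>F\<^esub> c) \<otimes>\<^bsub>F\<^esub> (b' (N - i) \<otimes>\<^bsub>F\<^esub> x [^]\<^bsub>F\<^esub> i)) = \<zero>\<^bsub>F\<^esub>"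
    using cA b'A x b'_sum
      F.finsum_rdistr[of "{..N}" "\<ominus>\<^bsub>F\<^esub> c" "\<lambda>i. b' (N - i) \<otimes>\<^bsub>F\<^esub> x [^]\<^bsub>F\<^esub> i"] by (auto simp: Pi_def)
  finally have sum: "(\<Oplus>\<^bsub>F\<^esub>i\<in>{..N}. a' i \<otimes>\<^bsub>F\<^esub> x [^]\<^bsub>F\<^esub> i) = \<zero>\<^bsub>F\<^esub>" using a_sum by simp
  have "a' N = \<zero>\<^bsub>F\<^esub>"
    using c aA by (simp add: a'_def b'_def F.minus_eq F.r_neg)
  then have "(\<Oplus>\<^bsub>F\<^esub>i\<in>{..N'}. a' i \<otimes>\<^bsub>F\<^esub> x [^]\<^bsub>F\<^esub> i) = \<zero>\<^bsub>F\<^esub>"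
    using sum a'A x unfolding N' by (subst (asm) F.finsum_Suc) (auto simp: Pi_def)
  then have "relation x N' a'"
    using a'A \<phi>a' a_0 a_pos unfolding relation_def N' by auto
  then show thesis using that[of N' a'] N' by simp
qed

text \<open>Infinite descent on the sum of the two degrees. The situation is symmetric in
  \<open>x\<close> and \<open>1/x\<close>, so the longer of the two relations can always be
  shortened.\<close>

lemma relations_incompatible:
  assumes "x \<in> carrier F" "x \<noteq> \<zero>\<^bsub>F\<^esub>" "relation x N a" "relation (inv\<^bsub>F\<^esub> x) M b"
  shows False
  using assms
proof (induction "N + M" arbitrary: x N M a b rule: less_induct)
  case less
  have inv: "inv\<^bsub>F\<^esub> x \<in> carrier F" "inv\<^bsub>F\<^esub> x \<noteq> \<zero>\<^bsub>F\<^esub>" "inv\<^bsub>F\<^esub> (inv\<^bsub>F\<^esub> x) = x"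
    using less.prems F.Units_inv_Units[of x] by (auto simp: F.field_Units)
  show ?case
  proof (cases "M \<le> N")
    case True
    then obtain N' a' where "N' < N" "relation x N' a'" using relation_reduce less.prems by metis
    then show False using less.hyps[of N' M x a' b] less.prems by simp
  next
    case False
    have "relation (inv\<^bsub>F\<^esub> (inv\<^bsub>F\<^esub> x)) N a" using inv(3) less.prems by simp
    then obtain M' b' where "M' < M" "relation (inv\<^bsub>F\<^esub> x) M' b'"
      using relation_reduce[OF inv(1,2), of M b N a] less.prems False by auto
    then show False using less.hyps[of N M' x a b'] less.prems by simp
  qed
qed

text \<open>If \<open>x\<close> and \<open>1/x\<close> were both outside \<open>A\<close>, each
  would have a relation, and such relations cannot coexist.\<close>

theorem valuation_ring:
  assumes "x \<in> carrier F" "x \<notin> A"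
  shows "inv\<^bsub>F\<^esub> x \<in> A"
proof (rule ccontr)
  assume inv: "inv\<^bsub>F\<^esub> x \<notin> A"
  have "x \<noteq> \<zero>\<^bsub>F\<^esub>" using assms A_closed(1) by metis
  then have "inv\<^bsub>F\<^esub> x \<in> carrier F" using assms by (simp add: F.field_Units)
  then show False
    using relation_exists[OF assms] relation_exists[OF _ inv] relations_incompatible assms \<open>x \<noteq> \<zero>\<^bsub>F\<^esub>\<close>
    by metis
qed

end

text \<open>Zorn's lemma on graphs: as sets of pairs, extension of partial homomorphisms is
  inclusion and the upper bound of a chain is its union. Closure under differences and products
  together with the pair of units encodes both the subring and the homomorphism.\<close>

theorem exists_maximal_partial_hom:
  assumes "field F" and "algebraically_closed L"
    and A0: "subring A0 F" and \<phi>0: "\<phi>0 \<in> ring_hom (F\<lparr>carrier := A0\<rparr>) L"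
  obtains A \<phi> where "maximal_partial_hom F L A \<phi>" "A0 \<subseteq> A" "\<And>a. a \<in> A0 \<Longrightarrow> \<phi> a = \<phi>0 a"
proof -
  interpret F: field F by fact
  interpret L: algebraically_closed L by fact
  define graph where "graph \<Gamma> \<longleftrightarrow> \<Gamma> \<subseteq> carrier F \<times> carrier L \<and> (\<one>\<^bsub>F\<^esub>, \<one>\<^bsub>L\<^esub>) \<in> \<Gamma> \<and>
      (\<forall>u\<in>\<Gamma>. \<forall>v\<in>\<Gamma>. (fst u \<ominus>\<^bsub>F\<^esub> fst v, snd u \<ominus>\<^bsub>L\<^esub> snd v) \<in> \<Gamma> \<and>
        (fst u \<otimes>\<^bsub>F\<^esub> fst v, snd u \<otimes>\<^bsub>L\<^esub> snd v) \<in> \<Gamma> \<and> (fst u = fst v \<longrightarrow> snd u = snd v))" for \<Gamma>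
  have graphI: "graph ((\<lambda>a. (a, \<phi> a)) ` A)"
    if A: "subring A F" and \<phi>: "\<phi> \<in> ring_hom (F\<lparr>carrier := A\<rparr>) L" for A \<phi>
  proof -
    note sub = subringE[OF A]
    have AF: "a \<in> carrier F" if "a \<in> A" for a using sub that by auto
    interpret K: ring "F\<lparr>carrier := A\<rparr>" using A by (rule F.subring_is_ring)
    interpret \<phi>: ring_hom_ring "F\<lparr>carrier := A\<rparr>" L \<phi>
      using \<phi> by (rule ring_hom_ringI2[OF K.ring_axioms L.ring_axioms])
    have minus: "a \<ominus>\<^bsub>F\<^esub> b \<in> A" "\<phi> (a \<ominus>\<^bsub>F\<^esub> b) = \<phi> a \<ominus>\<^bsub>L\<^esub> \<phi> b" if ab: "a \<in> A" "b \<in> A" for a b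
    proof -
      show ab': "a \<ominus>\<^bsub>F\<^esub> b \<in> A" using ab sub by (simp add: F.minus_eq)
      have "a = (a \<ominus>\<^bsub>F\<^esub> b) \<oplus>\<^bsub>F\<^esub> b" using ab AF by (simp add: F.minus_eq F.a_assoc F.l_neg)
      then have "\<phi> a = \<phi> (a \<ominus>\<^bsub>F\<^esub> b) \<oplus>\<^bsub>L\<^esub> \<phi> b" using \<phi>.hom_add[of "a \<ominus>\<^bsub>F\<^esub> b" b] ab ab' by simp
      then show "\<phi> (a \<ominus>\<^bsub>F\<^esub> b) = \<phi> a \<ominus>\<^bsub>L\<^esub> \<phi> b"
        using \<phi>.hom_closed[of "a \<ominus>\<^bsub>F\<^esub> b"] \<phi>.hom_closed[of b] ab ab'
        by (simp add: L.minus_eq L.a_assoc L.r_neg)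
    qed
    show ?thesis
      unfolding graph_def using sub AF minus \<phi>.hom_closed \<phi>.hom_mult \<phi>.hom_one
      by (auto simp: image_iff)
  qed
  have graphE: "\<exists>A \<phi>. subring A F \<and> \<phi> \<in> ring_hom (F\<lparr>carrier := A\<rparr>) L \<and> \<Gamma> = (\<lambda>a. (a, \<phi> a)) ` A"
    if \<Gamma>: "graph \<Gamma>" for \<Gamma>
  proof -
    define \<phi> where "\<phi> a = (THE y. (a, y) \<in> \<Gamma>)" for a
    have unique: "y = z" if "(a, y) \<in> \<Gamma>" "(a, z) \<in> \<Gamma>" for a y z
      using \<Gamma> that unfolding graph_def by (metis fst_conv snd_conv)
    have \<phi>: "\<phi> a = y" if "(a, y) \<in> \<Gamma>" for a y
      unfolding \<phi>_def using that unique by (intro the_equality) auto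
    have car: "a \<in> carrier F" "y \<in> carrier L" if "(a, y) \<in> \<Gamma>" for a y
      using \<Gamma> that unfolding graph_def by auto
    have one: "(\<one>\<^bsub>F\<^esub>, \<one>\<^bsub>L\<^esub>) \<in> \<Gamma>" using \<Gamma> by (simp add: graph_def)
    have minus: "(a \<ominus>\<^bsub>F\<^esub> b, y \<ominus>\<^bsub>L\<^esub> z) \<in> \<Gamma>" if "(a, y) \<in> \<Gamma>" "(b, z) \<in> \<Gamma>" for a b y z
      using \<Gamma> that unfolding graph_def by (metis fst_conv snd_conv)
    have mult: "(a \<otimes>\<^bsub>F\<^esub> b, y \<otimes>\<^bsub>L\<^esub> z) \<in> \<Gamma>" if "(a, y) \<in> \<Gamma>" "(b, z) \<in> \<Gamma>" for a b y z
      using \<Gamma> that unfolding graph_def by (metis fst_conv snd_conv)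
    have zero: "(\<zero>\<^bsub>F\<^esub>, \<zero>\<^bsub>L\<^esub>) \<in> \<Gamma>"
      using minus[OF one one] by (simp add: F.minus_eq L.minus_eq F.r_neg L.r_neg)
    have neg: "(\<ominus>\<^bsub>F\<^esub> a, \<ominus>\<^bsub>L\<^esub> y) \<in> \<Gamma>" if "(a, y) \<in> \<Gamma>" for a y
      using minus[OF zero that] car[OF that] by (simp add: F.minus_eq L.minus_eq)
    have add: "(a \<oplus>\<^bsub>F\<^esub> b, y \<oplus>\<^bsub>L\<^esub> z) \<in> \<Gamma>" if "(a, y) \<in> \<Gamma>" "(b, z) \<in> \<Gamma>" for a b y z
      using minus[OF that(1) neg[OF that(2)]] car[OF that(1)] car[OF that(2)]
      by (simp add: F.minus_eq L.minus_eq)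
    have "subring (fst ` \<Gamma>) F"
    proof (rule F.subringI)
      show "fst ` \<Gamma> \<subseteq> carrier F" using car by force
      show "\<one>\<^bsub>F\<^esub> \<in> fst ` \<Gamma>" using one by force
      show "\<ominus>\<^bsub>F\<^esub> a \<in> fst ` \<Gamma>" if "a \<in> fst ` \<Gamma>" for a using that neg by force
      show "a \<otimes>\<^bsub>F\<^esub> b \<in> fst ` \<Gamma>" if "a \<in> fst ` \<Gamma>" "b \<in> fst ` \<Gamma>" for a b using that mult by force
      show "a \<oplus>\<^bsub>F\<^esub> b \<in> fst ` \<Gamma>" if "a \<in> fst ` \<Gamma>" "b \<in> fst ` \<Gamma>" for a b using that add by force
    qed
    moreover have "\<phi> \<in> ring_hom (F\<lparr>carrier := fst ` \<Gamma>\<rparr>) L"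
      by (rule ring_hom_memI) (use \<phi>[OF mult] \<phi>[OF add] \<phi>[OF one] \<phi> car in auto)
    moreover have "\<Gamma> = (\<lambda>a. (a, \<phi> a)) ` fst ` \<Gamma>" using \<phi> by force
    ultimately show ?thesis by blast
  qed
  let ?\<Gamma>0 = "(\<lambda>a. (a, \<phi>0 a)) ` A0"
  define \<G> where "\<G> = {\<Gamma>. graph \<Gamma> \<and> ?\<Gamma>0 \<subseteq> \<Gamma>}"
  have "\<exists>\<Gamma>\<in>\<G>. \<forall>\<Delta>\<in>\<G>. \<Gamma> \<subseteq> \<Delta> \<longrightarrow> \<Delta> = \<Gamma>"
  proof (rule subset_Zorn_nonempty)
    show "\<G> \<noteq> {}" using graphI[OF A0 \<phi>0] by (auto simp: \<G>_def)
    fix \<C> assume "\<C> \<noteq> {}" and chain: "subset.chain \<G> \<C>"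
    then have mem: "graph \<Gamma>" "?\<Gamma>0 \<subseteq> \<Gamma>" if "\<Gamma> \<in> \<C>" for \<Gamma>
      using that by (auto simp: subset.chain_def \<G>_def)
    \<comment> \<open>Every closure condition on a graph involves at most two pairs, and two pairs
      from a chain lie in one member.\<close>
    have common: "\<exists>\<Gamma>\<in>\<C>. u \<in> \<Gamma> \<and> v \<in> \<Gamma>" if uv: "u \<in> \<Union>\<C>" "v \<in> \<Union>\<C>" for u v
    proof -
      obtain \<Gamma> \<Delta> where "\<Gamma> \<in> \<C>" "u \<in> \<Gamma>" "\<Delta> \<in> \<C>" "v \<in> \<Delta>" using uv by blast
      moreover from this have "\<Gamma> \<subseteq> \<Delta> \<or> \<Delta> \<subseteq> \<Gamma>" using chain by (auto simp: subset.chain_def)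
      ultimately show ?thesis by blast
    qed
    have "graph (\<Union>\<C>)"
      unfolding graph_def
    proof (intro conjI ballI)
      show "\<Union>\<C> \<subseteq> carrier F \<times> carrier L" using mem(1) by (auto simp: graph_def)
      show "(\<one>\<^bsub>F\<^esub>, \<one>\<^bsub>L\<^esub>) \<in> \<Union>\<C>" using mem(1) \<open>\<C> \<noteq> {}\<close> by (auto simp: graph_def)
      fix u v assume "u \<in> \<Union>\<C>" "v \<in> \<Union>\<C>"
      then obtain \<Gamma> where \<Gamma>: "\<Gamma> \<in> \<C>" "u \<in> \<Gamma>" "v \<in> \<Gamma>" using common by meson
      with mem(1)[OF \<Gamma>(1)] show "(fst u \<ominus>\<^bsub>F\<^esub> fst v, snd u \<ominus>\<^bsub>L\<^esub> snd v) \<in> \<Union>\<C>"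
        "(fst u \<otimes>\<^bsub>F\<^esub> fst v, snd u \<otimes>\<^bsub>L\<^esub> snd v) \<in> \<Union>\<C>" "fst u = fst v \<longrightarrow> snd u = snd v"
        unfolding graph_def by blast+
    qed
    moreover have "?\<Gamma>0 \<subseteq> \<Union>\<C>" using mem(2) \<open>\<C> \<noteq> {}\<close> by blast
    ultimately show "\<Union>\<C> \<in> \<G>" by (simp add: \<G>_def)
  qed
  then obtain \<Gamma> where "\<Gamma> \<in> \<G>" and max_\<G>: "\<forall>\<Delta>\<in>\<G>. \<Gamma> \<subseteq> \<Delta> \<longrightarrow> \<Delta> = \<Gamma>" by (rule bexE)
  then have \<Gamma>: "graph \<Gamma>" "?\<Gamma>0 \<subseteq> \<Gamma>" by (simp_all add: \<G>_def)
  have max: "\<Delta> = \<Gamma>" if "graph \<Delta>" "\<Gamma> \<subseteq> \<Delta>" for \<Delta>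
  proof -
    have "\<Delta> \<in> \<G>" using that \<Gamma>(2) unfolding \<G>_def by (intro CollectI conjI) (auto dest: subset_trans)
    then show ?thesis using max_\<G> that(2) by simp
  qed
  obtain A \<phi> where A: "subring A F" "\<phi> \<in> ring_hom (F\<lparr>carrier := A\<rparr>) L" "\<Gamma> = (\<lambda>a. (a, \<phi> a)) ` A"
    using graphE[OF \<Gamma>(1)] by blast
  show thesis
  proof (rule that[of A \<phi>])
    show "maximal_partial_hom F L A \<phi>"
    proof (intro maximal_partial_hom.intro maximal_partial_hom_axioms.intro)
      show "field F" "algebraically_closed L" by fact+
      show "subring A F" "\<phi> \<in> ring_hom (F\<lparr>carrier := A\<rparr>) L" by (rule A)+
      fix B \<psi> assume B: "subring B F" "A \<subseteq> B" "\<psi> \<in> ring_hom (F\<lparr>carrier := B\<rparr>) L"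
        "\<And>a. a \<in> A \<Longrightarrow> \<psi> a = \<phi> a"
      have "\<Gamma> \<subseteq> (\<lambda>a. (a, \<psi> a)) ` B"
        unfolding A(3) using B(2,4) by (auto intro!: image_eqI)
      then have "(\<lambda>a. (a, \<psi> a)) ` B = \<Gamma>" using graphI[OF B(1,3)] by (intro max)
      then show "B \<subseteq> A" unfolding A(3) by auto
    qed
    show "A0 \<subseteq> A" using \<Gamma>(2) unfolding A(3) by auto
    show "\<phi> a = \<phi>0 a" if "a \<in> A0" for a using \<Gamma>(2) that unfolding A(3) by auto
  qed
qed

section \<open>Ultraproducts of fields\<close>

definition ultrafilter :: "'a filter \<Rightarrow> bool" where
  "ultrafilter U \<longleftrightarrow> U \<noteq> bot \<and> (\<forall>P. eventually P U \<or> eventually (\<lambda>x. \<not> P x) U)"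

text \<open>A minimal proper filter decides every \<open>P\<close>: unless \<open>P\<close> holds
  eventually, adding the complement of \<open>P\<close> keeps the filter proper, so by minimality
  the complement was already in it.\<close>

lemma ultrafilter_exists:
  assumes "F \<noteq> bot"
  obtains U where "U \<le> F" "ultrafilter U"
proof -
  \<comment> \<open>Finer filters are smaller in the order of filters, so Zorn's lemma is applied to
    the reversed order.\<close>
  let ?A = "{U. U \<noteq> bot \<and> U \<le> F}" and ?r = "\<lambda>U V. V \<le> (U :: 'a filter)"
  have "\<exists>U\<in>?A. \<forall>V\<in>?A. ?r U V \<longrightarrow> V = U"
  proof (rule predicate_Zorn)
    show "partial_order_on ?A (relation_of ?r ?A)"
      by (rule partial_order_on_relation_ofI) auto
    fix C assume C: "C \<in> Chains (relation_of ?r ?A)"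
    then have CA: "C \<subseteq> ?A" and chain: "\<And>U V. U \<in> C \<Longrightarrow> V \<in> C \<Longrightarrow> U \<le> V \<or> V \<le> U"
      by (auto simp: Chains_def relation_of_def)
    show "\<exists>U\<in>?A. \<forall>V\<in>C. ?r V U"
    proof (cases "C = {}")
      case True
      then show ?thesis using assms by blast
    next
      case False
      \<comment> \<open>A chain is directed, so whatever holds eventually for its infimum already
        does so for a member; this keeps the infimum proper.\<close>
      have "eventually P (Inf C) \<longleftrightarrow> (\<exists>V\<in>C. eventually P V)" for P
      proof (rule eventually_Inf_base[OF False])
        fix U V assume "U \<in> C" "V \<in> C"
        then show "\<exists>W\<in>C. W \<le> inf U V" using chain[of U V] by (metis inf.orderE inf.absorb2 order_refl)
      qed
      then have "Inf C \<noteq> bot" using CA unfolding trivial_limit_def by blast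
      moreover obtain V where "V \<in> C" using False by blast
      then have "Inf C \<le> F" using CA Inf_lower[of V C] by (auto intro: order_trans)
      ultimately show ?thesis by (intro bexI[of _ "Inf C"]) (auto intro: Inf_lower)
    qed
  qed
  then obtain U where U: "U \<noteq> bot" "U \<le> F" and min: "\<And>V. V \<noteq> bot \<Longrightarrow> V \<le> U \<Longrightarrow> V = U"
    using order_trans by blast
  have "eventually (\<lambda>x. \<not> P x) U" if "\<not> eventually P U" for P
  proof -
    let ?V = "inf U (principal {x. \<not> P x})"
    have "?V \<noteq> bot" using that unfolding trivial_limit_def eventually_inf_principal by simp
    then have "U \<le> principal {x. \<not> P x}" using min[of ?V] by (metis inf_le1 inf_le2)
    then show ?thesis by (simp add: le_principal)
  qed
  then have "ultrafilter U" using U by (auto simp: ultrafilter_def)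
  then show thesis using U that by blast
qed

text \<open>Directedness makes the sets \<open>B x\<close> a filter base, so it is enough that each
  single one is nonempty.\<close>

lemma ultrafilter_of_base:
  assumes "S \<noteq> {}" and nonempty: "\<And>x. x \<in> S \<Longrightarrow> B x \<noteq> {}"
    and dir: "\<And>x y. x \<in> S \<Longrightarrow> y \<in> S \<Longrightarrow> \<exists>z\<in>S. B z \<subseteq> B x \<inter> B y"
  obtains U where "ultrafilter U" "\<And>x. x \<in> S \<Longrightarrow> eventually (\<lambda>q. q \<in> B x) U"
proof -
  let ?F = "INF x\<in>S. principal (B x)"
  have "eventually P ?F \<longleftrightarrow> (\<exists>x\<in>S. eventually P (principal (B x)))" for P
    using assms(1) dir by (intro eventually_INF_base) auto
  then have "?F \<noteq> bot" using nonempty unfolding trivial_limit_def by (auto simp: eventually_principal)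
  then obtain U where U: "U \<le> ?F" "ultrafilter U" by (rule ultrafilter_exists)
  have "eventually (\<lambda>q. q \<in> B x) U" if "x \<in> S" for x
    by (rule filter_leD[OF U(1)], rule eventually_INF1[OF that]) (simp add: eventually_principal)
  then show thesis using U(2) that by blast
qed

text \<open>Of finitely many fibres covering a set of the ultrafilter, one belongs to it. This
  freezes pivots and positions of unit entries.\<close>

lemma ultrafilter_finite_range:
  assumes U: "ultrafilter U" and T: "finite T" and f: "eventually (\<lambda>q. f q \<in> T) U"
  obtains t where "t \<in> T" "eventually (\<lambda>q. f q = t) U"
proof -
  have "\<exists>t\<in>T. eventually (\<lambda>q. f q = t) U"
    using T f
  proof (induction T rule: finite_induct)
    case empty
    then show ?case using U by (simp add: ultrafilter_def trivial_limit_def)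
  next
    case (insert t T)
    show ?case
    proof (cases "eventually (\<lambda>q. f q = t) U")
      case False
      then have "eventually (\<lambda>q. f q \<noteq> t) U" using U by (auto simp: ultrafilter_def)
      then have "eventually (\<lambda>q. f q \<in> T) U" using insert.prems by eventually_elim auto
      then show ?thesis using insert.IH by blast
    qed auto
  qed
  then show thesis using that by blast
qed

section \<open>Products of rings\<close>

definition product_ring :: "'q set \<Rightarrow> ('q \<Rightarrow> ('a, 'e) ring_scheme) \<Rightarrow> ('q \<Rightarrow> 'a) ring" where
  "product_ring C L =
     \<lparr> carrier = (\<Pi>\<^sub>E q\<in>C. carrier (L q)),
       mult = (\<lambda>f g. \<lambda>q\<in>C. f q \<otimes>\<^bsub>L q\<^esub> g q),
       one = (\<lambda>q\<in>C. \<one>\<^bsub>L q\<^esub>),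
       zero = (\<lambda>q\<in>C. \<zero>\<^bsub>L q\<^esub>),
       add = (\<lambda>f g. \<lambda>q\<in>C. f q \<oplus>\<^bsub>L q\<^esub> g q) \<rparr>"

lemma product_ring_apply:
  "q \<in> C \<Longrightarrow> (f \<otimes>\<^bsub>product_ring C L\<^esub> g) q = f q \<otimes>\<^bsub>L q\<^esub> g q"
  "q \<in> C \<Longrightarrow> (f \<oplus>\<^bsub>product_ring C L\<^esub> g) q = f q \<oplus>\<^bsub>L q\<^esub> g q"
  "q \<in> C \<Longrightarrow> \<one>\<^bsub>product_ring C L\<^esub> q = \<one>\<^bsub>L q\<^esub>"
  "q \<in> C \<Longrightarrow> \<zero>\<^bsub>product_ring C L\<^esub> q = \<zero>\<^bsub>L q\<^esub>"
  "q \<in> C \<Longrightarrow> f \<in> carrier (product_ring C L) \<Longrightarrow> f q \<in> carrier (L q)"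
  by (auto simp: product_ring_def)

text \<open>Elements are extensional on \<open>C\<close>, so ring laws can be checked at the points
  of \<open>C\<close>, the only ones where \<open>L q\<close> is known to be a ring.\<close>

lemma product_ring_eqI:
  assumes "f \<in> carrier (product_ring C L)" "g \<in> carrier (product_ring C L)"
    and "\<And>q. q \<in> C \<Longrightarrow> f q = g q"
  shows "f = g"
  using assms by (auto simp: product_ring_def intro: PiE_ext)

lemma cring_product_ring:
  assumes "\<And>q. q \<in> C \<Longrightarrow> cring (L q)"
  shows "cring (product_ring C L)"
proof -
  let ?B = "product_ring C L"
  note r = cring.axioms(1)[OF assms]
  have mem: "f q \<in> carrier (L q)" if "f \<in> carrier ?B" "q \<in> C" for f q
    using that by (simp add: product_ring_apply(5))
  have add: "f \<oplus>\<^bsub>?B\<^esub> g \<in> carrier ?B" and mult: "f \<otimes>\<^bsub>?B\<^esub> g \<in> carrier ?B"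
    if "f \<in> carrier ?B" "g \<in> carrier ?B" for f g
    using mem[OF that(1)] mem[OF that(2)] r by (auto simp: product_ring_def ring.ring_simprules)
  have one: "\<one>\<^bsub>?B\<^esub> \<in> carrier ?B" and zero: "\<zero>\<^bsub>?B\<^esub> \<in> carrier ?B"
    using r by (auto simp: product_ring_def ring.ring_simprules)
  note closed = add mult one zero
  show ?thesis
  proof (intro cringI abelian_groupI comm_monoidI)
    fix f assume f: "f \<in> carrier ?B"
    note f' = mem[OF f]
    let ?g = "\<lambda>q\<in>C. \<ominus>\<^bsub>L q\<^esub> f q"
    have g: "?g \<in> carrier ?B"
      using r f' by (auto simp: product_ring_def ring.ring_simprules)
    show "\<exists>g\<in>carrier ?B. g \<oplus>\<^bsub>?B\<^esub> f = \<zero>\<^bsub>?B\<^esub>"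
    proof (rule bexI[OF _ g])
      show "?g \<oplus>\<^bsub>?B\<^esub> f = \<zero>\<^bsub>?B\<^esub>"
        by (rule product_ring_eqI) (use closed f g f' r in \<open>auto simp: product_ring_apply(1-4) ring.ring_simprules(9)\<close>)
    qed
    show "\<zero>\<^bsub>?B\<^esub> \<oplus>\<^bsub>?B\<^esub> f = f"
    proof (rule product_ring_eqI[where L = L])
      fix q assume q: "q \<in> C"
      then interpret L: cring "L q" by (rule assms)
      show "(\<zero>\<^bsub>?B\<^esub> \<oplus>\<^bsub>?B\<^esub> f) q = (f) q"
        using f'[OF q] by (simp add: product_ring_apply(1-4)[OF q] L.l_zero)
    qed (use closed f in auto)
    show "\<one>\<^bsub>?B\<^esub> \<otimes>\<^bsub>?B\<^esub> f = f"
    proof (rule product_ring_eqI[where L = L])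
      fix q assume q: "q \<in> C"
      then interpret L: cring "L q" by (rule assms)
      show "(\<one>\<^bsub>?B\<^esub> \<otimes>\<^bsub>?B\<^esub> f) q = (f) q"
        using f'[OF q] by (simp add: product_ring_apply(1-4)[OF q] L.l_one)
    qed (use closed f in auto)
    fix g assume g: "g \<in> carrier ?B"
    note g' = mem[OF g]
    show "f \<oplus>\<^bsub>?B\<^esub> g = g \<oplus>\<^bsub>?B\<^esub> f"
    proof (rule product_ring_eqI[where L = L])
      fix q assume q: "q \<in> C"
      then interpret L: cring "L q" by (rule assms)
      show "(f \<oplus>\<^bsub>?B\<^esub> g) q = (g \<oplus>\<^bsub>?B\<^esub> f) q"
        using f'[OF q] g'[OF q] by (simp add: product_ring_apply(1-4)[OF q] L.a_comm)
    qed (use closed f g in auto)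
    show "f \<otimes>\<^bsub>?B\<^esub> g = g \<otimes>\<^bsub>?B\<^esub> f"
    proof (rule product_ring_eqI[where L = L])
      fix q assume q: "q \<in> C"
      then interpret L: cring "L q" by (rule assms)
      show "(f \<otimes>\<^bsub>?B\<^esub> g) q = (g \<otimes>\<^bsub>?B\<^esub> f) q"
        using f'[OF q] g'[OF q] by (simp add: product_ring_apply(1-4)[OF q] L.m_comm)
    qed (use closed f g in auto)
    fix h assume h: "h \<in> carrier ?B"
    note h' = mem[OF h]
    show "f \<oplus>\<^bsub>?B\<^esub> g \<oplus>\<^bsub>?B\<^esub> h = f \<oplus>\<^bsub>?B\<^esub> (g \<oplus>\<^bsub>?B\<^esub> h)"
    proof (rule product_ring_eqI[where L = L])
      fix q assume q: "q \<in> C"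
      then interpret L: cring "L q" by (rule assms)
      show "(f \<oplus>\<^bsub>?B\<^esub> g \<oplus>\<^bsub>?B\<^esub> h) q = (f \<oplus>\<^bsub>?B\<^esub> (g \<oplus>\<^bsub>?B\<^esub> h)) q"
        using f'[OF q] g'[OF q] h'[OF q] by (simp add: product_ring_apply(1-4)[OF q] L.a_assoc)
    qed (use closed f g h in auto)
    show "f \<otimes>\<^bsub>?B\<^esub> g \<otimes>\<^bsub>?B\<^esub> h = f \<otimes>\<^bsub>?B\<^esub> (g \<otimes>\<^bsub>?B\<^esub> h)"
    proof (rule product_ring_eqI[where L = L])
      fix q assume q: "q \<in> C"
      then interpret L: cring "L q" by (rule assms)
      show "(f \<otimes>\<^bsub>?B\<^esub> g \<otimes>\<^bsub>?B\<^esub> h) q = (f \<otimes>\<^bsub>?B\<^esub> (g \<otimes>\<^bsub>?B\<^esub> h)) q"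
        using f'[OF q] g'[OF q] h'[OF q] by (simp add: product_ring_apply(1-4)[OF q] L.m_assoc)
    qed (use closed f g h in auto)
    show "(f \<oplus>\<^bsub>?B\<^esub> g) \<otimes>\<^bsub>?B\<^esub> h = f \<otimes>\<^bsub>?B\<^esub> h \<oplus>\<^bsub>?B\<^esub> g \<otimes>\<^bsub>?B\<^esub> h"
    proof (rule product_ring_eqI[where L = L])
      fix q assume q: "q \<in> C"
      then interpret L: cring "L q" by (rule assms)
      show "((f \<oplus>\<^bsub>?B\<^esub> g) \<otimes>\<^bsub>?B\<^esub> h) q = (f \<otimes>\<^bsub>?B\<^esub> h \<oplus>\<^bsub>?B\<^esub> g \<otimes>\<^bsub>?B\<^esub> h) q"
        using f'[OF q] g'[OF q] h'[OF q] by (simp add: product_ring_apply(1-4)[OF q] L.l_distr)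
    qed (use closed f g h in auto)
  qed (use closed in auto)
qed

lemma product_ring_proj:
  "q \<in> C \<Longrightarrow> (\<lambda>f. f q) \<in> ring_hom (product_ring C L) (L q)"
  by (rule ring_hom_memI) (auto simp: product_ring_apply)

section \<open>The ultraproduct as a quotient of the product\<close>

locale ultraproduct =
  fixes U :: "'q filter" and C :: "'q set" and L :: "'q \<Rightarrow> ('a, 'e) ring_scheme"
  assumes U: "ultrafilter U" and U_C: "eventually (\<lambda>q. q \<in> C) U"
    and field: "\<And>q. q \<in> C \<Longrightarrow> field (L q)"
begin

abbreviation B where "B \<equiv> product_ring C L"

definition null :: "('q \<Rightarrow> 'a) set" where
  "null = {f \<in> carrier B. eventually (\<lambda>q. f q = \<zero>\<^bsub>L q\<^esub>) U}"

definition ultra :: "('q \<Rightarrow> 'a) set ring" where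
  "ultra = B Quot null"

definition germ :: "('q \<Rightarrow> 'a) \<Rightarrow> ('q \<Rightarrow> 'a) set" where
  "germ f = null +>\<^bsub>B\<^esub> f"

lemma cring_L: "q \<in> C \<Longrightarrow> cring (L q)"
  using field by (simp add: field_def domain_def)

sublocale B: cring B
  using cring_L by (rule cring_product_ring)

lemma proj_hom: "q \<in> C \<Longrightarrow> ring_hom_cring B (L q) (\<lambda>f. f q)"
  by (intro ring_hom_cring.intro ring_hom_cring_axioms.intro B.is_cring cring_L product_ring_proj)

lemma minus_apply:
  assumes "q \<in> C" "f \<in> carrier B" "g \<in> carrier B"
  shows "(f \<ominus>\<^bsub>B\<^esub> g) q = f q \<ominus>\<^bsub>L q\<^esub> g q"
proof -
  interpret L: cring "L q" using assms(1) by (rule cring_L)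
  interpret p: ring_hom_cring B "L q" "\<lambda>f. f q" using assms(1) by (rule proj_hom)
  show ?thesis using assms by (simp add: B.minus_eq L.minus_eq product_ring_apply)
qed

lemma ideal_null: "ideal null B"
proof (rule idealI)
  show "ring B" by (rule B.ring_axioms)
  have zero: "\<zero>\<^bsub>B\<^esub> \<in> null"
    unfolding null_def using U_C by (auto simp: product_ring_apply elim: eventually_mono)
  have add: "f \<oplus>\<^bsub>B\<^esub> g \<in> null" if "f \<in> null" "g \<in> null" for f g
  proof -
    have "eventually (\<lambda>q. f q = \<zero>\<^bsub>L q\<^esub> \<and> g q = \<zero>\<^bsub>L q\<^esub> \<and> q \<in> C) U"
      using that U_C by (auto simp: null_def eventually_conj_iff)
    then have "eventually (\<lambda>q. (f \<oplus>\<^bsub>B\<^esub> g) q = \<zero>\<^bsub>L q\<^esub>) U"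
      by (rule eventually_mono) (use cring_L in \<open>auto simp: product_ring_apply cring.cring_simprules\<close>)
    then show ?thesis using that by (simp add: null_def)
  qed
  have mult: "f \<otimes>\<^bsub>B\<^esub> g \<in> null" if "f \<in> null" "g \<in> carrier B" for f g
  proof -
    have "eventually (\<lambda>q. f q = \<zero>\<^bsub>L q\<^esub> \<and> q \<in> C) U"
      using that U_C by (auto simp: null_def eventually_conj_iff)
    then have "eventually (\<lambda>q. (f \<otimes>\<^bsub>B\<^esub> g) q = \<zero>\<^bsub>L q\<^esub>) U"
    proof (rule eventually_mono)
      fix q assume q: "f q = \<zero>\<^bsub>L q\<^esub> \<and> q \<in> C"
      then interpret L: cring "L q" using cring_L by blast
      have "g q \<in> carrier (L q)" using q that product_ring_apply(5)[of q C g L] by blast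
      then show "(f \<otimes>\<^bsub>B\<^esub> g) q = \<zero>\<^bsub>L q\<^esub>" using q by (simp add: product_ring_apply)
    qed
    then show ?thesis using that by (simp add: null_def)
  qed
  show "subgroup null (add_monoid B)"
  proof (rule B.add.subgroupI)
    show "null \<subseteq> carrier B" by (auto simp: null_def)
    show "null \<noteq> {}" using zero by blast
    show "\<ominus>\<^bsub>B\<^esub> f \<in> null" if "f \<in> null" for f
    proof -
      have "f \<in> carrier B" using that by (simp add: null_def)
      then have "\<ominus>\<^bsub>B\<^esub> f = f \<otimes>\<^bsub>B\<^esub> \<ominus>\<^bsub>B\<^esub> \<one>\<^bsub>B\<^esub>" by (simp add: B.r_minus)
      then show ?thesis using mult[OF that, of "\<ominus>\<^bsub>B\<^esub> \<one>\<^bsub>B\<^esub>"] by simp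
    qed
  qed (rule add)
  show "x \<otimes>\<^bsub>B\<^esub> f \<in> null" "f \<otimes>\<^bsub>B\<^esub> x \<in> null" if "f \<in> null" "x \<in> carrier B" for f x
  proof -
    show "f \<otimes>\<^bsub>B\<^esub> x \<in> null" using that by (rule mult)
    moreover have "f \<in> carrier B" using that by (simp add: null_def)
    ultimately show "x \<otimes>\<^bsub>B\<^esub> f \<in> null" using that by (simp add: B.m_comm)
  qed
qed

sublocale N: ideal null B by (rule ideal_null)

sublocale ultra: cring ultra
  unfolding ultra_def by (rule N.quotient_is_cring[OF B.is_cring])

lemma germ_hom: "germ \<in> ring_hom B ultra"
  unfolding ultra_def germ_def[abs_def] by (rule N.rcos_ring_hom)

sublocale germ: ring_hom_cring B ultra germ
  by (intro ring_hom_cring.intro ring_hom_cring_axioms.intro B.is_cring ultra.is_cring germ_hom)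

lemma germ_surj:
  assumes "z \<in> carrier ultra"
  obtains f where "f \<in> carrier B" "z = germ f"
  using assms by (auto simp: ultra_def germ_def FactRing_def A_RCOSETS_def')

text \<open>Los's theorem for equality; every passage between the factors and the ultraproduct goes
  through it.\<close>

lemma germ_eq_iff:
  assumes "f \<in> carrier B" "g \<in> carrier B"
  shows "germ f = germ g \<longleftrightarrow> eventually (\<lambda>q. f q = g q) U"
proof -
  have "germ f = germ g \<longleftrightarrow> f \<ominus>\<^bsub>B\<^esub> g \<in> null"
    unfolding germ_def by (rule B.quotient_eq_iff_same_a_r_cos[OF ideal_null assms, symmetric])
  also have "\<dots> \<longleftrightarrow> eventually (\<lambda>q. (f \<ominus>\<^bsub>B\<^esub> g) q = \<zero>\<^bsub>L q\<^esub>) U"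
    using B.minus_closed[OF assms] unfolding null_def mem_Collect_eq by blast
  also have "\<dots> \<longleftrightarrow> eventually (\<lambda>q. f q = g q) U"
  proof (rule eventually_subst, rule eventually_mono[OF U_C])
    fix q assume q: "q \<in> C"
    then interpret L: cring "L q" by (rule cring_L)
    show "((f \<ominus>\<^bsub>B\<^esub> g) q = \<zero>\<^bsub>L q\<^esub>) = (f q = g q)"
      using assms[THEN product_ring_apply(5)[OF q]] L.r_right_minus_eq[of "f q" "g q"]
      by (simp add: minus_apply[OF q assms])
  qed
  finally show ?thesis .
qed

lemma field_ultra: "field ultra"
proof (rule cring.cring_fieldI2[OF ultra.is_cring])
  have "\<not> eventually (\<lambda>q. \<zero>\<^bsub>B\<^esub> q = \<one>\<^bsub>B\<^esub> q) U"
  proof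
    assume "eventually (\<lambda>q. \<zero>\<^bsub>B\<^esub> q = \<one>\<^bsub>B\<^esub> q) U"
    with U_C have "eventually (\<lambda>q. False) U"
    proof eventually_elim
      case (elim q)
      then interpret L: field "L q" by (intro field)
      show ?case using elim by (simp add: product_ring_apply)
    qed
    then show False using U by (simp add: ultrafilter_def trivial_limit_def)
  qed
  then show "\<zero>\<^bsub>ultra\<^esub> \<noteq> \<one>\<^bsub>ultra\<^esub>"
    using germ_eq_iff[of "\<zero>\<^bsub>B\<^esub>" "\<one>\<^bsub>B\<^esub>"] by simp
  fix z assume z: "z \<in> carrier ultra" "z \<noteq> \<zero>\<^bsub>ultra\<^esub>"
  then obtain f where f: "f \<in> carrier B" "z = germ f" by (auto elim: germ_surj)
  \<comment> \<open>The pointwise inverse, with value 0 at the zeros of \<open>f\<close> so that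
    \<open>g\<close> stays in the product.\<close>
  define g where "g = (\<lambda>q\<in>C. if f q = \<zero>\<^bsub>L q\<^esub> then \<zero>\<^bsub>L q\<^esub> else inv\<^bsub>L q\<^esub> f q)"
  have fq: "f q \<in> carrier (L q)" if "q \<in> C" for q using that f by (simp add: product_ring_apply)
  have inv: "inv\<^bsub>L q\<^esub> f q \<in> carrier (L q)" "f q \<otimes>\<^bsub>L q\<^esub> inv\<^bsub>L q\<^esub> f q = \<one>\<^bsub>L q\<^esub>"
    if "q \<in> C" "f q \<noteq> \<zero>\<^bsub>L q\<^esub>" for q
  proof -
    interpret L: field "L q" using that by (intro field)
    show "inv\<^bsub>L q\<^esub> f q \<in> carrier (L q)" "f q \<otimes>\<^bsub>L q\<^esub> inv\<^bsub>L q\<^esub> f q = \<one>\<^bsub>L q\<^esub>"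
      using that fq by (simp_all add: L.field_Units)
  qed
  have g: "g \<in> carrier B"
    using inv cring_L by (auto simp: g_def product_ring_def cring.cring_simprules)
  have "\<not> eventually (\<lambda>q. f q = \<zero>\<^bsub>B\<^esub> q) U" using germ_eq_iff[OF f(1), of "\<zero>\<^bsub>B\<^esub>"] z f by simp
  \<comment> \<open>The ultrafilter turns "not eventually zero" into "eventually nonzero"; for a
    general filter the quotient would have zero divisors.\<close>
  then have "eventually (\<lambda>q. f q \<noteq> \<zero>\<^bsub>B\<^esub> q) U" using U by (auto simp: ultrafilter_def)
  with U_C have "eventually (\<lambda>q. (f \<otimes>\<^bsub>B\<^esub> g) q = \<one>\<^bsub>B\<^esub> q) U"
    by eventually_elim (use inv in \<open>simp add: product_ring_apply g_def\<close>)
  then have "z \<otimes>\<^bsub>ultra\<^esub> germ g = \<one>\<^bsub>ultra\<^esub>"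
    using germ_eq_iff[of "f \<otimes>\<^bsub>B\<^esub> g" "\<one>\<^bsub>B\<^esub>"] f g by simp
  then show "\<exists>y\<in>carrier ultra. z \<otimes>\<^bsub>ultra\<^esub> y = \<one>\<^bsub>ultra\<^esub>" using g by (intro bexI[of _ "germ g"]) auto
qed

end

section \<open>Echelon families and subspaces of the standard space\<close>

definition echelon ::
    "('a, 'e) ring_scheme \<Rightarrow> nat \<Rightarrow> nat \<Rightarrow> (nat \<Rightarrow> nat) \<Rightarrow> (nat \<Rightarrow> nat \<Rightarrow> 'a) \<Rightarrow> bool" where
  "echelon R n k i Y \<longleftrightarrow>
     (\<forall>a<k. i a < n \<and> (\<forall>s<n. Y a s \<in> carrier R) \<and>
       (\<forall>b<k. Y a (i b) = (if a = b then \<one>\<^bsub>R\<^esub> else \<zero>\<^bsub>R\<^esub>)))"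

text \<open>The coefficients of \<open>u\<close> in an echelon family are its entries at the pivots \<open>i\<close>.\<close>

definition in_span ::
    "('a, 'e) ring_scheme \<Rightarrow> nat \<Rightarrow> nat \<Rightarrow> (nat \<Rightarrow> nat) \<Rightarrow> (nat \<Rightarrow> nat \<Rightarrow> 'a) \<Rightarrow> (nat \<Rightarrow> 'a) \<Rightarrow> bool" where
  "in_span R n k i Y u \<longleftrightarrow> (\<forall>s<n. u s = (\<Oplus>\<^bsub>R\<^esub>a\<in>{..<k}. u (i a) \<otimes>\<^bsub>R\<^esub> Y a s))"

section \<open>Subspaces described by echelon families\<close>

context field
begin

lemma carrier_std_space: "carrier (std_space n R) = {..<n} \<rightarrow>\<^sub>E carrier R"
  by (simp add: func_space_def)

lemma std_space_simps:
  "\<zero>\<^bsub>std_space n R\<^esub> = (\<lambda>s\<in>{..<n}. \<zero>)"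
  "u \<oplus>\<^bsub>std_space n R\<^esub> v = (\<lambda>s\<in>{..<n}. u s \<oplus> v s)"
  "c \<odot>\<^bsub>std_space n R\<^esub> u = (\<lambda>s\<in>{..<n}. c \<otimes> u s)"
  by (simp_all add: func_space_def)

lemma subspace_std_space_iff:
  "VectorSpace.subspace R W (std_space n R) \<longleftrightarrow>
     W \<subseteq> {..<n} \<rightarrow>\<^sub>E carrier R \<and> (\<lambda>s\<in>{..<n}. \<zero>) \<in> W \<and>
     (\<forall>u\<in>W. \<forall>v\<in>W. (\<lambda>s\<in>{..<n}. u s \<oplus> v s) \<in> W) \<and>
     (\<forall>c\<in>carrier R. \<forall>u\<in>W. (\<lambda>s\<in>{..<n}. c \<otimes> u s) \<in> W)"
  using vectorspace_std_space[of n] func_space_is_module[of "{..<n}"]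
  by (auto simp: VectorSpace.subspace_def submodule_def carrier_std_space std_space_simps)

lemma subspace_lincomb:
  fixes k :: nat
  assumes W: "VectorSpace.subspace R W (std_space n R)"
    and c: "\<And>a. a < k \<Longrightarrow> c a \<in> carrier R" and Y: "\<And>a. a < k \<Longrightarrow> (\<lambda>s\<in>{..<n}. Y a s) \<in> W"
  shows "(\<lambda>s\<in>{..<n}. \<Oplus>a\<in>{..<k}. c a \<otimes> Y a s) \<in> W"
  using c Y
proof (induction k)
  case 0
  then show ?case using W by (simp add: subspace_std_space_iff restrict_def)
next
  case (Suc k)
  have sub: "W \<subseteq> {..<n} \<rightarrow>\<^sub>E carrier R"
    and W_add: "\<And>u v. u \<in> W \<Longrightarrow> v \<in> W \<Longrightarrow> (\<lambda>s\<in>{..<n}. u s \<oplus> v s) \<in> W"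
    and W_smult: "\<And>c u. c \<in> carrier R \<Longrightarrow> u \<in> W \<Longrightarrow> (\<lambda>s\<in>{..<n}. c \<otimes> u s) \<in> W"
    using W unfolding subspace_std_space_iff by blast+
  have Yc: "Y a s \<in> carrier R" if "a < Suc k" "s < n" for a s
    using PiE_mem[OF subsetD[OF sub Suc.prems(2)[OF that(1)]], of s] that(2) by simp
  have "(\<lambda>s\<in>{..<n}. c k \<otimes> (\<lambda>s\<in>{..<n}. Y k s) s) \<in> W"
    by (rule W_smult[OF Suc.prems(1)[OF lessI] Suc.prems(2)[OF lessI]])
  moreover have "(\<lambda>s\<in>{..<n}. \<Oplus>a\<in>{..<k}. c a \<otimes> Y a s) \<in> W"
    by (rule Suc.IH[OF Suc.prems(1)[OF less_SucI] Suc.prems(2)[OF less_SucI]])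
  ultimately have "(\<lambda>s\<in>{..<n}. (\<lambda>s\<in>{..<n}. c k \<otimes> (\<lambda>s\<in>{..<n}. Y k s) s) s \<oplus>
      (\<lambda>s\<in>{..<n}. \<Oplus>a\<in>{..<k}. c a \<otimes> Y a s) s) \<in> W"
    by (rule W_add)
  also have "(\<lambda>s\<in>{..<n}. (\<lambda>s\<in>{..<n}. c k \<otimes> (\<lambda>s\<in>{..<n}. Y k s) s) s \<oplus>
      (\<lambda>s\<in>{..<n}. \<Oplus>a\<in>{..<k}. c a \<otimes> Y a s) s) = (\<lambda>s\<in>{..<n}. \<Oplus>a\<in>{..<Suc k}. c a \<otimes> Y a s)"
    using Suc.prems(1) Yc by (intro restrict_ext) (simp add: lessThan_Suc Pi_def)
  finally show ?case .
qed

lemma echelonD: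
  assumes "echelon R n k i Y" "a < k"
  shows "i a < n" "s < n \<Longrightarrow> Y a s \<in> carrier R"
    "b < k \<Longrightarrow> Y a (i b) = (if a = b then \<one> else \<zero>)"
  using assms unfolding echelon_def by blast+

text \<open>Pivots are distinct, which bounds the length of a family by \<open>n\<close> and permits
  the choice of a longest one in \<open>subspace_echelon_basis\<close>.\<close>

lemma echelon_le:
  assumes "echelon R n k i Y"
  shows "k \<le> n" "inj_on i {..<k}"
proof -
  show inj: "inj_on i {..<k}"
  proof (rule inj_onI)
    fix a b assume ab: "a \<in> {..<k}" "b \<in> {..<k}" "i a = i b"
    then have "Y a (i a) = Y a (i b)" by simp
    then show "a = b" using echelonD(3)[OF assms, of a a] echelonD(3)[OF assms, of a b] ab
      by (auto split: if_splits)
  qed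
  have "i ` {..<k} \<subseteq> {..<n}" using echelonD(1)[OF assms] by auto
  then show "k \<le> n" using card_inj_on_le[OF inj, of "{..<n}"] by simp
qed

text \<open>The identity block lets coefficients be read off at the pivots. Linear independence and
  the form of \<open>in_span\<close> rest on this.\<close>

lemma echelon_lincomb_pivot:
  assumes "echelon R n k i Y" "b < k" "\<And>a. a < k \<Longrightarrow> c a \<in> carrier R"
  shows "(\<Oplus>a\<in>{..<k}. c a \<otimes> Y a (i b)) = c b"
proof -
  have "(\<Oplus>a\<in>{..<k}. c a \<otimes> Y a (i b)) = (\<Oplus>a\<in>{..<k}. if b = a then c a else \<zero>)"
    using assms by (intro finsum_cong') (auto simp: echelonD(3))
  also have "\<dots> = c b" using assms by (intro finsum_singleton) auto
  finally show ?thesis .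
qed

definition echelon_space :: "nat \<Rightarrow> nat \<Rightarrow> (nat \<Rightarrow> nat) \<Rightarrow> (nat \<Rightarrow> nat \<Rightarrow> 'a) \<Rightarrow> (nat \<Rightarrow> 'a) set" where
  "echelon_space n k i Y = {u \<in> {..<n} \<rightarrow>\<^sub>E carrier R. in_span R n k i Y u}"

definition lincomb_map :: "nat \<Rightarrow> nat \<Rightarrow> (nat \<Rightarrow> nat \<Rightarrow> 'a) \<Rightarrow> (nat \<Rightarrow> 'a) \<Rightarrow> nat \<Rightarrow> 'a" where
  "lincomb_map n k Y c = (\<lambda>s\<in>{..<n}. \<Oplus>a\<in>{..<k}. c a \<otimes> Y a s)"

lemma lincomb_map_closed:
  assumes "\<And>a s. a < k \<Longrightarrow> s < n \<Longrightarrow> Y a s \<in> carrier R" "\<And>a. a < k \<Longrightarrow> c a \<in> carrier R"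
  shows "lincomb_map n k Y c \<in> {..<n} \<rightarrow>\<^sub>E carrier R"
  unfolding lincomb_map_def restrict_PiE_iff
proof
  fix s assume "s \<in> {..<n}"
  then show "(\<Oplus>a\<in>{..<k}. c a \<otimes> Y a s) \<in> carrier R"
    using assms by (intro finsum_closed Pi_I m_closed) simp_all
qed

lemma lincomb_map_hom:
  assumes Y: "\<And>a s. a < k \<Longrightarrow> s < n \<Longrightarrow> Y a s \<in> carrier R"
  shows "lincomb_map n k Y \<in> LinearCombinations.module_hom R (std_space k R) (std_space n R)"
proof -
  have add: "lincomb_map n k Y (c \<oplus>\<^bsub>std_space k R\<^esub> d)
      = lincomb_map n k Y c \<oplus>\<^bsub>std_space n R\<^esub> lincomb_map n k Y d"
    if cd: "c \<in> {..<k} \<rightarrow>\<^sub>E carrier R" "d \<in> {..<k} \<rightarrow>\<^sub>E carrier R" for c d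
    unfolding std_space_simps lincomb_map_def
  proof (rule restrict_ext)
    fix s assume s: "s \<in> {..<n}"
    have cd': "c a \<in> carrier R" "d a \<in> carrier R" if "a < k" for a using cd that by auto
    have "(\<Oplus>a\<in>{..<k}. (\<lambda>s\<in>{..<k}. c s \<oplus> d s) a \<otimes> Y a s)
        = (\<Oplus>a\<in>{..<k}. c a \<otimes> Y a s \<oplus> d a \<otimes> Y a s)"
      using s Y cd' by (intro finsum_cong') (auto simp: l_distr)
    also have "\<dots> = (\<Oplus>a\<in>{..<k}. c a \<otimes> Y a s) \<oplus> (\<Oplus>a\<in>{..<k}. d a \<otimes> Y a s)"
      using s Y cd' by (intro finsum_addf) auto
    finally show "(\<Oplus>a\<in>{..<k}. (\<lambda>s\<in>{..<k}. c s \<oplus> d s) a \<otimes> Y a s)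
        = (\<lambda>s\<in>{..<n}. \<Oplus>a\<in>{..<k}. c a \<otimes> Y a s) s \<oplus> (\<lambda>s\<in>{..<n}. \<Oplus>a\<in>{..<k}. d a \<otimes> Y a s) s"
      using s by simp
  qed
  have smult: "lincomb_map n k Y (r \<odot>\<^bsub>std_space k R\<^esub> c) = r \<odot>\<^bsub>std_space n R\<^esub> lincomb_map n k Y c"
    if c: "c \<in> {..<k} \<rightarrow>\<^sub>E carrier R" and r: "r \<in> carrier R" for c r
    unfolding std_space_simps lincomb_map_def
  proof (rule restrict_ext)
    fix s assume s: "s \<in> {..<n}"
    have c': "c a \<in> carrier R" if "a < k" for a using c that by auto
    have "(\<Oplus>a\<in>{..<k}. (\<lambda>s\<in>{..<k}. r \<otimes> c s) a \<otimes> Y a s) = (\<Oplus>a\<in>{..<k}. r \<otimes> (c a \<otimes> Y a s))"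
      using s Y c' r by (intro finsum_cong') (auto simp: m_assoc)
    also have "\<dots> = r \<otimes> (\<Oplus>a\<in>{..<k}. c a \<otimes> Y a s)"
      using s Y c' r by (intro finsum_rdistr[symmetric]) auto
    finally show "(\<Oplus>a\<in>{..<k}. (\<lambda>s\<in>{..<k}. r \<otimes> c s) a \<otimes> Y a s)
        = r \<otimes> (\<lambda>s\<in>{..<n}. \<Oplus>a\<in>{..<k}. c a \<otimes> Y a s) s"
      using s by simp
  qed
  have closed: "lincomb_map n k Y c \<in> {..<n} \<rightarrow>\<^sub>E carrier R" if "c \<in> {..<k} \<rightarrow>\<^sub>E carrier R" for c
    using Y that by (intro lincomb_map_closed) auto
  show ?thesis
    unfolding LinearCombinations.module_hom_def carrier_std_space using closed add smult by blast
qed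

text \<open>Two descriptions of one subspace: the parametrization gives linearity and dimension, the
  equations of \<open>in_span\<close> transfer along homomorphisms.\<close>

lemma echelon_space_eq_image:
  assumes Y: "echelon R n k i Y"
  shows "echelon_space n k i Y = lincomb_map n k Y ` ({..<k} \<rightarrow>\<^sub>E carrier R)"
proof (intro equalityI subsetI)
  fix u assume u: "u \<in> echelon_space n k i Y"
  show "u \<in> lincomb_map n k Y ` ({..<k} \<rightarrow>\<^sub>E carrier R)"
  proof (rule image_eqI)
    let ?c = "\<lambda>a\<in>{..<k}. u (i a)"
    show c: "?c \<in> {..<k} \<rightarrow>\<^sub>E carrier R"
      using u echelonD(1)[OF Y] by (auto simp: echelon_space_def)
    have uc: "u \<in> {..<n} \<rightarrow>\<^sub>E carrier R" using u by (simp add: echelon_space_def)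
    show "u = lincomb_map n k Y ?c"
    proof (rule PiE_ext[OF uc lincomb_map_closed])
      fix s assume s: "s \<in> {..<n}"
      have "u s = (\<Oplus>a\<in>{..<k}. u (i a) \<otimes> Y a s)"
        using u s by (simp add: echelon_space_def in_span_def)
      also have "\<dots> = (\<Oplus>a\<in>{..<k}. ?c a \<otimes> Y a s)"
        using s PiE_mem[OF uc] echelonD(1,2)[OF Y] by (intro finsum_cong') auto
      finally show "u s = lincomb_map n k Y ?c s" using s by (simp add: lincomb_map_def)
    qed (use c echelonD[OF Y] in auto)
  qed
next
  fix u assume "u \<in> lincomb_map n k Y ` ({..<k} \<rightarrow>\<^sub>E carrier R)"
  then obtain c where c: "c \<in> {..<k} \<rightarrow>\<^sub>E carrier R" "u = lincomb_map n k Y c" by blast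
  then have c': "c a \<in> carrier R" if "a < k" for a using that by auto
  have piv: "u (i a) = c a" if "a < k" for a
    using echelon_lincomb_pivot[OF Y that c'] echelonD(1)[OF Y that] c(2) by (simp add: lincomb_map_def)
  have "u s = (\<Oplus>a\<in>{..<k}. u (i a) \<otimes> Y a s)" if "s < n" for s
  proof -
    have "u s = (\<Oplus>a\<in>{..<k}. c a \<otimes> Y a s)" using that c(2) by (simp add: lincomb_map_def)
    also have "\<dots> = (\<Oplus>a\<in>{..<k}. u (i a) \<otimes> Y a s)"
      using that piv c' echelonD(2)[OF Y] by (intro finsum_cong') auto
    finally show ?thesis .
  qed
  moreover have "u \<in> {..<n} \<rightarrow>\<^sub>E carrier R"
    unfolding c(2) using c' echelonD(2)[OF Y] by (intro lincomb_map_closed) auto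
  ultimately show "u \<in> echelon_space n k i Y" by (auto simp: echelon_space_def in_span_def)
qed

lemma fin_dim_std_space: "vectorspace.fin_dim R (std_space n R)"
proof -
  interpret V: vectorspace R "std_space n R" by (rule vectorspace_std_space)
  define \<delta> where "\<delta> a = (\<lambda>s\<in>{..<n}. if a = s then \<one> else \<zero>)" for a :: nat
  have \<delta>: "\<delta> ` {..<n} \<subseteq> carrier (std_space n R)"
    unfolding \<delta>_def carrier_std_space by (simp add: image_subset_iff restrict_PiE_iff)
  have "u \<in> V.span (\<delta> ` {..<n})" if u: "u \<in> carrier (std_space n R)" for u
  proof -
    have u': "u \<in> {..<n} \<rightarrow>\<^sub>E carrier R" using u by (simp add: carrier_std_space)
    have "(\<lambda>s\<in>{..<n}. \<delta> a s) \<in> V.span (\<delta> ` {..<n})" if "a < n" for a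
    proof -
      have "(\<lambda>s\<in>{..<n}. \<delta> a s) = \<delta> a" by (auto simp: \<delta>_def)
      then show ?thesis using V.in_own_span[OF \<delta>] that by auto
    qed
    then have "(\<lambda>s\<in>{..<n}. \<Oplus>a\<in>{..<n}. u a \<otimes> \<delta> a s) \<in> V.span (\<delta> ` {..<n})"
      using u' by (intro subspace_lincomb[OF V.span_is_subspace[OF \<delta>]]) auto
    also have "(\<lambda>s\<in>{..<n}. \<Oplus>a\<in>{..<n}. u a \<otimes> \<delta> a s) = u"
    proof (rule PiE_ext[OF _ u'])
      have ech: "echelon R n n (\<lambda>a. a) \<delta>" by (auto simp: echelon_def \<delta>_def)
      show "(\<lambda>s\<in>{..<n}. \<Oplus>a\<in>{..<n}. u a \<otimes> \<delta> a s) s = u s" if "s \<in> {..<n}" for s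
        using echelon_lincomb_pivot[OF ech, of s u] that u' by auto
      show "(\<lambda>s\<in>{..<n}. \<Oplus>a\<in>{..<n}. u a \<otimes> \<delta> a s) \<in> {..<n} \<rightarrow>\<^sub>E carrier R"
      proof (rule lincomb_map_closed[of n n \<delta> u, unfolded lincomb_map_def])
        show "\<delta> a s \<in> carrier R" if "s < n" for a s using that by (simp add: \<delta>_def)
        show "u a \<in> carrier R" if "a < n" for a using PiE_mem[OF u'] that by simp
      qed
    qed
    finally show ?thesis .
  qed
  then have "V.span (\<delta> ` {..<n}) = carrier (std_space n R)"
    using V.span_is_subset2[OF \<delta>] by blast
  then show ?thesis unfolding V.fin_dim_def using \<delta> by blast
qed

lemma image_subspace:
  assumes T: "T \<in> LinearCombinations.module_hom R (std_space k R) (std_space n R)"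
  shows "VectorSpace.subspace R (T ` carrier (std_space k R)) (std_space n R)"
    and "inj_on T (carrier (std_space k R)) \<Longrightarrow>
      vectorspace.dim R ((std_space n R)\<lparr>carrier := T ` carrier (std_space k R)\<rparr>) = k"
proof -
  let ?V = "std_space k R" and ?W = "std_space n R"
  interpret V: vectorspace R ?V by (rule vectorspace_std_space)
  interpret W: vectorspace R ?W by (rule vectorspace_std_space)
  interpret T: linear_map R ?V ?W T
    by (intro linear_map.intro mod_hom.intro mod_hom_axioms.intro V.module_axioms W.module_axioms
        vectorspace_std_space T)
  show sub: "VectorSpace.subspace R (T ` carrier ?V) ?W" using T.imT_is_subspace by (simp add: T.im_def)
  show "vectorspace.dim R (?W\<lparr>carrier := T ` carrier ?V\<rparr>) = k" if inj: "inj_on T (carrier ?V)"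
  proof -
    let ?I = "?W\<lparr>carrier := T ` carrier ?V\<rparr>"
    interpret I: vectorspace R ?I using sub by (rule W.subspace_is_vs)
    \<comment> \<open>Read as a map onto its image, \<open>T\<close> is bijective, so the dimensions
      agree.\<close>
    interpret T': linear_map R ?V ?I T
      by (intro linear_map.intro mod_hom.intro mod_hom_axioms.intro V.module_axioms I.module_axioms
          vectorspace_std_space I.vectorspace_axioms) (use T in \<open>auto simp: LinearCombinations.module_hom_def\<close>)
    show ?thesis using T'.dim_eq[OF fin_dim_std_space inj] by (simp add: dim_std_space)
  qed
qed

lemma lincomb_map_inj:
  assumes Y: "echelon R n k i Y"
  shows "inj_on (lincomb_map n k Y) (carrier (std_space k R))"
proof (rule inj_onI)
  fix c d assume cd: "c \<in> carrier (std_space k R)" "d \<in> carrier (std_space k R)"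
    and *: "lincomb_map n k Y c = lincomb_map n k Y d"
  have piv: "lincomb_map n k Y c (i a) = c a" if "a < k" "c \<in> carrier (std_space k R)" for a c
    using echelon_lincomb_pivot[OF Y that(1), of c] echelonD(1)[OF Y that(1)] that(2)
    by (auto simp: lincomb_map_def carrier_std_space)
  show "c = d"
  proof (rule PiE_ext)
    show "c \<in> {..<k} \<rightarrow>\<^sub>E carrier R" "d \<in> {..<k} \<rightarrow>\<^sub>E carrier R"
      using cd by (simp_all add: carrier_std_space)
    show "c a = d a" if "a \<in> {..<k}" for a using piv[of a c] piv[of a d] cd * that by simp
  qed
qed

lemma echelon_space_subspace:
  assumes Y: "echelon R n k i Y"
  shows "VectorSpace.subspace R (echelon_space n k i Y) (std_space n R)"
    and "vectorspace.dim R ((std_space n R)\<lparr>carrier := echelon_space n k i Y\<rparr>) = k"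
proof -
  have T: "lincomb_map n k Y \<in> LinearCombinations.module_hom R (std_space k R) (std_space n R)"
    using echelonD(2)[OF Y] by (intro lincomb_map_hom) auto
  have eq: "echelon_space n k i Y = lincomb_map n k Y ` carrier (std_space k R)"
    using echelon_space_eq_image[OF Y] by (simp add: carrier_std_space)
  show "VectorSpace.subspace R (echelon_space n k i Y) (std_space n R)"
    "vectorspace.dim R ((std_space n R)\<lparr>carrier := echelon_space n k i Y\<rparr>) = k"
    unfolding eq using image_subspace[OF T] lincomb_map_inj[OF Y] by auto
qed

text \<open>With \<open>n\<close> distinct pivots every index is a pivot, and the equations of
  \<open>in_span\<close> hold for every vector. The family is a hypothesis because its existence is
  proved only later, over a valuation ring.\<close>

lemma subspace_full_dim:
  assumes W: "VectorSpace.subspace R W (std_space n R)"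
    and dim: "vectorspace.dim R ((std_space n R)\<lparr>carrier := W\<rparr>) = n"
    and Y: "echelon R n k i Y" "W = echelon_space n k i Y"
  shows "W = carrier (std_space n R)"
proof -
  have k: "k = n" using echelon_space_subspace(2)[OF Y(1)] dim Y(2) by simp
  have "i ` {..<n} \<subseteq> {..<n}" "inj_on i {..<n}"
    using echelonD(1)[OF Y(1)] echelon_le(2)[OF Y(1)] k by auto
  then have surj: "i ` {..<n} = {..<n}" by (intro endo_inj_surj) auto
  have "in_span R n n i Y u" if u: "u \<in> {..<n} \<rightarrow>\<^sub>E carrier R" for u
    unfolding in_span_def
  proof (intro allI impI)
    fix s assume "s < n"
    then have "s \<in> i ` {..<n}" using surj by simp
    then obtain b where b: "b < n" "s = i b" by auto
    have "u (i a) \<in> carrier R" if "a < n" for a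
      using u echelonD(1)[OF Y(1)] that k by auto
    then show "u s = (\<Oplus>a\<in>{..<n}. u (i a) \<otimes> Y a s)"
      using echelon_lincomb_pivot[OF Y(1)[unfolded k] b(1), of "\<lambda>a. u (i a)"] b(2) by simp
  qed
  then show ?thesis using Y(2) k by (auto simp: echelon_space_def carrier_std_space)
qed

end

text \<open>The case \<open>A = carrier R\<close> is allowed and gives the plain statements over a field.\<close>

locale valuation_subring = field R for R (structure) and A +
  assumes subring: "subring A R"
    and valuation: "x \<in> carrier R \<Longrightarrow> x \<notin> A \<Longrightarrow> inv x \<in> A"
begin

lemma A_closed:
  "\<zero> \<in> A" "\<one> \<in> A" "a \<in> A \<Longrightarrow> b \<in> A \<Longrightarrow> a \<otimes> b \<in> A"
  "a \<in> A \<Longrightarrow> b \<in> A \<Longrightarrow> a \<ominus> b \<in> A" "a \<in> A \<Longrightarrow> a \<in> carrier R"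
  using subringE[OF subring] by (auto simp: minus_eq)

text \<open>The pivot is an entry of minimal valuation.\<close>

lemma exists_pivot:
  fixes x :: "nat \<Rightarrow> 'a"
  assumes "\<And>s. s < n \<Longrightarrow> x s \<in> carrier R" and "\<exists>s<n. x s \<noteq> \<zero>"
  shows "\<exists>t<n. x t \<noteq> \<zero> \<and> (\<forall>s<n. inv (x t) \<otimes> x s \<in> A)"
  using assms
proof (induction n)
  case (Suc n)
  have xn: "x n \<in> carrier R" using Suc.prems by simp
  have rearrange: "(a \<otimes> b) \<otimes> (c \<otimes> d) = (c \<otimes> a) \<otimes> (b \<otimes> d)"
    if "a \<in> carrier R" "b \<in> carrier R" "c \<in> carrier R" "d \<in> carrier R" for a b c d
    using that by (simp add: m_assoc m_comm m_lcomm)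
  show ?case
  proof (cases "\<exists>s<n. x s \<noteq> \<zero>")
    case False
    then have "x n \<noteq> \<zero>" using Suc.prems(2) by (auto simp: less_Suc_eq)
    moreover from this have "inv (x n) \<otimes> x s \<in> A" if "s < Suc n" for s
      using False that xn A_closed(1,2) by (auto simp: less_Suc_eq field_Units)
    ultimately show ?thesis by blast
  next
    case True
    then obtain t where t: "t < n" "x t \<noteq> \<zero>" "\<And>s. s < n \<Longrightarrow> inv (x t) \<otimes> x s \<in> A"
      using Suc by auto
    have xt: "x t \<in> carrier R" "inv (x t) \<in> carrier R" "x t \<otimes> inv (x t) = \<one>"
      using t Suc.prems by (auto simp: field_Units)
    show ?thesis
    proof (cases "inv (x t) \<otimes> x n \<in> A")
      case True
      then show ?thesis using t by (intro exI[of _ t]) (auto simp: less_Suc_eq)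
    next
      case False
      then have "x n \<noteq> \<zero>" using A_closed(1) xt by auto
      then have xn': "inv (x n) \<in> carrier R" "inv (x n) \<otimes> x n = \<one>" using xn by (auto simp: field_Units)
      \<comment> \<open>\<open>x n\<close> has smaller valuation than \<open>x t\<close>, so it
        becomes the pivot; the earlier entries follow by transitivity of divisibility.\<close>
      have "inv (inv (x t) \<otimes> x n) \<in> A" using False xt xn by (intro valuation) auto
      also have "inv (inv (x t) \<otimes> x n) = inv (x n) \<otimes> x t"
      proof (rule comm_inv_char)
        have "inv (x t) \<otimes> x n \<otimes> (inv (x n) \<otimes> x t) = inv (x t) \<otimes> ((x n \<otimes> inv (x n)) \<otimes> x t)"
          using xt xn xn' by (simp add: m_assoc)
        also have "\<dots> = \<one>" using xt xn xn' by (simp add: m_comm)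
        finally show "inv (x t) \<otimes> x n \<otimes> (inv (x n) \<otimes> x t) = \<one>" .
      qed (use xt xn xn' in auto)
      finally have tn: "inv (x n) \<otimes> x t \<in> A" .
      have "inv (x n) \<otimes> x s \<in> A" if "s < Suc n" for s
      proof (cases "s = n")
        case True
        then show ?thesis using xn' A_closed(2) by simp
      next
        case False
        then have s: "s < n" "x s \<in> carrier R" using that Suc.prems by auto
        have "inv (x n) \<otimes> x s = (x t \<otimes> inv (x t)) \<otimes> (inv (x n) \<otimes> x s)"
          using xt xn' s by simp
        also have "\<dots> = (inv (x n) \<otimes> x t) \<otimes> (inv (x t) \<otimes> x s)"
          using rearrange[of "x t" "inv (x t)" "inv (x n)" "x s"] xt xn' s by blast
        finally show ?thesis using tn t(3)[OF s(1)] A_closed(3) by simp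
      qed
      then show ?thesis using \<open>x n \<noteq> \<zero>\<close> by blast
    qed
  qed
qed simp

text \<open>Division by an entry of minimal valuation gives a vector over \<open>A\<close> with an
  entry 1, which remains nonzero under every homomorphism from \<open>A\<close> to a field. The
  scalar is returned so that zeros of \<open>v\<close> and linear conditions on it carry
  over.\<close>

lemma exists_unimodular_multiple:
  assumes W: "VectorSpace.subspace R W (std_space n R)" and v: "v \<in> W" "v \<noteq> (\<lambda>s\<in>{..<n}. \<zero>)"
  obtains w t c where "w \<in> W" "t < n" "w t = \<one>" "\<And>s. s < n \<Longrightarrow> w s \<in> A"
    "c \<in> carrier R" "w = (\<lambda>s\<in>{..<n}. c \<otimes> v s)"
proof -
  note W' = W[unfolded subspace_std_space_iff]
  have vc: "v \<in> {..<n} \<rightarrow>\<^sub>E carrier R" using W' v by blast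
  have "\<exists>s<n. v s \<noteq> \<zero>"
  proof (rule ccontr)
    assume "\<not> ?thesis"
    then have "v = (\<lambda>s\<in>{..<n}. \<zero>)" using vc by (intro PiE_ext[OF vc]) auto
    then show False using v by simp
  qed
  then obtain t where t: "t < n" "v t \<noteq> \<zero>" "\<And>s. s < n \<Longrightarrow> inv (v t) \<otimes> v s \<in> A"
    using exists_pivot[of n v] vc by (auto dest: PiE_mem)
  have "v t \<in> carrier R" using vc t by auto
  then have inv: "inv (v t) \<in> carrier R" "inv (v t) \<otimes> v t = \<one>" using t by (auto simp: field_Units)
  let ?w = "\<lambda>s\<in>{..<n}. inv (v t) \<otimes> v s"
  have "?w \<in> W" using W' inv v by blast
  then show thesis using that[of ?w t "inv (v t)"] t inv by simp
qed

text \<open>The valuative criterion for the Grassmannian: a subspace over the field extends over the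
  valuation ring. A longest echelon family over \<open>A\<close> inside \<open>W\<close> spans
  \<open>W\<close>, because a vector outside its span, cleared at the pivots and then made
  unimodular, would provide one more pivot.\<close>

theorem subspace_echelon_basis:
  assumes W: "VectorSpace.subspace R W (std_space n R)"
  obtains k i Y where "echelon R n k i Y" "\<And>a s. a < k \<Longrightarrow> s < n \<Longrightarrow> Y a s \<in> A"
    "W = echelon_space n k i Y"
proof -
  note W' = W[unfolded subspace_std_space_iff]
  have W_add: "(\<lambda>s\<in>{..<n}. u s \<oplus> v s) \<in> W" if "u \<in> W" "v \<in> W" for u v using W' that by blast
  have W_smult: "(\<lambda>s\<in>{..<n}. c \<otimes> u s) \<in> W" if "c \<in> carrier R" "u \<in> W" for c u
    using W' that by blast
  define Q where "Q k i Y \<longleftrightarrow> echelon R n k i Y \<and> (\<forall>a<k. \<forall>s<n. Y a s \<in> A) \<and> (\<forall>a<k. Y a \<in> W)" for k i Y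
  have "\<exists>i Y. Q 0 i Y" by (auto simp: Q_def echelon_def)
  moreover have le: "\<forall>k. (\<exists>i Y. Q k i Y) \<longrightarrow> k \<le> n"
    using echelon_le(1) by (auto simp: Q_def)
  moreover define k where "k = (GREATEST k. \<exists>i Y. Q k i Y)"
  ultimately have k: "\<exists>i Y. Q k i Y"
    using GreatestI_nat[of "\<lambda>k. \<exists>i Y. Q k i Y" 0 n] by simp
  have max: "l \<le> k" if "\<exists>i Y. Q l i Y" for l
    unfolding k_def using Greatest_le_nat[of "\<lambda>k. \<exists>i Y. Q k i Y" l n] that le by simp
  obtain i Y where Y: "echelon R n k i Y" and YA: "\<And>a s. a < k \<Longrightarrow> s < n \<Longrightarrow> Y a s \<in> A"
    and YW: "\<And>a. a < k \<Longrightarrow> Y a \<in> W" using k by (auto simp: Q_def)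
  have Wc: "u \<in> {..<n} \<rightarrow>\<^sub>E carrier R" if "u \<in> W" for u using W' that by blast
  have ext: "(\<lambda>s\<in>{..<n}. u s) = u" if "u \<in> {..<n} \<rightarrow>\<^sub>E carrier R" for u
    using that by (simp add: PiE_restrict)
  have Yc: "Y a s \<in> carrier R" if "a < k" "s < n" for a s using echelonD(2)[OF Y] that by blast
  have YW': "(\<lambda>s\<in>{..<n}. Y a s) \<in> W" if "a < k" for a
    using YW[OF that] ext[OF Wc[OF YW[OF that]]] by simp
  have "in_span R n k i Y u" if u: "u \<in> W" for u
  proof (rule ccontr)
    assume no_span: "\<not> in_span R n k i Y u"
    have uc: "u s \<in> carrier R" if "s < n" for s using Wc[OF u] that by auto
    have uic: "u (i a) \<in> carrier R" if "a < k" for a using echelonD(1)[OF Y that] uc by blast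
    \<comment> \<open>The combination of the family that agrees with \<open>u\<close> at all
      pivots.\<close>
    let ?p = "\<lambda>s\<in>{..<n}. \<Oplus>a\<in>{..<k}. u (i a) \<otimes> Y a s"
    have pc: "(\<Oplus>a\<in>{..<k}. u (i a) \<otimes> Y a s) \<in> carrier R" if "s < n" for s
      using that uic Yc by (intro finsum_closed) auto
    have pW: "?p \<in> W" by (rule subspace_lincomb[OF W uic YW'])
    have "(\<lambda>s\<in>{..<n}. u s \<oplus> (\<lambda>s\<in>{..<n}. (\<ominus> \<one>) \<otimes> ?p s) s) = (\<lambda>s\<in>{..<n}. u s \<ominus> ?p s)"
      by (rule restrict_ext) (use pc in \<open>simp add: minus_eq l_minus\<close>)
    with W_add[OF u W_smult[OF _ pW, of "\<ominus> \<one>"]]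
    have vW: "(\<lambda>s\<in>{..<n}. u s \<ominus> ?p s) \<in> W" (is "?v \<in> W") by simp
    have vi: "?v (i b) = \<zero>" if "b < k" for b
      using echelon_lincomb_pivot[OF Y that, of "\<lambda>a. u (i a)"] uic that echelonD(1)[OF Y that]
      by (simp add: minus_eq r_neg)
    have "?v \<noteq> (\<lambda>s\<in>{..<n}. \<zero>)"
    proof
      assume v0: "?v = (\<lambda>s\<in>{..<n}. \<zero>)"
      have "u s = (\<Oplus>a\<in>{..<k}. u (i a) \<otimes> Y a s)" if s: "s < n" for s
      proof -
        have "u s \<ominus> (\<Oplus>a\<in>{..<k}. u (i a) \<otimes> Y a s) = \<zero>"
          using fun_cong[OF v0, of s] s by simp
        then show ?thesis using r_right_minus_eq uc[OF s] pc[OF s] by blast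
      qed
      then show False using no_span by (simp add: in_span_def)
    qed
    then obtain w t c where w: "w \<in> W" "t < n" "w t = \<one>" "\<And>s. s < n \<Longrightarrow> w s \<in> A"
      "c \<in> carrier R" "w = (\<lambda>s\<in>{..<n}. c \<otimes> ?v s)"
      by (rule exists_unimodular_multiple[OF W vW]) (rule that; assumption)
    have wc: "w s \<in> carrier R" if "s < n" for s using w(4)[OF that] A_closed(5) by blast
    have wi: "w (i b) = \<zero>" if "b < k" for b
      using vi[OF that] w(5) echelonD(1)[OF Y that] unfolding w(6) by simp
    define i' where "i' = i(k := t)"
    \<comment> \<open>Column \<open>t\<close> is cleared in the old vectors. Since \<open>w\<close>
      vanishes at the old pivots, their identity block survives, and since \<open>Y\<close> and
      \<open>w\<close> are both over \<open>A\<close>, so is the new family.\<close>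
    define Y' where "Y' a = (if a < k then (\<lambda>s\<in>{..<n}. Y a s \<ominus> Y a t \<otimes> w s) else w)" for a
    have "Y' a \<in> W" if "a < Suc k" for a
    proof (cases "a < k")
      case True
      have "(\<lambda>s\<in>{..<n}. Y a s \<oplus> (\<lambda>s\<in>{..<n}. (\<ominus> Y a t) \<otimes> w s) s) = (\<lambda>s\<in>{..<n}. Y a s \<ominus> Y a t \<otimes> w s)"
        by (rule restrict_ext) (use wc Yc[OF True] w(2) in \<open>simp add: minus_eq l_minus\<close>)
      with W_add[OF YW[OF True] W_smult[OF _ w(1), of "\<ominus> Y a t"]]
      have "(\<lambda>s\<in>{..<n}. Y a s \<ominus> Y a t \<otimes> w s) \<in> W" using Yc[OF True w(2)] by simp
      then show ?thesis using True by (simp add: Y'_def)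
    qed (use w(1) in \<open>simp add: Y'_def\<close>)
    moreover have Y'A: "Y' a s \<in> A" if "a < Suc k" "s < n" for a s
      using that YA[of a] YA[of a t] w(2,4) by (auto simp: Y'_def intro!: A_closed(3,4))
    moreover have "echelon R n (Suc k) i' Y'"
      unfolding echelon_def
    proof (intro allI impI conjI)
      fix a assume a: "a < Suc k"
      show "i' a < n" using a w(2) echelonD(1)[OF Y] by (auto simp: i'_def less_Suc_eq)
      show "Y' a s \<in> carrier R" if "s < n" for s using Y'A[OF a that] A_closed(5) by blast
      fix b assume b: "b < Suc k"
      consider "a < k" "b < k" | "a < k" "b = k" | "a = k" "b < k" | "a = k" "b = k"
        using a b by linarith
      then show "Y' a (i' b) = (if a = b then \<one> else \<zero>)"
      proof cases
        case 1
        then show ?thesis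
          using wi echelonD[OF Y] Yc w(2) by (auto simp: Y'_def i'_def minus_eq)
      next
        case 2
        then show ?thesis using Yc w(2,3) by (auto simp: Y'_def i'_def minus_eq r_neg)
      next
        case 3
        then show ?thesis using wi by (auto simp: Y'_def i'_def)
      next
        case 4
        then show ?thesis using w(3) by (auto simp: Y'_def i'_def)
      qed
    qed
    ultimately have "Q (Suc k) i' Y'" by (auto simp: Q_def)
    then show False using max[of "Suc k"] by auto
  qed
  then have "W \<subseteq> echelon_space n k i Y" using Wc by (auto simp: echelon_space_def)
  moreover have "echelon_space n k i Y \<subseteq> W"
  proof
    fix u assume "u \<in> echelon_space n k i Y"
    then obtain c where c: "c \<in> {..<k} \<rightarrow>\<^sub>E carrier R" "u = lincomb_map n k Y c"
      unfolding echelon_space_eq_image[OF Y] by blast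
    show "u \<in> W"
      unfolding c(2) lincomb_map_def by (rule subspace_lincomb[OF W _ YW']) (use c(1) in auto)
  qed
  ultimately show thesis using that[OF Y YA] by blast
qed

end

section \<open>Thickness in coordinates\<close>

text \<open>The echelon families \<open>Y\<close> and \<open>Z\<close> span \<open>V1\<close> and \<open>V2\<close>, and \<open>u\<close> witnesses that \<open>M g V1\<close> meets \<open>V2\<close>.
  Normalizing the pivots of \<open>Y\<close>, \<open>Z\<close> and one entry of \<open>u\<close> to \<open>1\<close>, instead of asking for linear
  independence and \<open>u \<noteq> 0\<close>, makes the condition stable under all ring homomorphisms.\<close>

definition degenerate ::
    "('a, 'e) ring_scheme \<Rightarrow> nat \<Rightarrow> nat \<Rightarrow> nat \<Rightarrow> 'g set \<Rightarrow> ('g \<Rightarrow> nat \<times> nat \<Rightarrow> 'a) \<Rightarrow> bool" where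
  "degenerate R n k l S M \<longleftrightarrow>
     (\<exists>i Y j Z. echelon R n k i Y \<and> echelon R n l j Z \<and>
       (\<forall>g\<in>S. \<exists>u. (\<forall>s<n. u s \<in> carrier R) \<and> (\<exists>s<n. u s = \<one>\<^bsub>R\<^esub>) \<and>
          in_span R n k i Y u \<and> in_span R n l j Z (mat_apply n R (M g) u)))"

section \<open>Thickness as trivial intersection\<close>

context field
begin

lemma mat_apply_closed:
  assumes "A \<in> carrier (mat_monoid n R)" "\<And>s. s < n \<Longrightarrow> u s \<in> carrier R"
  shows "mat_apply n R A u \<in> {..<n} \<rightarrow>\<^sub>E carrier R"
  unfolding mat_apply_def restrict_PiE_iff
proof
  fix s assume "s \<in> {..<n}"
  then show "(\<Oplus>t\<in>{..<n}. A (s, t) \<otimes> u t) \<in> carrier R"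
    using assms mat_carrierD[OF assms(1)] by (intro finsum_closed Pi_I m_closed) simp_all
qed

lemma mat_apply_cong:
  assumes "A \<in> carrier (mat_monoid n R)" "\<And>s. s < n \<Longrightarrow> u s \<in> carrier R" "\<And>s. s < n \<Longrightarrow> u s = v s"
  shows "mat_apply n R A u = mat_apply n R A v"
  unfolding mat_apply_def
proof (rule restrict_ext)
  fix s assume s: "s \<in> {..<n}"
  show "(\<Oplus>t\<in>{..<n}. A (s, t) \<otimes> u t) = (\<Oplus>t\<in>{..<n}. A (s, t) \<otimes> v t)"
    by (rule finsum_cong') (use assms s mat_carrierD[OF assms(1)] in auto)
qed

lemma mat_apply_module_hom:
  assumes A: "A \<in> carrier (mat_monoid n R)"
  shows "mat_apply n R A \<in> LinearCombinations.module_hom R (std_space n R) (std_space n R)"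
proof -
  \<comment> \<open>The columns of \<open>A\<close> form the family, which makes the action of a
    matrix an instance of \<open>lincomb_map\<close>.\<close>
  let ?T = "lincomb_map n n (\<lambda>t s. A (s, t))"
  have T: "?T \<in> LinearCombinations.module_hom R (std_space n R) (std_space n R)"
    using mat_carrierD[OF A] by (intro lincomb_map_hom)
  have eq: "mat_apply n R A u = ?T u" if u: "u \<in> carrier (std_space n R)" for u
    unfolding mat_apply_def lincomb_map_def
  proof (rule restrict_ext)
    fix s assume s: "s \<in> {..<n}"
    have u': "u t \<in> carrier R" if "t < n" for t using u that by (auto simp: carrier_std_space)
    show "(\<Oplus>t\<in>{..<n}. A (s, t) \<otimes> u t) = (\<Oplus>t\<in>{..<n}. u t \<otimes> A (s, t))"
      by (rule finsum_cong') (use u' s mat_carrierD[OF A] in \<open>auto simp: m_comm\<close>)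
  qed
  interpret V: vectorspace R "std_space n R" by (rule vectorspace_std_space)
  show ?thesis
    using T V.M.a_closed V.smult_closed
    unfolding LinearCombinations.module_hom_def by (simp add: eq Pi_def)
qed

lemma mat_apply_inverse:
  assumes A: "A \<in> carrier (mat_monoid n R)" and B: "B \<in> carrier (mat_monoid n R)"
    and BA: "B \<otimes>\<^bsub>mat_monoid n R\<^esub> A = \<one>\<^bsub>mat_monoid n R\<^esub>"
    and u: "u \<in> {..<n} \<rightarrow>\<^sub>E carrier R"
  shows "mat_apply n R B (mat_apply n R A u) = u"
proof (rule PiE_ext)
  note Ac = mat_carrierD[OF A] and Bc = mat_carrierD[OF B]
  have uc: "u s \<in> carrier R" if "s < n" for s using PiE_mem[OF u] that by simp
  have Au: "mat_apply n R A u \<in> {..<n} \<rightarrow>\<^sub>E carrier R" by (rule mat_apply_closed[OF A uc])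
  show "mat_apply n R B (mat_apply n R A u) \<in> {..<n} \<rightarrow>\<^sub>E carrier R"
    using PiE_mem[OF Au] by (intro mat_apply_closed[OF B]) simp
  show "u \<in> {..<n} \<rightarrow>\<^sub>E carrier R" by fact
  fix s assume "s \<in> {..<n}"
  then have s: "s < n" by simp
  have "mat_apply n R B (mat_apply n R A u) s
      = (\<Oplus>t\<in>{..<n}. B (s, t) \<otimes> (\<Oplus>r\<in>{..<n}. A (t, r) \<otimes> u r))"
    unfolding mat_apply_def using s Ac Bc uc by (simp, intro finsum_cong') auto
  also have "\<dots> = (\<Oplus>t\<in>{..<n}. \<Oplus>r\<in>{..<n}. B (s, t) \<otimes> (A (t, r) \<otimes> u r))"
    using s Ac Bc uc by (intro finsum_cong' refl finsum_rdistr) auto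
  also have "\<dots> = (\<Oplus>r\<in>{..<n}. \<Oplus>t\<in>{..<n}. B (s, t) \<otimes> (A (t, r) \<otimes> u r))"
    using s Ac Bc uc by (intro finsum_swap) auto
  also have "\<dots> = (\<Oplus>r\<in>{..<n}. (\<Oplus>t\<in>{..<n}. B (s, t) \<otimes> A (t, r)) \<otimes> u r)"
  proof (intro finsum_cong' refl)
    fix r assume "r \<in> {..<n}"
    then have r: "r < n" by simp
    have "(\<Oplus>t\<in>{..<n}. B (s, t) \<otimes> (A (t, r) \<otimes> u r)) = (\<Oplus>t\<in>{..<n}. B (s, t) \<otimes> A (t, r) \<otimes> u r)"
      using s r Ac Bc uc by (intro finsum_cong') (auto simp: m_assoc)
    also have "\<dots> = (\<Oplus>t\<in>{..<n}. B (s, t) \<otimes> A (t, r)) \<otimes> u r"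
      using s r Ac Bc uc by (intro finsum_ldistr[symmetric]) auto
    finally show "(\<Oplus>t\<in>{..<n}. B (s, t) \<otimes> (A (t, r) \<otimes> u r)) = (\<Oplus>t\<in>{..<n}. B (s, t) \<otimes> A (t, r)) \<otimes> u r" .
  qed (use s Ac Bc uc in auto)
  also have "\<dots> = (\<Oplus>r\<in>{..<n}. if s = r then u r else \<zero>)"
  proof (intro finsum_cong' refl)
    fix r assume "r \<in> {..<n}"
    then have r: "r < n" by simp
    have "(\<Oplus>t\<in>{..<n}. B (s, t) \<otimes> A (t, r)) = \<one>\<^bsub>mat_monoid n R\<^esub> (s, r)"
      unfolding BA[symmetric] mat_mult_apply[OF s r] ..
    then show "(\<Oplus>t\<in>{..<n}. B (s, t) \<otimes> A (t, r)) \<otimes> u r = (if s = r then u r else \<zero>)"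
      using uc[OF r] by (simp add: mat_one_apply[OF s r])
  qed (use uc in auto)
  also have "\<dots> = u s" using s uc by (intro finsum_singleton) auto
  finally show "mat_apply n R B (mat_apply n R A u) s = u s" .
qed

text \<open>Addition of a vector of \<open>V1\<close> and one of \<open>V2\<close> is a linear map
  from a space of dimension \<open>n\<close>. It is injective because the intersection is trivial,
  hence surjective by dimension.\<close>

lemma complementary_subspaces_sum:
  assumes V1: "VectorSpace.subspace R V1 (std_space n R)" and V2: "VectorSpace.subspace R V2 (std_space n R)"
    and dim1: "vectorspace.dim R ((std_space n R)\<lparr>carrier := V1\<rparr>) = k"
    and dim2: "vectorspace.dim R ((std_space n R)\<lparr>carrier := V2\<rparr>) = l"
    and n: "k + l = n" and inter: "V1 \<inter> V2 \<subseteq> {\<lambda>s\<in>{..<n}. \<zero>}"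
  shows "LinearCombinations.module.submodule_sum (std_space n R) V1 V2 = carrier (std_space n R)"
proof -
  let ?V = "std_space n R"
  interpret V: vectorspace R ?V by (rule vectorspace_std_space)
  interpret val: valuation_subring R "carrier R"
    by (intro valuation_subring.intro valuation_subring_axioms.intro field_axioms carrier_is_subring) blast
  obtain k' i Y where Y: "echelon R n k' i Y" "V1 = echelon_space n k' i Y"
    using val.subspace_echelon_basis[OF V1] by metis
  obtain l' j Z where Z: "echelon R n l' j Z" "V2 = echelon_space n l' j Z"
    using val.subspace_echelon_basis[OF V2] by metis
  have [simp]: "k' = k" "l' = l"
    using echelon_space_subspace(2)[OF Y(1)] echelon_space_subspace(2)[OF Z(1)] dim1 dim2 Y(2) Z(2) by auto
  note Y' = Y[simplified] and Z' = Z[simplified]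
  \<comment> \<open>The two bases one after the other. Their pivots may collide, so \<open>E\<close>
    is in general not an echelon family and its independence has to come from the trivial
    intersection.\<close>
  define E where "E a = (if a < k then Y a else Z (a - k))" for a
  have Ec: "E a s \<in> carrier R" if "a < n" "s < n" for a s
    using that echelonD(2)[OF Y'(1), of a s] echelonD(2)[OF Z'(1), of "a - k" s] n by (auto simp: E_def)
  let ?\<Phi> = "lincomb_map n n E"
  have \<Phi>: "?\<Phi> \<in> LinearCombinations.module_hom R ?V ?V" by (rule lincomb_map_hom[OF Ec])
  interpret \<Phi>: linear_map R ?V ?V ?\<Phi>
    by (intro linear_map.intro mod_hom.intro mod_hom_axioms.intro V.module_axioms V.vectorspace_axioms \<Phi>)
  let ?p = "\<lambda>c. \<lambda>a\<in>{..<k}. c a" and ?q = "\<lambda>c. \<lambda>b\<in>{..<l}. c (k + b)"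
  have pq: "?p c \<in> {..<k} \<rightarrow>\<^sub>E carrier R" "?q c \<in> {..<l} \<rightarrow>\<^sub>E carrier R"
    if c: "c \<in> carrier ?V" for c
  proof -
    have "c a \<in> carrier R" if "a < n" for a
      using PiE_mem[OF c[unfolded carrier_std_space]] that by simp
    then show "?p c \<in> {..<k} \<rightarrow>\<^sub>E carrier R" "?q c \<in> {..<l} \<rightarrow>\<^sub>E carrier R"
      unfolding restrict_PiE_iff using n by simp_all
  qed
  have split: "?\<Phi> c = lincomb_map n k Y (?p c) \<oplus>\<^bsub>?V\<^esub> lincomb_map n l Z (?q c)" if c: "c \<in> carrier ?V" for c
    unfolding std_space_simps lincomb_map_def
  proof (rule restrict_ext)
    fix s assume s: "s \<in> {..<n}"
    have c': "c a \<in> carrier R" if "a < n" for a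
      using PiE_mem[OF c[unfolded carrier_std_space]] that by simp
    have Yc: "Y a s \<in> carrier R" if "a < k" for a using echelonD(2)[OF Y'(1) that] s by simp
    have Zc: "Z b s \<in> carrier R" if "b < l" for b using echelonD(2)[OF Z'(1) that] s by simp
    have "{..<n} = {..<k} \<union> (\<lambda>b. k + b) ` {..<l}"
    proof (intro equalityI subsetI)
      fix a assume "a \<in> {..<n}"
      then show "a \<in> {..<k} \<union> (\<lambda>b. k + b) ` {..<l}"
        using n by (cases "a < k") (auto intro!: image_eqI[of _ _ "a - k"])
    qed (use n in auto)
    then have "(\<Oplus>a\<in>{..<n}. c a \<otimes> E a s)
        = (\<Oplus>a\<in>{..<k} \<union> (\<lambda>b. k + b) ` {..<l}. c a \<otimes> E a s)" by simp
    also have "\<dots> = (\<Oplus>a\<in>{..<k}. c a \<otimes> E a s) \<oplus> (\<Oplus>a\<in>(\<lambda>b. k + b) ` {..<l}. c a \<otimes> E a s)"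
      using s n c' Ec by (intro finsum_Un_disjoint) auto
    also have "(\<Oplus>a\<in>(\<lambda>b. k + b) ` {..<l}. c a \<otimes> E a s) = (\<Oplus>b\<in>{..<l}. c (k + b) \<otimes> E (k + b) s)"
      using s n c' Ec by (intro finsum_reindex) (auto simp: inj_on_def)
    also have "\<dots> = (\<Oplus>b\<in>{..<l}. ?q c b \<otimes> Z b s)"
      using n c' Zc by (intro finsum_cong') (auto simp: E_def)
    also have "(\<Oplus>a\<in>{..<k}. c a \<otimes> E a s) = (\<Oplus>a\<in>{..<k}. ?p c a \<otimes> Y a s)"
      using n c' Yc by (intro finsum_cong') (auto simp: E_def)
    finally show "(\<Oplus>a\<in>{..<n}. c a \<otimes> E a s)
      = (\<lambda>s\<in>{..<n}. \<Oplus>a\<in>{..<k}. ?p c a \<otimes> Y a s) s \<oplus> (\<lambda>s\<in>{..<n}. \<Oplus>b\<in>{..<l}. ?q c b \<otimes> Z b s) s"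
      using s by simp
  qed
  have in1: "lincomb_map n k Y (?p c) \<in> V1" and in2: "lincomb_map n l Z (?q c) \<in> V2"
    if c: "c \<in> carrier ?V" for c
    unfolding Y'(2) Z'(2) echelon_space_eq_image[OF Y'(1)] echelon_space_eq_image[OF Z'(1)]
    using pq[OF c] by blast+
  note V1' = V1[unfolded subspace_std_space_iff] and V2' = V2[unfolded subspace_std_space_iff]
  have V12: "V1 \<subseteq> carrier ?V" "V2 \<subseteq> carrier ?V" using V1' V2' by (simp_all add: carrier_std_space)
  have ker: "c = \<zero>\<^bsub>?V\<^esub>" if c: "c \<in> carrier ?V" "?\<Phi> c = \<zero>\<^bsub>?V\<^esub>" for c
  proof -
    let ?x = "lincomb_map n k Y (?p c)" and ?y = "lincomb_map n l Z (?q c)"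
    have xy: "?x \<in> carrier ?V" "?y \<in> carrier ?V" using in1[OF c(1)] in2[OF c(1)] V12 by blast+
    have sum: "?x \<oplus>\<^bsub>?V\<^esub> ?y = \<zero>\<^bsub>?V\<^esub>" using split[OF c(1)] c(2) by simp
    then have "?x = \<ominus>\<^bsub>?V\<^esub> ?y" using V.M.minus_equality[of ?x ?y] xy by simp
    moreover have "\<ominus>\<^bsub>?V\<^esub> ?y \<in> V2"
      using submodule.smult_closed[OF V.is_module[OF V2] _ in2[OF c(1)], of "\<ominus> \<one>"] V.smult_minus_1[of ?y] xy
      by simp
    ultimately have x0: "?x = \<zero>\<^bsub>?V\<^esub>" using inter in1[OF c(1)] by (auto simp: std_space_simps)
    then have y0: "?y = \<zero>\<^bsub>?V\<^esub>" using sum xy by simp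
    have zk: "(\<lambda>s\<in>{..<k}. \<zero>) \<in> carrier (std_space k R)" for k by (simp add: carrier_std_space)
    have zmap: "lincomb_map n k Y (\<lambda>s\<in>{..<k}. \<zero>) = \<zero>\<^bsub>?V\<^esub>" if "echelon R n k i Y" for k i Y
      unfolding std_space_simps lincomb_map_def
      by (rule restrict_ext) (use echelonD(2)[OF that] in \<open>auto intro!: add.finprod_one_eqI\<close>)
    have "?p c = (\<lambda>s\<in>{..<k}. \<zero>)"
      using inj_onD[OF lincomb_map_inj[OF Y'(1)], of "?p c" "\<lambda>s\<in>{..<k}. \<zero>"] x0 zmap[OF Y'(1)] zk pq(1)[OF c(1)]
      by (simp add: carrier_std_space)
    moreover have "?q c = (\<lambda>s\<in>{..<l}. \<zero>)"
      using inj_onD[OF lincomb_map_inj[OF Z'(1)], of "?q c" "\<lambda>s\<in>{..<l}. \<zero>"] y0 zmap[OF Z'(1)] zk pq(2)[OF c(1)]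
      by (simp add: carrier_std_space)
    ultimately have c0: "a < k \<Longrightarrow> c a = \<zero>" "b < l \<Longrightarrow> c (k + b) = \<zero>" for a b
      by (metis lessThan_iff restrict_apply')+
    show ?thesis
    proof (rule PiE_ext)
      show "c \<in> {..<n} \<rightarrow>\<^sub>E carrier R" "\<zero>\<^bsub>?V\<^esub> \<in> {..<n} \<rightarrow>\<^sub>E carrier R"
        using c by (simp_all add: carrier_std_space std_space_simps)
      fix a assume "a \<in> {..<n}"
      then show "c a = \<zero>\<^bsub>?V\<^esub> a"
        using c0(1)[of a] c0(2)[of "a - k"] n by (cases "a < k") (auto simp: std_space_simps)
    qed
  qed
  have "inj_on ?\<Phi> (carrier ?V)"
  proof (rule \<Phi>.Ke0_imp_inj)
    show "carrier (?V\<lparr>carrier := \<Phi>.kerT\<rparr>) = {\<zero>\<^bsub>?V\<^esub>}"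
      using ker by (auto simp: \<Phi>.ker_def)
  qed
  note im = image_subspace(1)[OF \<Phi>] image_subspace(2)[OF \<Phi> this]
  obtain k'' i'' Y'' where "echelon R n k'' i'' Y''" "?\<Phi> ` carrier ?V = echelon_space n k'' i'' Y''"
    using val.subspace_echelon_basis[OF im(1)] by metis
  from subspace_full_dim[OF im this] have surj: "?\<Phi> ` carrier ?V = carrier ?V" .
  show ?thesis
  proof (intro equalityI subsetI)
    fix v assume "v \<in> V.submodule_sum V1 V2"
    then show "v \<in> carrier ?V" using V12 by (auto simp: V.submodule_sum_def)
  next
    fix v assume "v \<in> carrier ?V"
    then obtain c where c: "c \<in> carrier ?V" "v = ?\<Phi> c" using surj by blast
    show "v \<in> V.submodule_sum V1 V2"
      unfolding V.submodule_sum_def c(2) split[OF c(1)] using in1[OF c(1)] in2[OF c(1)] by blast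
  qed
qed

text \<open>An invertible matrix preserves the dimension of \<open>V1\<close>, so the dimensions
  stay complementary and only the intersection has to be examined.\<close>

lemma internal_direct_sum_iff:
  assumes A: "A \<in> Units (mat_monoid n R)"
    and V1: "VectorSpace.subspace R V1 (std_space n R)" and V2: "VectorSpace.subspace R V2 (std_space n R)"
    and dim1: "vectorspace.dim R ((std_space n R)\<lparr>carrier := V1\<rparr>) = k"
    and dim2: "vectorspace.dim R ((std_space n R)\<lparr>carrier := V2\<rparr>) = l"
    and n: "k + l = n"
  shows "internal_direct_sum R (std_space n R) (mat_apply n R A ` V1) V2 \<longleftrightarrow>
    \<not> (\<exists>u\<in>V1. u \<noteq> (\<lambda>s\<in>{..<n}. \<zero>) \<and> mat_apply n R A u \<in> V2)"
proof -
  let ?V = "std_space n R" and ?T = "mat_apply n R A" and ?z = "\<lambda>s\<in>{..<n}. \<zero>"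
  interpret val: valuation_subring R "carrier R"
    by (intro valuation_subring.intro valuation_subring_axioms.intro field_axioms carrier_is_subring) blast
  obtain B where B: "B \<in> carrier (mat_monoid n R)" "B \<otimes>\<^bsub>mat_monoid n R\<^esub> A = \<one>\<^bsub>mat_monoid n R\<^esub>"
    and Ac: "A \<in> carrier (mat_monoid n R)"
    using A by (auto simp: Units_def)
  have T: "?T \<in> LinearCombinations.module_hom R ?V ?V" by (rule mat_apply_module_hom[OF Ac])
  have inj: "inj_on ?T (carrier ?V)"
    by (rule inj_on_inverseI[of _ "mat_apply n R B"])
      (rule mat_apply_inverse[OF Ac B], simp add: carrier_std_space)
  have V12: "V1 \<subseteq> carrier ?V" "?z \<in> V1" "V2 \<subseteq> carrier ?V" "?z \<in> V2"
    using V1[unfolded subspace_std_space_iff] V2[unfolded subspace_std_space_iff]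
    by (simp_all add: carrier_std_space)
  obtain k' i Y where Y: "echelon R n k' i Y" "V1 = echelon_space n k' i Y"
    using val.subspace_echelon_basis[OF V1] by metis
  have "k' = k" using echelon_space_subspace(2)[OF Y(1)] dim1 Y(2) by simp
  note Y = Y[unfolded this]
  let ?L = "lincomb_map n k Y"
  have L: "?L \<in> LinearCombinations.module_hom R (std_space k R) ?V"
    using echelonD(2)[OF Y(1)] by (intro lincomb_map_hom) auto
  have V1_eq: "V1 = ?L ` carrier (std_space k R)"
    using echelon_space_eq_image[OF Y(1)] Y(2) by (simp add: carrier_std_space)
  have TL: "?T \<circ> ?L \<in> LinearCombinations.module_hom R (std_space k R) ?V"
    using T L unfolding LinearCombinations.module_hom_def by (simp add: Pi_def)
  have TL_inj: "inj_on (?T \<circ> ?L) (carrier (std_space k R))"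
    using lincomb_map_inj[OF Y(1)] inj_on_subset[OF inj V12(1)] unfolding V1_eq by (rule comp_inj_on)
  have TV1: "VectorSpace.subspace R (?T ` V1) ?V"
    and dim: "vectorspace.dim R (?V\<lparr>carrier := ?T ` V1\<rparr>) = k"
    using image_subspace(1)[OF TL] image_subspace(2)[OF TL TL_inj] unfolding V1_eq image_comp by simp_all
  have z: "?z \<in> ?T ` V1" using TV1[unfolded subspace_std_space_iff] by blast
  interpret V: vectorspace R ?V by (rule vectorspace_std_space)
  interpret T: linear_map R ?V ?V ?T
    by (intro linear_map.intro mod_hom.intro mod_hom_axioms.intro V.module_axioms V.vectorspace_axioms T)
  have Tz: "?T ?z = ?z" using T.T0_is_0 by (simp add: std_space_simps)
  show ?thesis
  proof
    assume "internal_direct_sum R ?V (?T ` V1) V2"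
    then have inter: "?T ` V1 \<inter> V2 = {?z}" by (simp add: internal_direct_sum_def std_space_simps)
    have "u = ?z" if "u \<in> V1" "?T u \<in> V2" for u
    proof -
      have "?T u \<in> {?z}" using that unfolding inter[symmetric] by (intro IntI imageI)
      then have "?T u = ?T ?z" unfolding Tz by (rule singletonD)
      then show ?thesis using inj_onD[OF inj] that V12 by blast
    qed
    then show "\<not> (\<exists>u\<in>V1. u \<noteq> ?z \<and> ?T u \<in> V2)" by blast
  next
    assume *: "\<not> (\<exists>u\<in>V1. u \<noteq> ?z \<and> ?T u \<in> V2)"
    have inter: "?T ` V1 \<inter> V2 \<subseteq> {?z}"
    proof
      fix v assume "v \<in> ?T ` V1 \<inter> V2"
      then obtain u where "u \<in> V1" "v = ?T u" "?T u \<in> V2" by blast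
      then show "v \<in> {?z}" using * Tz by (cases "u = ?z") auto
    qed
    then show "internal_direct_sum R ?V (?T ` V1) V2"
      using complementary_subspaces_sum[OF TV1 V2 dim dim2 n inter] TV1 V2 z V12(4)
      by (auto simp: internal_direct_sum_def std_space_simps)
  qed
qed

text \<open>The failure of thickness without coordinates, midway between \<open>thick_at\<close> and
  \<open>degenerate\<close>. It allows echelon families to be chosen anew over a different
  ring.\<close>

definition meeting_subspaces :: "nat \<Rightarrow> nat \<Rightarrow> nat \<Rightarrow> 'g set \<Rightarrow> ('g \<Rightarrow> nat \<times> nat \<Rightarrow> 'a) \<Rightarrow> bool" where
  "meeting_subspaces n k l S M \<longleftrightarrow>
     (\<exists>V1 V2. VectorSpace.subspace R V1 (std_space n R) \<and> VectorSpace.subspace R V2 (std_space n R) \<and>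
       vectorspace.dim R ((std_space n R)\<lparr>carrier := V1\<rparr>) = k \<and>
       vectorspace.dim R ((std_space n R)\<lparr>carrier := V2\<rparr>) = l \<and>
       (\<forall>g\<in>S. \<exists>u\<in>V1. u \<noteq> (\<lambda>s\<in>{..<n}. \<zero>) \<and> mat_apply n R (M g) u \<in> V2))"

lemma thick_at_iff:
  assumes "m \<le> n" and M: "\<And>g. g \<in> carrier G \<Longrightarrow> M g \<in> Units (mat_monoid n R)"
    and \<rho>: "\<And>g. g \<in> carrier G \<Longrightarrow> \<rho> g = mat_apply n R (M g)"
  shows "thick_at G R (std_space n R) \<rho> m \<longleftrightarrow> \<not> meeting_subspaces n m (n - m) (carrier G) M"
proof -
  have n: "m + (n - m) = n" using assms(1) by simp
  show ?thesis
    unfolding thick_at_def meeting_subspaces_def dim_std_space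
    using internal_direct_sum_iff[OF M _ _ _ _ n] \<rho> by (smt (verit, ccfv_SIG))
qed

lemma degenerate_imp_meeting_subspaces:
  assumes deg: "degenerate R n k l S M" and M: "\<And>g. g \<in> S \<Longrightarrow> M g \<in> carrier (mat_monoid n R)"
  shows "meeting_subspaces n k l S M"
proof -
  obtain i Y j Z where Y: "echelon R n k i Y" and Z: "echelon R n l j Z"
    and u: "\<And>g. g \<in> S \<Longrightarrow> \<exists>u. (\<forall>s<n. u s \<in> carrier R) \<and> (\<exists>s<n. u s = \<one>) \<and>
          in_span R n k i Y u \<and> in_span R n l j Z (mat_apply n R (M g) u)"
    using deg unfolding degenerate_def by blast
  have "\<exists>u\<in>echelon_space n k i Y. u \<noteq> (\<lambda>s\<in>{..<n}. \<zero>) \<and> mat_apply n R (M g) u \<in> echelon_space n l j Z"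
    if g: "g \<in> S" for g
  proof -
    obtain u t where u: "\<And>s. s < n \<Longrightarrow> u s \<in> carrier R" "t < n" "u t = \<one>"
      "in_span R n k i Y u" "in_span R n l j Z (mat_apply n R (M g) u)"
      using u[OF g] by blast
    \<comment> \<open>\<open>degenerate\<close> constrains \<open>u\<close> only below
      \<open>n\<close>; restriction makes it an element of the standard space.\<close>
    let ?u = "\<lambda>s\<in>{..<n}. u s"
    have uc: "?u \<in> {..<n} \<rightarrow>\<^sub>E carrier R" unfolding restrict_PiE_iff using u(1) by simp
    have "in_span R n k i Y ?u"
      unfolding in_span_def
    proof (intro allI impI)
      fix s assume s: "s < n"
      have "u s = (\<Oplus>a\<in>{..<k}. u (i a) \<otimes> Y a s)" using u(4) s by (simp add: in_span_def)
      also have "\<dots> = (\<Oplus>a\<in>{..<k}. ?u (i a) \<otimes> Y a s)"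
        using s u(1) echelonD(1,2)[OF Y] by (intro finsum_cong') auto
      finally show "?u s = (\<Oplus>a\<in>{..<k}. ?u (i a) \<otimes> Y a s)" using s by simp
    qed
    moreover have "mat_apply n R (M g) ?u = mat_apply n R (M g) u"
      by (rule mat_apply_cong[OF M[OF g]]) (simp_all add: u(1))
    moreover have "?u \<noteq> (\<lambda>s\<in>{..<n}. \<zero>)"
    proof
      assume "?u = (\<lambda>s\<in>{..<n}. \<zero>)"
      then have "?u t = (\<lambda>s\<in>{..<n}. \<zero>) t" by (rule fun_cong)
      then show False using u(2,3) by simp
    qed
    ultimately show ?thesis
      using uc u(5) mat_apply_closed[OF M[OF g] u(1)]
      by (intro bexI[of _ ?u]) (simp_all add: echelon_space_def)
  qed
  then show ?thesis
    unfolding meeting_subspaces_def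
    using echelon_space_subspace[OF Y] echelon_space_subspace[OF Z] by blast
qed

end

text \<open>\<open>finsum\<close> depends on the carrier, so sums in a subring are compared with
  sums in \<open>R\<close> through the inclusion homomorphism.\<close>

lemma (in ring) finsum_subring:
  assumes "subring A R" and "\<And>x. x \<in> I \<Longrightarrow> f x \<in> A"
  shows "finsum (R\<lparr>carrier := A\<rparr>) f I = finsum R f I"
proof -
  interpret A: ring "R\<lparr>carrier := A\<rparr>" using assms(1) by (rule subring_is_ring)
  have "id \<in> ring_hom (R\<lparr>carrier := A\<rparr>) R"
    using subringE(1)[OF assms(1)] by (intro ring_hom_memI) auto
  then interpret id: ring_hom_ring "R\<lparr>carrier := A\<rparr>" R id
    by (rule ring_hom_ringI2[OF A.ring_axioms ring_axioms])
  show ?thesis using id.hom_finsum[of f I] assms(2) by (simp add: Pi_def comp_def)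
qed

text \<open>The properness step: data over the field are replaced by data over \<open>A\<close>.
  Subspaces have echelon families over \<open>A\<close>, and each common vector can be scaled to be
  unimodular, since meeting \<open>V2\<close> is invariant under scaling.\<close>

lemma (in valuation_subring) meeting_subspaces_imp_degenerate:
  assumes meet: "meeting_subspaces n k l S M" and M: "\<And>g. g \<in> S \<Longrightarrow> M g \<in> carrier (mat_monoid n R)"
    and MA: "\<And>g s t. g \<in> S \<Longrightarrow> s < n \<Longrightarrow> t < n \<Longrightarrow> M g (s, t) \<in> A"
  shows "degenerate (R\<lparr>carrier := A\<rparr>) n k l S M"
proof -
  obtain V1 V2 where V1: "VectorSpace.subspace R V1 (std_space n R)"
    and V2: "VectorSpace.subspace R V2 (std_space n R)"
    and dim1: "vectorspace.dim R ((std_space n R)\<lparr>carrier := V1\<rparr>) = k"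
    and dim2: "vectorspace.dim R ((std_space n R)\<lparr>carrier := V2\<rparr>) = l"
    and meets: "\<And>g. g \<in> S \<Longrightarrow> \<exists>u\<in>V1. u \<noteq> (\<lambda>s\<in>{..<n}. \<zero>) \<and> mat_apply n R (M g) u \<in> V2"
    using meet unfolding meeting_subspaces_def by blast
  obtain k' i Y where Y: "echelon R n k' i Y" "\<And>a s. a < k' \<Longrightarrow> s < n \<Longrightarrow> Y a s \<in> A"
    "V1 = echelon_space n k' i Y"
    by (rule subspace_echelon_basis[OF V1]) (rule that; assumption)
  obtain l' j Z where Z: "echelon R n l' j Z" "\<And>a s. a < l' \<Longrightarrow> s < n \<Longrightarrow> Z a s \<in> A"
    "V2 = echelon_space n l' j Z"
    by (rule subspace_echelon_basis[OF V2]) (rule that; assumption)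
  have kl: "k' = k" "l' = l"
    using echelon_space_subspace(2)[OF Y(1)] echelon_space_subspace(2)[OF Z(1)] dim1 dim2 Y(3) Z(3)
    by simp_all
  note Y = Y[unfolded kl] and Z = Z[unfolded kl]
  let ?A = "R\<lparr>carrier := A\<rparr>"
  have ech: "echelon ?A n k i Y" if "echelon R n k i Y" "\<And>a s. a < k \<Longrightarrow> s < n \<Longrightarrow> Y a s \<in> A" for k i Y
    using that unfolding echelon_def by simp
  have span: "in_span ?A n k i Y u"
    if "in_span R n k i Y u" "\<And>a s. a < k \<Longrightarrow> s < n \<Longrightarrow> Y a s \<in> A" "\<And>s. s < n \<Longrightarrow> u s \<in> A"
      "\<And>a. a < k \<Longrightarrow> i a < n" for k i Y u
    unfolding in_span_def
  proof (intro allI impI)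
    fix s assume s: "s < n"
    have "finsum ?A (\<lambda>a. u (i a) \<otimes> Y a s) {..<k} = finsum R (\<lambda>a. u (i a) \<otimes> Y a s) {..<k}"
      using s that A_closed(3) by (intro finsum_subring[OF subring]) auto
    then show "u s = (\<Oplus>\<^bsub>?A\<^esub>a\<in>{..<k}. u (i a) \<otimes>\<^bsub>?A\<^esub> Y a s)"
      using that(1) s by (simp add: in_span_def)
  qed
  have "\<exists>u. (\<forall>s<n. u s \<in> A) \<and> (\<exists>s<n. u s = \<one>) \<and> in_span ?A n k i Y u \<and>
      in_span ?A n l j Z (mat_apply n ?A (M g) u)" if g: "g \<in> S" for g
  proof -
    obtain v where v: "v \<in> V1" "v \<noteq> (\<lambda>s\<in>{..<n}. \<zero>)" "mat_apply n R (M g) v \<in> V2"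
      using meets[OF g] by blast
    obtain w t c where w: "w \<in> V1" "t < n" "w t = \<one>" "\<And>s. s < n \<Longrightarrow> w s \<in> A"
      "c \<in> carrier R" "w = (\<lambda>s\<in>{..<n}. c \<otimes> v s)"
      by (rule exists_unimodular_multiple[OF V1 v(1,2)]) (rule that; assumption)
    have vc: "v \<in> carrier (std_space n R)"
      using v(1) V1[unfolded subspace_std_space_iff] by (auto simp: carrier_std_space)
    have "mat_apply n R (M g) w = c \<odot>\<^bsub>std_space n R\<^esub> mat_apply n R (M g) v"
      using module_hom_smult[OF mat_apply_module_hom[OF M[OF g]] w(5) vc] w(6)
      by (simp add: std_space_simps)
    also have "\<dots> \<in> V2"
      using V2[unfolded subspace_std_space_iff] v(3) w(5) by (simp add: std_space_simps)
    finally have Tw: "mat_apply n R (M g) w \<in> V2" .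
    have prodA: "M g (s, t) \<otimes> w t \<in> A" if "s < n" "t < n" for s t
      using MA[OF g that] w(4)[OF that(2)] by (rule A_closed(3))
    have eq: "mat_apply n ?A (M g) w = mat_apply n R (M g) w"
      unfolding mat_apply_def
    proof (rule restrict_ext)
      fix s assume "s \<in> {..<n}"
      then have "finsum ?A (\<lambda>t. M g (s, t) \<otimes> w t) {..<n} = finsum R (\<lambda>t. M g (s, t) \<otimes> w t) {..<n}"
        using prodA by (intro finsum_subring[OF subring]) auto
      then show "(\<Oplus>\<^bsub>?A\<^esub>t\<in>{..<n}. M g (s, t) \<otimes>\<^bsub>?A\<^esub> w t) = (\<Oplus>t\<in>{..<n}. M g (s, t) \<otimes> w t)" by simp
    qed
    have TwA: "mat_apply n R (M g) w s \<in> A" if s: "s < n" for s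
    proof -
      interpret A: ring ?A using subring by (rule subring_is_ring)
      have "finsum ?A (\<lambda>t. M g (s, t) \<otimes> w t) {..<n} \<in> carrier ?A"
        using s prodA by (intro A.finsum_closed) auto
      then show ?thesis unfolding eq[symmetric] using s by (simp add: mat_apply_def)
    qed
    have "in_span R n k i Y w" "in_span R n l j Z (mat_apply n R (M g) w)"
      using w(1) Tw unfolding Y(3) Z(3) echelon_space_def by blast+
    then have "in_span ?A n k i Y w" "in_span ?A n l j Z (mat_apply n ?A (M g) w)"
      unfolding eq
      using span[of k i Y w] span[of l j Z "mat_apply n R (M g) w"] Y(2) w(4) echelonD(1)[OF Y(1)]
        Z(2) TwA echelonD(1)[OF Z(1)]
      by simp_all
    then show ?thesis using w(2-4) by blast
  qed
  then show ?thesis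
    unfolding degenerate_def
    by (intro exI[of _ i] exI[of _ Y] exI[of _ j] exI[of _ Z])
      (use ech[of k i Y] ech[of l j Z] Y(1,2) Z(1,2) in simp)
qed

lemma (in field) meeting_subspaces_iff:
  assumes M: "\<And>g. g \<in> S \<Longrightarrow> M g \<in> carrier (mat_monoid n R)"
  shows "meeting_subspaces n k l S M \<longleftrightarrow> degenerate R n k l S M"
proof
  interpret valuation_subring R "carrier R"
    by (intro valuation_subring.intro valuation_subring_axioms.intro field_axioms carrier_is_subring) blast
  assume "meeting_subspaces n k l S M"
  from meeting_subspaces_imp_degenerate[OF this M mat_carrierD[OF M]]
  show "degenerate R n k l S M" by simp
qed (use degenerate_imp_meeting_subspaces M in blast)

section \<open>Transfer of degeneracy\<close>

text \<open>The families and vectors in \<open>degenerate\<close> are arbitrary outside their index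
  ranges, so equations are transported along agreement inside them.\<close>

lemma in_span_cong:
  assumes R: "ring R" and span: "in_span R n k i Y u" and i: "\<And>a. a < k \<Longrightarrow> i a < n \<and> i' a = i a"
    and Y: "\<And>a s. a < k \<Longrightarrow> s < n \<Longrightarrow> Y a s \<in> carrier R \<and> Y' a s = Y a s"
    and u: "\<And>s. s < n \<Longrightarrow> u s \<in> carrier R \<and> u' s = u s"
  shows "in_span R n k i' Y' u'"
  unfolding in_span_def
proof (intro allI impI)
  interpret R: ring R by fact
  fix s assume s: "s < n"
  have "u s = (\<Oplus>\<^bsub>R\<^esub>a\<in>{..<k}. u (i a) \<otimes>\<^bsub>R\<^esub> Y a s)" using span s by (simp add: in_span_def)
  also have "\<dots> = (\<Oplus>\<^bsub>R\<^esub>a\<in>{..<k}. u' (i' a) \<otimes>\<^bsub>R\<^esub> Y' a s)"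
    using i Y u s by (intro R.finsum_cong') auto
  finally show "u' s = (\<Oplus>\<^bsub>R\<^esub>a\<in>{..<k}. u' (i' a) \<otimes>\<^bsub>R\<^esub> Y' a s)" using u[OF s] by simp
qed

section \<open>Transfer along ring homomorphisms\<close>

context ring_hom_cring
begin

lemma in_span_hom:
  assumes "in_span R n k i Y u" and i: "\<And>a. a < k \<Longrightarrow> i a < n"
    and Y: "\<And>a s. a < k \<Longrightarrow> s < n \<Longrightarrow> Y a s \<in> carrier R" and u: "\<And>s. s < n \<Longrightarrow> u s \<in> carrier R"
  shows "in_span S n k i (\<lambda>a s. h (Y a s)) (\<lambda>s. h (u s))"
  unfolding in_span_def
proof (intro allI impI)
  fix s assume s: "s < n"
  have "h (u s) = h (\<Oplus>a\<in>{..<k}. u (i a) \<otimes> Y a s)" using assms(1) s by (simp add: in_span_def)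
  also have "\<dots> = (\<Oplus>\<^bsub>S\<^esub>a\<in>{..<k}. h (u (i a) \<otimes> Y a s))"
    using i Y u s by (subst hom_finsum) (auto simp: comp_def)
  also have "\<dots> = (\<Oplus>\<^bsub>S\<^esub>a\<in>{..<k}. h (u (i a)) \<otimes>\<^bsub>S\<^esub> h (Y a s))"
    using i Y u s by (intro S.finsum_cong') auto
  finally show "h (u s) = (\<Oplus>\<^bsub>S\<^esub>a\<in>{..<k}. h (u (i a)) \<otimes>\<^bsub>S\<^esub> h (Y a s))" .
qed

lemma mat_apply_hom:
  assumes s: "s < n" and M: "\<And>s t. s < n \<Longrightarrow> t < n \<Longrightarrow> M (s, t) \<in> carrier R \<and> N (s, t) = h (M (s, t))"
    and u: "\<And>t. t < n \<Longrightarrow> u t \<in> carrier R"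
  shows "mat_apply n R M u s \<in> carrier R" "mat_apply n S N (\<lambda>t. h (u t)) s = h (mat_apply n R M u s)"
proof -
  have M': "M (s, t) \<in> carrier R" "N (s, t) = h (M (s, t))" if "t < n" for t using M[OF s that] by auto
  show "mat_apply n R M u s \<in> carrier R"
    using s M' u unfolding mat_apply_def by (simp add: Pi_def)
  have "h (mat_apply n R M u s) = (\<Oplus>\<^bsub>S\<^esub>t\<in>{..<n}. h (M (s, t) \<otimes> u t))"
    using s M' u unfolding mat_apply_def by (simp add: Pi_def comp_def)
  also have "\<dots> = (\<Oplus>\<^bsub>S\<^esub>t\<in>{..<n}. N (s, t) \<otimes>\<^bsub>S\<^esub> h (u t))"
    using M' u by (intro S.finsum_cong') auto
  finally show "mat_apply n S N (\<lambda>t. h (u t)) s = h (mat_apply n R M u s)"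
    using s by (simp add: mat_apply_def)
qed

lemma degenerate_hom:
  assumes deg: "degenerate R n k l I M"
    and M: "\<And>g s t. g \<in> I \<Longrightarrow> s < n \<Longrightarrow> t < n \<Longrightarrow> M g (s, t) \<in> carrier R \<and> N g (s, t) = h (M g (s, t))"
  shows "degenerate S n k l I N"
proof -
  obtain i Y j Z where Y: "echelon R n k i Y" and Z: "echelon R n l j Z"
    and u: "\<And>g. g \<in> I \<Longrightarrow> \<exists>u. (\<forall>s<n. u s \<in> carrier R) \<and> (\<exists>s<n. u s = \<one>) \<and>
          in_span R n k i Y u \<and> in_span R n l j Z (mat_apply n R (M g) u)"
    using deg unfolding degenerate_def by blast
  have D: "\<And>a. a < k \<Longrightarrow> i a < n" "\<And>a s. a < k \<Longrightarrow> s < n \<Longrightarrow> Y a s \<in> carrier R"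
    "\<And>a. a < l \<Longrightarrow> j a < n" "\<And>a s. a < l \<Longrightarrow> s < n \<Longrightarrow> Z a s \<in> carrier R"
    using Y Z by (auto simp: echelon_def)
  have ech: "echelon S n k i (\<lambda>a s. h (Y a s))" if "echelon R n k i Y" for k i Y
    using that unfolding echelon_def by auto
  have "\<exists>u. (\<forall>s<n. u s \<in> carrier S) \<and> (\<exists>s<n. u s = \<one>\<^bsub>S\<^esub>) \<and> in_span S n k i (\<lambda>a s. h (Y a s)) u \<and>
          in_span S n l j (\<lambda>a s. h (Z a s)) (mat_apply n S (N g) u)" if g: "g \<in> I" for g
  proof -
    obtain u t where u: "\<And>s. s < n \<Longrightarrow> u s \<in> carrier R" "t < n" "u t = \<one>"
      "in_span R n k i Y u" "in_span R n l j Z (mat_apply n R (M g) u)"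
      using u[OF g] by blast
    note Mu = mat_apply_hom[of _ n "M g" "N g", OF _ M[OF g] u(1)]
    have "in_span S n l j (\<lambda>a s. h (Z a s)) (mat_apply n S (N g) (\<lambda>s. h (u s)))"
    proof (rule in_span_cong[OF S.ring_axioms in_span_hom[OF u(5) D(3,4) Mu(1)]])
      show "j a < n \<and> j a = j a" if "a < l" for a using D(3) that by simp
      show "h (Z a s) \<in> carrier S \<and> h (Z a s) = h (Z a s)" if "a < l" "s < n" for a s
        using D(4) that by simp
      show "h (mat_apply n R (M g) u s) \<in> carrier S \<and>
          mat_apply n S (N g) (\<lambda>s. h (u s)) s = h (mat_apply n R (M g) u s)" if "s < n" for s
        using Mu[OF that] by simp
    qed assumption
    then show ?thesis
      using in_span_hom[OF u(4) D(1,2) u(1)] u(1-3) by (intro exI[of _ "\<lambda>s. h (u s)"]) auto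
  qed
  then show ?thesis
    unfolding degenerate_def
    by (intro exI[of _ i] exI[of _ "\<lambda>a s. h (Y a s)"] exI[of _ j] exI[of _ "\<lambda>a s. h (Z a s)"])
      (use ech[OF Y] ech[OF Z] in simp)
qed

end

section \<open>Transfer to the ultraproduct\<close>

context ultraproduct
begin

text \<open>The combination is formed in the product ring, from which \<open>germ\<close> and all
  projections are homomorphisms; the equation then passes from the factors to the germs.\<close>

lemma in_span_germ:
  assumes i: "\<And>a. a < k \<Longrightarrow> i a < n"
    and Y: "\<And>a s. a < k \<Longrightarrow> s < n \<Longrightarrow> Y a s \<in> carrier B" and u: "\<And>s. s < n \<Longrightarrow> u s \<in> carrier B"
    and span: "eventually (\<lambda>q. in_span (L q) n k i (\<lambda>a s. Y a s q) (\<lambda>s. u s q)) U"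
  shows "in_span ultra n k i (\<lambda>a s. germ (Y a s)) (\<lambda>s. germ (u s))"
  unfolding in_span_def
proof (intro allI impI)
  fix s assume s: "s < n"
  let ?w = "\<Oplus>\<^bsub>B\<^esub>a\<in>{..<k}. u (i a) \<otimes>\<^bsub>B\<^esub> Y a s"
  have t: "u (i a) \<otimes>\<^bsub>B\<^esub> Y a s \<in> carrier B" if "a < k" for a using i Y u s that by simp
  have w: "?w \<in> carrier B" using t by (intro B.finsum_closed) auto
  have "eventually (\<lambda>q. u s q = ?w q) U"
    using span U_C
  proof eventually_elim
    case (elim q)
    interpret L: cring "L q" using elim(2) by (rule cring_L)
    interpret p: ring_hom_cring B "L q" "\<lambda>f. f q" using elim(2) by (rule proj_hom)
    have "?w q = (\<Oplus>\<^bsub>L q\<^esub>a\<in>{..<k}. (u (i a) \<otimes>\<^bsub>B\<^esub> Y a s) q)"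
      using t by (subst p.hom_finsum) (auto simp: comp_def)
    also have "\<dots> = (\<Oplus>\<^bsub>L q\<^esub>a\<in>{..<k}. u (i a) q \<otimes>\<^bsub>L q\<^esub> Y a s q)"
      using i Y u s by (intro L.finsum_cong') (auto simp: p.hom_closed)
    also have "\<dots> = u s q" using elim(1) s by (simp add: in_span_def)
    finally show ?case by simp
  qed
  then have "germ (u s) = germ ?w" using germ_eq_iff[OF u[OF s] w] by simp
  also have "\<dots> = (\<Oplus>\<^bsub>ultra\<^esub>a\<in>{..<k}. germ (u (i a) \<otimes>\<^bsub>B\<^esub> Y a s))"
    using t by (subst germ.hom_finsum) (auto simp: comp_def)
  also have "\<dots> = (\<Oplus>\<^bsub>ultra\<^esub>a\<in>{..<k}. germ (u (i a)) \<otimes>\<^bsub>ultra\<^esub> germ (Y a s))"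
    using i Y u s by (intro ultra.finsum_cong') auto
  finally show "germ (u s) = (\<Oplus>\<^bsub>ultra\<^esub>a\<in>{..<k}. germ (u (i a)) \<otimes>\<^bsub>ultra\<^esub> germ (Y a s))" .
qed

text \<open>The pivots of the subspaces, and the index of the unit entry of each vector \<open>u\<close>, range over
  finite sets, hence are constant on a set of the ultrafilter.\<close>

lemma degenerate_ultra:
  assumes deg: "\<And>q. q \<in> C \<Longrightarrow> degenerate (L q) n k l I (M q)"
    and M: "\<And>q g s t. q \<in> C \<Longrightarrow> g \<in> I \<Longrightarrow> s < n \<Longrightarrow> t < n \<Longrightarrow> M q g (s, t) \<in> carrier (L q)"
    and N: "\<And>g s t. g \<in> I \<Longrightarrow> s < n \<Longrightarrow> t < n \<Longrightarrow> N g (s, t) = germ (\<lambda>q\<in>C. M q g (s, t))"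
  shows "degenerate ultra n k l I N"
proof -
  \<comment> \<open>The vectors for all \<open>g\<close> are gathered in one function
    \<open>u\<close>, so that a single choice over \<open>q\<close> provides all witnesses
    together.\<close>
  define P where "P q i Y j Z u \<longleftrightarrow> echelon (L q) n k i Y \<and> echelon (L q) n l j Z \<and>
      (\<forall>g\<in>I. (\<forall>s<n. u g s \<in> carrier (L q)) \<and> (\<exists>s<n. u g s = \<one>\<^bsub>L q\<^esub>) \<and>
        in_span (L q) n k i Y (u g) \<and> in_span (L q) n l j Z (mat_apply n (L q) (M q g) (u g)))"
    for q i Y j Z and u :: "_ \<Rightarrow> nat \<Rightarrow> 'a"
  have "\<exists>i Y j Z u. P q i Y j Z u" if "q \<in> C" for q
    using deg[OF that] unfolding degenerate_def P_def bchoice_iff by blast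
  then obtain i Y j Z u where "\<And>q. q \<in> C \<Longrightarrow> P q (i q) (Y q) (j q) (Z q) (u q)" by metis
  then have Y: "\<And>q. q \<in> C \<Longrightarrow> echelon (L q) n k (i q) (Y q)"
    and Z: "\<And>q. q \<in> C \<Longrightarrow> echelon (L q) n l (j q) (Z q)"
    and u: "\<And>q g s. q \<in> C \<Longrightarrow> g \<in> I \<Longrightarrow> s < n \<Longrightarrow> u q g s \<in> carrier (L q)"
    and u1: "\<And>q g. q \<in> C \<Longrightarrow> g \<in> I \<Longrightarrow> \<exists>s<n. u q g s = \<one>\<^bsub>L q\<^esub>"
    and uY: "\<And>q g. q \<in> C \<Longrightarrow> g \<in> I \<Longrightarrow> in_span (L q) n k (i q) (Y q) (u q g)"
    and uZ: "\<And>q g. q \<in> C \<Longrightarrow> g \<in> I \<Longrightarrow> in_span (L q) n l (j q) (Z q) (mat_apply n (L q) (M q g) (u q g))"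
    unfolding P_def by blast+
  have pivots: "\<exists>i0. (\<forall>a<k. i0 a < n) \<and> eventually (\<lambda>q. \<forall>a<k. i q a = i0 a) U"
    if Y: "\<And>q. q \<in> C \<Longrightarrow> echelon (L q) n k (i q) (Y q)" for k i Y
  proof -
    \<comment> \<open>Restriction to \<open>{..<k}\<close> leaves only finitely many possible pivot
      functions.\<close>
    have "eventually (\<lambda>q. restrict (i q) {..<k} \<in> {..<k} \<rightarrow>\<^sub>E {..<n}) U"
      using U_C by eventually_elim (use Y in \<open>simp add: restrict_PiE_iff echelon_def\<close>)
    then obtain i0 where i0: "i0 \<in> {..<k} \<rightarrow>\<^sub>E {..<n}" "eventually (\<lambda>q. restrict (i q) {..<k} = i0) U"
      using ultrafilter_finite_range[OF U, of "{..<k} \<rightarrow>\<^sub>E {..<n}"] by (metis finite_PiE finite_lessThan)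
    have "eventually (\<lambda>q. \<forall>a<k. i q a = i0 a) U"
      using i0(2) by eventually_elim (metis lessThan_iff restrict_apply')
    then show ?thesis using i0(1) by (intro exI[of _ i0]) auto
  qed
  obtain i0 where i0: "\<And>a. a < k \<Longrightarrow> i0 a < n" "eventually (\<lambda>q. \<forall>a<k. i q a = i0 a) U"
    using pivots[OF Y] by auto
  obtain j0 where j0: "\<And>a. a < l \<Longrightarrow> j0 a < n" "eventually (\<lambda>q. \<forall>a<l. j q a = j0 a) U"
    using pivots[OF Z] by auto
  define Y' where "Y' a s = (\<lambda>q\<in>C. Y q a s)" for a s
  define Z' where "Z' a s = (\<lambda>q\<in>C. Z q a s)" for a s
  define u' where "u' g s = (\<lambda>q\<in>C. u q g s)" for g s
  define M' where "M' g x = (\<lambda>q\<in>C. M q g x)" for g x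
  have mem: "(\<lambda>q\<in>C. f q) \<in> carrier B" if "\<And>q. q \<in> C \<Longrightarrow> f q \<in> carrier (L q)" for f
    using that by (simp add: product_ring_def restrict_PiE_iff)
  have Y'B: "Y' a s \<in> carrier B" if "a < k" "s < n" for a s
    unfolding Y'_def by (rule mem) (use Y that in \<open>simp add: echelon_def\<close>)
  have Z'B: "Z' a s \<in> carrier B" if "a < l" "s < n" for a s
    unfolding Z'_def by (rule mem) (use Z that in \<open>simp add: echelon_def\<close>)
  have u'B: "u' g s \<in> carrier B" if "g \<in> I" "s < n" for g s
    unfolding u'_def by (rule mem) (use u that in simp)
  have M'B: "M' g (s, t) \<in> carrier B" if "g \<in> I" "s < n" "t < n" for g s t
    unfolding M'_def by (rule mem) (use M that in simp)
  have ech: "echelon ultra n k i0 (\<lambda>a s. germ (\<lambda>q\<in>C. Y q a s))"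
    if Y: "\<And>q. q \<in> C \<Longrightarrow> echelon (L q) n k (i q) (Y q)" and Y'B: "\<And>a s. a < k \<Longrightarrow> s < n \<Longrightarrow> (\<lambda>q\<in>C. Y q a s) \<in> carrier B"
      and i0: "\<And>a. a < k \<Longrightarrow> i0 a < n" "eventually (\<lambda>q. \<forall>a<k. i q a = i0 a) U" for k i Y i0
    unfolding echelon_def
  proof (intro allI impI conjI)
    fix a b assume ab: "a < k" "b < k"
    let ?d = "if a = b then \<one>\<^bsub>B\<^esub> else \<zero>\<^bsub>B\<^esub>"
    have "eventually (\<lambda>q. (\<lambda>q\<in>C. Y q a (i0 b)) q = ?d q) U"
      using i0(2) U_C
    proof eventually_elim
      case (elim q)
      then have "Y q a (i0 b) = Y q a (i q b)" using ab by simp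
      also have "\<dots> = (if a = b then \<one>\<^bsub>L q\<^esub> else \<zero>\<^bsub>L q\<^esub>)"
        using Y[OF elim(2)] ab by (simp add: echelon_def)
      finally show ?case using elim(2) by (simp add: product_ring_apply)
    qed
    then have "germ (\<lambda>q\<in>C. Y q a (i0 b)) = germ ?d"
      using germ_eq_iff[OF Y'B[OF ab(1) i0(1)[OF ab(2)]], of ?d] by (simp split: if_splits)
    then show "germ (\<lambda>q\<in>C. Y q a (i0 b)) = (if a = b then \<one>\<^bsub>ultra\<^esub> else \<zero>\<^bsub>ultra\<^esub>)" by simp
  qed (use i0 Y'B germ.hom_closed in blast)+
  have "\<exists>v. (\<forall>s<n. v s \<in> carrier ultra) \<and> (\<exists>s<n. v s = \<one>\<^bsub>ultra\<^esub>) \<and>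
      in_span ultra n k i0 (\<lambda>a s. germ (Y' a s)) v \<and>
      in_span ultra n l j0 (\<lambda>a s. germ (Z' a s)) (mat_apply n ultra (N g) v)" if g: "g \<in> I" for g
  proof (intro exI[of _ "\<lambda>s. germ (u' g s)"] conjI)
    show "\<forall>s<n. germ (u' g s) \<in> carrier ultra" using u'B[OF g] by simp
    \<comment> \<open>The position of the unit entry is frozen for one \<open>g\<close> at a time.
      The set of the ultrafilter on which it is constant may depend on \<open>g\<close>, so
      infinitely many \<open>g\<close> are allowed.\<close>
    obtain t where t: "\<And>q. q \<in> C \<Longrightarrow> t q < n \<and> u q g (t q) = \<one>\<^bsub>L q\<^esub>" using u1[OF _ g] by metis
    have "eventually (\<lambda>q. t q \<in> {..<n}) U" using U_C by eventually_elim (use t in simp)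
    then obtain t0 where t0: "t0 < n" "eventually (\<lambda>q. t q = t0) U"
      using ultrafilter_finite_range[OF U, of "{..<n}"] by (metis finite_lessThan lessThan_iff)
    have "eventually (\<lambda>q. u' g t0 q = \<one>\<^bsub>B\<^esub> q) U"
      using t0(2) U_C by eventually_elim (use t in \<open>auto simp: u'_def product_ring_apply\<close>)
    then have "germ (u' g t0) = \<one>\<^bsub>ultra\<^esub>"
      using germ_eq_iff[OF u'B[OF g t0(1)] B.one_closed] by simp
    then show "\<exists>s<n. germ (u' g s) = \<one>\<^bsub>ultra\<^esub>" using t0(1) by blast
    show "in_span ultra n k i0 (\<lambda>a s. germ (Y' a s)) (\<lambda>s. germ (u' g s))"
    proof (rule in_span_germ[OF i0(1) Y'B u'B[OF g]])
      show "eventually (\<lambda>q. in_span (L q) n k i0 (\<lambda>a s. Y' a s q) (\<lambda>s. u' g s q)) U"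
        using i0(2) U_C
      proof eventually_elim
        case (elim q)
        show ?case
        proof (rule in_span_cong[OF cring.axioms(1)[OF cring_L[OF elim(2)]] uY[OF elim(2) g]])
          show "i q a < n \<and> i0 a = i q a" if "a < k" for a
            using Y[OF elim(2)] elim(1) that by (simp add: echelon_def)
          show "Y q a s \<in> carrier (L q) \<and> Y' a s q = Y q a s" if "a < k" "s < n" for a s
            using Y[OF elim(2)] elim(2) that by (simp add: echelon_def Y'_def)
          show "u q g s \<in> carrier (L q) \<and> u' g s q = u q g s" if "s < n" for s
            using u[OF elim(2) g that] elim(2) by (simp add: u'_def)
        qed
      qed
    qed
    \<comment> \<open>The image vector is computed in the product ring, where its germ and its
      components can both be identified.\<close>
    let ?v = "mat_apply n B (M' g) (u' g)"
    have v: "?v s \<in> carrier B" "mat_apply n ultra (N g) (\<lambda>s. germ (u' g s)) s = germ (?v s)"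
      if s: "s < n" for s
      using germ.mat_apply_hom[of s n "M' g" "N g" "u' g", OF s] M'B[OF g] N[OF g] u'B[OF g]
      by (auto simp: M'_def)
    have vq: "?v s q = mat_apply n (L q) (M q g) (u q g) s \<and> ?v s q \<in> carrier (L q)"
      if s: "s < n" and q: "q \<in> C" for s q
    proof -
      interpret p: ring_hom_cring B "L q" "\<lambda>f. f q" using q by (rule proj_hom)
      have "M' g x q = M q g x" for x using q by (simp add: M'_def)
      then have "mat_apply n (L q) (M q g) (\<lambda>t. u' g t q) s = ?v s q"
        using M'B[OF g] u'B[OF g] by (intro p.mat_apply_hom(2)[OF s]) simp_all
      moreover have "mat_apply n (L q) (M q g) (\<lambda>t. u' g t q) = mat_apply n (L q) (M q g) (u q g)"
        using q by (simp add: u'_def)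
      ultimately show ?thesis using p.hom_closed[OF v(1)[OF s]] by simp
    qed
    have "in_span ultra n l j0 (\<lambda>a s. germ (Z' a s)) (\<lambda>s. germ (?v s))"
    proof (rule in_span_germ[OF j0(1) Z'B v(1)])
      show "eventually (\<lambda>q. in_span (L q) n l j0 (\<lambda>a s. Z' a s q) (\<lambda>s. ?v s q)) U"
        using j0(2) U_C
      proof eventually_elim
        case (elim q)
        show ?case
        proof (rule in_span_cong[OF cring.axioms(1)[OF cring_L[OF elim(2)]] uZ[OF elim(2) g]])
          show "j q a < n \<and> j0 a = j q a" if "a < l" for a
            using Z[OF elim(2)] elim(1) that by (simp add: echelon_def)
          show "Z q a s \<in> carrier (L q) \<and> Z' a s q = Z q a s" if "a < l" "s < n" for a s
            using Z[OF elim(2)] elim(2) that by (simp add: echelon_def Z'_def)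
          show "mat_apply n (L q) (M q g) (u q g) s \<in> carrier (L q) \<and>
              ?v s q = mat_apply n (L q) (M q g) (u q g) s" if "s < n" for s
            using conjunct1[OF vq[OF that elim(2)]] conjunct2[OF vq[OF that elim(2)]] by simp
        qed
      qed
    qed
    then show "in_span ultra n l j0 (\<lambda>a s. germ (Z' a s)) (mat_apply n ultra (N g) (\<lambda>s. germ (u' g s)))"
      by (rule in_span_cong[OF ultra.ring_axioms])
        (use j0(1) Z'B v in auto)
  qed
  moreover have "echelon ultra n k i0 (\<lambda>a s. germ (Y' a s))"
    unfolding Y'_def by (rule ech[OF Y Y'B[unfolded Y'_def] i0])
  moreover have "echelon ultra n l j0 (\<lambda>a s. germ (Z' a s))"
    unfolding Z'_def by (rule ech[OF Z Z'B[unfolded Z'_def] j0])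
  ultimately show ?thesis
    unfolding degenerate_def
    by (intro exI[of _ i0] exI[of _ "\<lambda>a s. germ (Y' a s)"] exI[of _ j0] exI[of _ "\<lambda>a s. germ (Z' a s)"]) simp
qed

end

section \<open>Closedness of the degenerate locus\<close>

text \<open>The condition on \<open>\<Inter>C\<close> places \<open>p\<close> in the closure of
  \<open>C\<close>; intersecting with \<open>carrier A\<close> gives it the right meaning for empty
  \<open>C\<close> too. The fields enter only through homomorphisms \<open>h q\<close> with kernel
  \<open>q\<close>.\<close>

lemma degenerate_closed:
  fixes A :: "('a, 'e) ring_scheme" and L :: "'a set \<Rightarrow> ('b, 'f) ring_scheme"
  assumes A: "cring A" and C: "C \<subseteq> Spec A" and p: "p \<in> Spec A" and Cp: "carrier A \<inter> \<Inter>C \<subseteq> p"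
    and L: "\<And>q. q \<in> Spec A \<Longrightarrow> algebraically_closed (L q)"
    and h: "\<And>q. q \<in> Spec A \<Longrightarrow> h q \<in> ring_hom A (L q)"
    and ker: "\<And>q a. q \<in> Spec A \<Longrightarrow> a \<in> carrier A \<Longrightarrow> h q a = \<zero>\<^bsub>L q\<^esub> \<longleftrightarrow> a \<in> q"
    and M: "\<And>g. g \<in> I \<Longrightarrow> M g \<in> carrier (mat_monoid n A)"
    and deg: "\<And>q. q \<in> C \<Longrightarrow> degenerate (L q) n k l I (\<lambda>g. mat_map n (h q) (M g))"
  shows "degenerate (L p) n k l I (\<lambda>g. mat_map n (h p) (M g))"
proof -
  interpret A: cring A by fact
  interpret p: primeideal p A using p by (simp add: Spec_def)
  interpret Lp: algebraically_closed "L p" using L[OF p] .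
  have prime: "primeideal q A" if "q \<in> C" for q using that C by (auto simp: Spec_def)
  have Lq: "field (L q)" if "q \<in> C" for q
    using L[of q] that C by (auto simp: algebraically_closed_def)
  have Mc: "M g (s, t) \<in> carrier A" if "g \<in> I" "s < n" "t < n" for g s t
    using A.mat_carrierD[OF M] that by blast
  \<comment> \<open>Each base set is nonempty because \<open>p\<close> lies in the closure of
    \<open>C\<close>. The base is directed: \<open>p\<close> is prime, so products of elements
    outside \<open>p\<close> stay outside, and an ideal \<open>q\<close> missing a product misses
    both factors.\<close>
  obtain U where U: "ultrafilter U" and U_base: "\<And>a. a \<in> carrier A - p \<Longrightarrow> eventually (\<lambda>q. q \<in> {q \<in> C. a \<notin> q}) U"
  proof (rule ultrafilter_of_base[of "carrier A - p" "\<lambda>a. {q \<in> C. a \<notin> q}"])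
    show "carrier A - p \<noteq> {}" using p.I_notcarr p.a_subset by blast
    show "{q \<in> C. a \<notin> q} \<noteq> {}" if "a \<in> carrier A - p" for a using Cp that by blast
    show "\<exists>c\<in>carrier A - p. {q \<in> C. c \<notin> q} \<subseteq> {q \<in> C. a \<notin> q} \<inter> {q \<in> C. b \<notin> q}"
      if ab: "a \<in> carrier A - p" "b \<in> carrier A - p" for a b
    proof
      show "a \<otimes>\<^bsub>A\<^esub> b \<in> carrier A - p" using p.I_prime[of a b] ab by auto
      show "{q \<in> C. a \<otimes>\<^bsub>A\<^esub> b \<notin> q} \<subseteq> {q \<in> C. a \<notin> q} \<inter> {q \<in> C. b \<notin> q}"
      proof
        fix q assume "q \<in> {q \<in> C. a \<otimes>\<^bsub>A\<^esub> b \<notin> q}"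
        then have q: "q \<in> C" "a \<otimes>\<^bsub>A\<^esub> b \<notin> q" by auto
        interpret q: primeideal q A using prime[OF q(1)] .
        show "q \<in> {q \<in> C. a \<notin> q} \<inter> {q \<in> C. b \<notin> q}"
          using q q.I_l_closed[of b a] q.I_r_closed[of a b] ab by blast
      qed
    qed
  qed (rule that; assumption)
  have "\<one>\<^bsub>A\<^esub> \<in> carrier A - p" using p.I_notcarr p.one_imp_carrier by blast
  from U_base[OF this] have U_C: "eventually (\<lambda>q. q \<in> C) U" by eventually_elim simp
  interpret ultraproduct U C L by (rule ultraproduct.intro[OF U U_C Lq])
  interpret ult: field ultra by (rule field_ultra)
  define f where "f a = (\<lambda>q\<in>C. h q a)" for a
  have f: "f \<in> ring_hom A B"
  proof (rule ring_hom_memI)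
    note hC = h[OF subsetD[OF C]]
    fix a b assume ab: "a \<in> carrier A" "b \<in> carrier A"
    show "f a \<in> carrier B"
      using ring_hom_closed[OF hC ab(1)] by (simp add: f_def product_ring_def restrict_PiE_iff)
    show "f (a \<otimes>\<^bsub>A\<^esub> b) = f a \<otimes>\<^bsub>B\<^esub> f b"
      unfolding f_def product_ring_def by (auto simp: ring_hom_mult[OF hC ab] intro!: restrict_ext)
    show "f (a \<oplus>\<^bsub>A\<^esub> b) = f a \<oplus>\<^bsub>B\<^esub> f b"
      unfolding f_def product_ring_def by (auto simp: ring_hom_add[OF hC ab] intro!: restrict_ext)
  next
    show "f \<one>\<^bsub>A\<^esub> = \<one>\<^bsub>B\<^esub>"
      unfolding f_def product_ring_def by (auto simp: ring_hom_one[OF h[OF subsetD[OF C]]] intro!: restrict_ext)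
  qed
  interpret f: ring_hom_ring A B f using f by (rule ring_hom_ringI2[OF A.ring_axioms B.ring_axioms])
  have gf: "germ \<circ> f \<in> ring_hom A ultra" by (rule ring_hom_trans[OF f germ_hom])
  \<comment> \<open>An element outside \<open>p\<close> avoids \<open>q\<close> for all
    \<open>q\<close> in a set of the ultrafilter, so its germ is nonzero. Hence \<open>h p\<close>
    factors through the image of \<open>A\<close> in the ultraproduct.\<close>
  have ker_gf: "h p a = \<zero>\<^bsub>L p\<^esub>" if a: "a \<in> carrier A" "(germ \<circ> f) a = \<zero>\<^bsub>ultra\<^esub>" for a
  proof (rule ccontr)
    assume "h p a \<noteq> \<zero>\<^bsub>L p\<^esub>"
    then have "a \<in> carrier A - p" using ker[OF p a(1)] a(1) by simp
    note ev1 = U_base[OF this]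
    have "germ (f a) = germ \<zero>\<^bsub>B\<^esub>" using a(2) by simp
    then have ev2: "eventually (\<lambda>q. f a q = \<zero>\<^bsub>B\<^esub> q) U"
      using germ_eq_iff[OF f.hom_closed[OF a(1)] B.zero_closed] by simp
    from ev1 ev2 have "eventually (\<lambda>q. False) U"
    proof eventually_elim
      case (elim q)
      then have "h q a = \<zero>\<^bsub>L q\<^esub>" "q \<in> Spec A" "a \<notin> q"
        using C by (auto simp: f_def product_ring_apply)
      then show ?case using ker[OF _ a(1)] by blast
    qed
    then show False using U by (simp add: ultrafilter_def trivial_limit_def)
  qed
  obtain \<psi> where \<psi>: "\<psi> \<in> ring_hom (ultra\<lparr>carrier := (germ \<circ> f) ` carrier A\<rparr>) (L p)"
    "\<And>a. a \<in> carrier A \<Longrightarrow> \<psi> ((germ \<circ> f) a) = h p a"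
    by (rule ring_hom_factor[OF A.ring_axioms ultra.ring_axioms Lp.ring_axioms gf h[OF p] ker_gf],
        assumption, assumption) (rule that; assumption)
  have sub: "subring ((germ \<circ> f) ` carrier A) ultra"
    using ring_hom_ring.img_is_subring[OF ring_hom_ringI2[OF A.ring_axioms ultra.ring_axioms gf] A.carrier_is_subring] .
  \<comment> \<open>Chevalley's theorem: the factored map extends to a valuation ring
    \<open>R\<close> of the ultraproduct, still with values in \<open>L p\<close>.\<close>
  obtain R \<phi> where "maximal_partial_hom ultra (L p) R \<phi>" and R: "(germ \<circ> f) ` carrier A \<subseteq> R"
    and \<phi>\<psi>: "\<And>y. y \<in> (germ \<circ> f) ` carrier A \<Longrightarrow> \<phi> y = \<psi> y"
    by (rule exists_maximal_partial_hom[OF field_ultra L[OF p] sub \<psi>(1)]) (rule that; assumption)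
  then interpret max: maximal_partial_hom ultra "L p" R \<phi> by simp
  interpret val: valuation_subring ultra R
    by (intro valuation_subring.intro valuation_subring_axioms.intro field_ultra max.subring max.valuation_ring)
  define N where "N g = mat_map n (germ \<circ> f) (M g)" for g
  have N: "N g (s, t) = (germ \<circ> f) (M g (s, t))" if "s < n" "t < n" for g s t
    using that by (simp add: N_def mat_map_def)
  have "degenerate ultra n k l I N"
  proof (rule degenerate_ultra[OF deg])
    fix q g s t assume q: "q \<in> C" and st: "g \<in> I" "s < n" "t < n"
    show "mat_map n (h q) (M g) (s, t) \<in> carrier (L q)"
      using ring_hom_closed[OF h Mc[OF st]] q C st by (auto simp: mat_map_def)
  next
    fix g s t assume st: "g \<in> I" "s < n" "t < n"
    show "N g (s, t) = germ (\<lambda>q\<in>C. mat_map n (h q) (M g) (s, t))"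
      using st by (simp add: N f_def mat_map_def)
  qed
  moreover have Nc: "N g \<in> carrier (mat_monoid n ultra)" if "g \<in> I" for g
    unfolding N_def using mat_map_hom(1)[OF A ultra.is_cring gf] M[OF that] by (rule hom_in_carrier)
  \<comment> \<open>The echelon families obtained from the factors need not have entries in
    \<open>R\<close>. Passing to the subspaces makes it possible to choose families over
    \<open>R\<close> for them.\<close>
  ultimately have "ult.meeting_subspaces n k l I N"
    using ult.meeting_subspaces_iff[of I N n k l] by simp
  moreover have "N g (s, t) \<in> R" if "g \<in> I" "s < n" "t < n" for g s t
    using R Mc[OF that] N[OF that(2,3)] by auto
  ultimately have "degenerate (ultra\<lparr>carrier := R\<rparr>) n k l I N"
    using val.meeting_subspaces_imp_degenerate Nc by blast
  then show ?thesis
  proof (rule max.\<phi>.degenerate_hom)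
    fix g s t assume st: "g \<in> I" "s < n" "t < n"
    have "\<phi> (N g (s, t)) = h p (M g (s, t))"
      using \<phi>\<psi>[of "N g (s, t)"] \<psi>(2)[OF Mc[OF st]] Mc[OF st] N[OF st(2,3)] by simp
    then show "N g (s, t) \<in> carrier (ultra\<lparr>carrier := R\<rparr>) \<and> mat_map n (h p) (M g) (s, t) = \<phi> (N g (s, t))"
      using R Mc[OF st] N[OF st(2,3)] st by (auto simp: mat_map_def)
  qed
qed

section \<open>Specialization to closures of residue fields\<close>

lemma to_residue_field_eq_zero_iff:
  assumes "cring A" "p \<in> Spec A" "a \<in> carrier A"
  shows "to_residue_field A p a = \<zero>\<^bsub>residue_field A p\<^esub> \<longleftrightarrow> a \<in> p"
proof -
  interpret A: cring A by fact
  interpret p: primeideal p A using assms by (simp add: Spec_def)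
  interpret Q: domain "A Quot p" by (rule p.quotient_is_domain)
  have a: "p +>\<^bsub>A\<^esub> a \<in> carrier (A Quot p)" using ring_hom_closed[OF p.rcos_ring_hom assms(3)] .
  have zero: "\<zero>\<^bsub>A Quot p\<^esub> = p" by (simp add: FactRing_def)
  have "to_residue_field A p a = \<zero>\<^bsub>residue_field A p\<^esub> \<longleftrightarrow> p +>\<^bsub>A\<^esub> a = \<zero>\<^bsub>A Quot p\<^esub>"
    unfolding to_residue_field_def residue_field_def Q.fraction_field_zero
    using a by (subst Q.fraction_eq_iff) auto
  also have "\<dots> \<longleftrightarrow> a \<in> p"
    unfolding zero using A.a_rcos_zero[OF p.ideal_axioms] A.a_coset_join1[OF _ assms(3)] p.a_rcos_self[of a] assms(3)
    by (metis p.a_rcos_const p.a_rcos_self assms(3))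
  finally show ?thesis .
qed

lemma field_hom_eq_zero_iff:
  assumes "field K" "field L" "\<phi> \<in> ring_hom K L" "x \<in> carrier K"
  shows "\<phi> x = \<zero>\<^bsub>L\<^esub> \<longleftrightarrow> x = \<zero>\<^bsub>K\<^esub>"
proof -
  interpret K: field K by fact
  interpret L: field L by fact
  interpret \<phi>: ring_hom_ring K L \<phi> using assms(3) by (rule ring_hom_ringI2[OF K.ring_axioms L.ring_axioms])
  have "x = \<zero>\<^bsub>K\<^esub>" if "\<phi> x = \<zero>\<^bsub>L\<^esub>"
  proof (rule ccontr)
    assume "x \<noteq> \<zero>\<^bsub>K\<^esub>"
    then have "inv\<^bsub>K\<^esub> x \<in> carrier K" "x \<otimes>\<^bsub>K\<^esub> inv\<^bsub>K\<^esub> x = \<one>\<^bsub>K\<^esub>" using assms(4) by (simp_all add: K.field_Units)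
    then have "\<phi> x \<otimes>\<^bsub>L\<^esub> \<phi> (inv\<^bsub>K\<^esub> x) = \<one>\<^bsub>L\<^esub>" using \<phi>.hom_mult[OF assms(4), of "inv\<^bsub>K\<^esub> x"] by simp
    then show False using that \<open>inv\<^bsub>K\<^esub> x \<in> carrier K\<close> by simp
  qed
  then show ?thesis by auto
qed

definition to_residue_closure ::
    "('a, 'e) ring_scheme \<Rightarrow> 'a set \<Rightarrow> 'a \<Rightarrow> (('a set \<times> 'a set) set list \<times> nat) multiset \<Rightarrow> ('a set \<times> 'a set) set" where
  "to_residue_closure A p = ring.indexed_const (residue_field A p) \<circ> to_residue_field A p"

text \<open>These are the properties of \<open>L\<close> and \<open>h\<close> that
  \<open>degenerate_closed\<close> assumes. The kernel is still \<open>p\<close> because a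
  homomorphism of fields is injective.\<close>

lemma residue_closure:
  assumes A: "cring A" and p: "p \<in> Spec A"
  defines "L \<equiv> field.alg_closure (residue_field A p)"
  shows "algebraically_closed L" "to_residue_closure A p \<in> ring_hom A L"
    "a \<in> carrier A \<Longrightarrow> to_residue_closure A p a = \<zero>\<^bsub>L\<^esub> \<longleftrightarrow> a \<in> p"
proof -
  let ?K = "residue_field A p"
  interpret K: field ?K using p by (rule field_residue_field)
  interpret L: algebraic_closure L "K.indexed_const ` carrier ?K"
    unfolding L_def by (rule K.alg_closureE(1))
  have \<iota>: "K.indexed_const \<in> ring_hom ?K L" unfolding L_def by (rule K.alg_closureE(2))
  have \<tau>: "to_residue_field A p \<in> ring_hom A ?K" by (rule ring_hom_to_residue_field[OF p])
  show "algebraically_closed L" by (rule L.algebraically_closed_axioms)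
  show "to_residue_closure A p \<in> ring_hom A L"
    unfolding to_residue_closure_def by (rule ring_hom_trans[OF \<tau> \<iota>])
  show "to_residue_closure A p a = \<zero>\<^bsub>L\<^esub> \<longleftrightarrow> a \<in> p" if a: "a \<in> carrier A"
    using field_hom_eq_zero_iff[OF K.field_axioms L.field_axioms \<iota> ring_hom_closed[OF \<tau> a]]
      to_residue_field_eq_zero_iff[OF A p a]
    by (simp add: to_residue_closure_def)
qed

text \<open>The universal representation takes values in invertible matrices and homomorphisms
  preserve this, so the criterion for thickness by intersections applies over the closure. The
  matrices are thereby specialized from one family over \<open>rep_ring n G\<close>, as the
  closedness argument requires.\<close>

lemma absolutely_thick_at_rep_iff:
  assumes G: "group G" and x: "x \<in> topspace (Rep n G)" and "m \<le> n"
  shows "absolutely_thick_at G (residue_field_at n G x) n (rep_at n G x) m \<longleftrightarrow>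
    \<not> degenerate (field.alg_closure (residue_field_at n G x)) n m (n - m) (carrier G)
      (\<lambda>g. mat_map n (to_residue_closure (rep_ring n G) x) (universal_rep n G g))"
proof -
  let ?A = "rep_ring n G"
  let ?K = "residue_field_at n G x" and ?h = "to_residue_closure ?A x"
  let ?L = "field.alg_closure ?K" and ?M = "\<lambda>g. mat_map n ?h (universal_rep n G g)"
  have xA: "x \<in> Spec ?A" using x topspace_Rep[OF G] by simp
  note A = cring_rep_ring[OF G, of n]
  note rc = residue_closure[OF A xA]
  interpret L: algebraically_closed ?L by (rule rc(1))
  have "?M \<in> hom G (GL n ?L)"
    by (rule hom_GL_mat_map[OF G A L.is_cring rc(2) universal_rep_hom[OF G]])
  then have M: "?M g \<in> Units (mat_monoid n ?L)" if "g \<in> carrier G" for g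
    using hom_in_carrier that by (fastforce simp: GL_def units_of_def)
  have \<rho>: "closure_rep ?K n (rep_at n G x) g = mat_apply n ?L (?M g)" for g
    by (auto simp: closure_rep_def rep_at_def mat_map_def to_residue_closure_def intro!: arg_cong[of _ _ "mat_apply n ?L"])
  have "thick_at G ?L (std_space n ?L) (closure_rep ?K n (rep_at n G x)) m \<longleftrightarrow>
      \<not> L.meeting_subspaces n m (n - m) (carrier G) ?M"
    by (rule L.thick_at_iff[OF assms(3) M \<rho>])
  also have "L.meeting_subspaces n m (n - m) (carrier G) ?M \<longleftrightarrow> degenerate ?L n m (n - m) (carrier G) ?M"
    by (rule L.meeting_subspaces_iff) (use M in \<open>auto simp: Units_def\<close>)
  finally show ?thesis unfolding absolutely_thick_at_def .
qed

lemma openin_absolutely_thick_at: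
  assumes G: "group G" and "m \<le> n"
  shows "openin (Rep n G) {x \<in> topspace (Rep n G).
    absolutely_thick_at G (residue_field_at n G x) n (rep_at n G x) m}" (is "openin _ ?T")
proof -
  let ?A = "rep_ring n G"
  let ?L = "\<lambda>x. field.alg_closure (residue_field_at n G x)"
  let ?M = "\<lambda>x g. mat_map n (to_residue_closure ?A x) (universal_rep n G g)"
  note A = cring_rep_ring[OF G, of n]
  interpret A: cring ?A by (rule A)
  define C where "C = {x \<in> Spec ?A. degenerate (?L x) n m (n - m) (carrier G) (?M x)}"
  have U: "universal_rep n G g \<in> carrier (mat_monoid n ?A)" if "g \<in> carrier G" for g
    using hom_in_carrier[OF universal_rep_hom[OF G] that] by (auto simp: GL_def units_of_def Units_def)
  \<comment> \<open>The degenerate locus is shown to equal the zero set of the functions vanishing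
    on it; this inclusion is the substantial one.\<close>
  have "vanishing_set ?A (carrier ?A \<inter> \<Inter>C) \<subseteq> C"
  proof
    fix p assume "p \<in> vanishing_set ?A (carrier ?A \<inter> \<Inter>C)"
    then have p: "p \<in> Spec ?A" "carrier ?A \<inter> \<Inter>C \<subseteq> p" by (auto simp: vanishing_set_def)
    have "degenerate (?L p) n m (n - m) (carrier G) (?M p)"
      by (rule degenerate_closed[OF A _ p residue_closure[OF A] U]) (auto simp: C_def)
    then show "p \<in> C" using p by (simp add: C_def)
  qed
  moreover have "C \<subseteq> vanishing_set ?A (carrier ?A \<inter> \<Inter>C)" by (auto simp: vanishing_set_def C_def)
  ultimately have C: "C = vanishing_set ?A (carrier ?A \<inter> \<Inter>C)" by simp
  have "?T = Spec ?A - C"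
    using absolutely_thick_at_rep_iff[OF G _ assms(2)] topspace_Rep[OF G, of n] by (auto simp: C_def)
  then have "?T = Spec ?A - vanishing_set ?A (carrier ?A \<inter> \<Inter>C)" using C by simp
  then show ?thesis unfolding Rep_def openin_zariski[OF A] by blast
qed

theorem theorem1p1:
  fixes G :: "('g, 'h) monoid_scheme" and n :: nat
  assumes "group G" and "0 < n"
  shows "(\<forall>m. 0 < m \<and> m < n \<longrightarrow>
            openin (Rep n G)
              {x \<in> topspace (Rep n G).
                 absolutely_thick_at G (residue_field_at n G x) n (rep_at n G x) m}) \<and>
         openin (Rep n G)
           {x \<in> topspace (Rep n G).
              absolutely_thick G (residue_field_at n G x) n (rep_at n G x)}"
proof -
  let ?X = "topspace (Rep n G)"
  let ?T = "\<lambda>m. {x \<in> ?X. absolutely_thick_at G (residue_field_at n G x) n (rep_at n G x) m}"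
  have open_at: "openin (Rep n G) (?T m)" if "m < n" for m
    using openin_absolutely_thick_at[OF assms(1)] that by simp
  have "absolutely_thick G (residue_field_at n G x) n (rep_at n G x) \<longleftrightarrow>
      (\<forall>m\<in>{0<..<n}. absolutely_thick_at G (residue_field_at n G x) n (rep_at n G x) m)" if x: "x \<in> ?X" for x
  proof -
    have "x \<in> Spec (rep_ring n G)" using x topspace_Rep[OF assms(1)] by simp
    from residue_closure(1)[OF cring_rep_ring[OF assms(1)] this]
    interpret L: algebraically_closed "field.alg_closure (residue_field_at n G x)" .
    show ?thesis
      unfolding absolutely_thick_def thick_def absolutely_thick_at_def L.dim_std_space by auto
  qed
  \<comment> \<open>Intersecting with \<open>?X\<close> makes the empty intersection, which occurs
    for \<open>n = 1\<close>, the whole space.\<close>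
  then have eq: "{x \<in> ?X. absolutely_thick G (residue_field_at n G x) n (rep_at n G x)} =
      ?X \<inter> (\<Inter>m\<in>{0<..<n}. ?T m)" by auto
  have "openin (Rep n G) (?X \<inter> (\<Inter>m\<in>J. ?T m))" if "finite J" "J \<subseteq> {0<..<n}" for J
    using that
  proof (induction J rule: finite_induct)
    case (insert m J)
    have "?X \<inter> (\<Inter>m\<in>insert m J. ?T m) = ?T m \<inter> (?X \<inter> (\<Inter>m\<in>J. ?T m))" by auto
    then show ?case using insert open_at[of m] by (simp add: openin_Int)
  qed simp
  from this[of "{0<..<n}"] show ?thesis using open_at unfolding eq by simp
qed

end
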